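(* Let $r\ge 2$ and let $s,p,n$ be positive integers with $n=4p=2r+s$ and $p+s+2=n+1$. There are two trees with passport $[r^2,1^s;4^p;n]$; in each, exactly one white vertex (the center) is adjacent to both black vertices of degree $r$ and to two black leaves. For the tree in which the two black leaves are not consecutive in the cyclic order around the center, the monodromy group $G$ is isomorphic to a semidirect product $$G\cong\begin{cases}A_p^2\rtimes\mathbb{Z}_4 & \text{if } r\equiv1\pmod 2,\\ S_p^2\rtimes\mathbb{Z}_4 & \text{if } r\equiv 0\pmod 2.\end{cases}$$ For the tree in which the two black leaves are consecutive around the center, the monodromy group $G$ is isomorphic to a semidirect product $$G\cong\begin{cases}A_p^4\rtimes(\mathbb{Z}_2^3\rtimes\mathbb{Z}_4) & \text{if } r\equiv 0\pmod 2,\\ A_p^4\rtimes\mathbb{Z}_4 & \text{if } r\equiv1\pmod 2.\end{cases}$$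
   Context: A tree is a bicolored (black/white) plane tree, up to color- and orientation-preserving isomorphism. The passport $[\alpha;\beta;n]$ of a tree with $n$ edges records the partition $\alpha\vdash n$ of black vertex degrees and $\beta\vdash n$ of white vertex degrees ($k^m$ means $k$ repeated $m$ times). Label the edges by $1,\dots,n$; let $\sigma_0\in S_n$ (resp. $\sigma_1$) be the permutation whose cycles are the cyclic orders of edges around the black (resp. white) vertices. The monodromy group is $\langle\sigma_0,\sigma_1\rangle\le S_n$ (well defined up to conjugacy). $A_m$, $S_m$ are the alternating and symmetric groups and $\mathbb{Z}_m$ is the cyclic group of order $m$. *)

theory Defs
  imports "HOL-Algebra.Algebra" "HOL-Combinatorics.Orbits"
begin

section \<open>Bicolored plane trees\<close>

text \<open>Every edge \<open>e\<close> joins the black vertex \<open>black_end T e\<close> to the white vertex \<open>white_end T e\<close>.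
  The plane structure is given by the cyclic order of the edges around each vertex:
  \<open>rot T v e\<close> is the edge following \<open>e\<close> counterclockwise around \<open>v\<close>. Only the values at edges
  \<open>e\<close> incident to \<open>v\<close> are meaningful.\<close>

record ('v, 'e) bicolored_map =
  blacks :: "'v set"
  whites :: "'v set"
  edges :: "'e set"
  black_end :: "'e \<Rightarrow> 'v"
  white_end :: "'e \<Rightarrow> 'v"
  rot :: "'v \<Rightarrow> 'e \<Rightarrow> 'e"

definition vertices :: "('v, 'e) bicolored_map \<Rightarrow> 'v set" where
  "vertices T = blacks T \<union> whites T"

definition incident :: "('v, 'e) bicolored_map \<Rightarrow> 'v \<Rightarrow> 'e set" where
  "incident T v = {e \<in> edges T. black_end T e = v \<or> white_end T e = v}"

definition vdegree :: "('v, 'e) bicolored_map \<Rightarrow> 'v \<Rightarrow> nat" where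
  "vdegree T v = card (incident T v)"

definition adjacent :: "('v, 'e) bicolored_map \<Rightarrow> 'v \<Rightarrow> 'v \<Rightarrow> bool" where
  "adjacent T u v \<longleftrightarrow> (\<exists>e\<in>edges T. {black_end T e, white_end T e} = {u, v})"

definition connected_graph :: "('v, 'e) bicolored_map \<Rightarrow> bool" where
  "connected_graph T \<longleftrightarrow>
     vertices T \<noteq> {} \<and> (\<forall>u\<in>vertices T. \<forall>v\<in>vertices T. (adjacent T)\<^sup>*\<^sup>* u v)"

text \<open>The closed path \<open>vs ! 0, es ! 0, vs ! 1, es ! 1, \<dots>\<close>, with indices modulo its length,
  without repeated vertices or edges. Two parallel edges form a cycle of length 2.\<close>

definition graph_cycle :: "('v, 'e) bicolored_map \<Rightarrow> 'v list \<Rightarrow> 'e list \<Rightarrow> bool" where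
  "graph_cycle T vs es \<longleftrightarrow>
     es \<noteq> [] \<and> length vs = length es \<and> distinct vs \<and> distinct es \<and> set es \<subseteq> edges T \<and>
     (\<forall>i<length es. {black_end T (es ! i), white_end T (es ! i)}
                     = {vs ! i, vs ! (Suc i mod length vs)})"

text \<open>The empty set is not \<^const>\<open>cyclic_on\<close>, so there are no isolated vertices, that is, the tree
  consisting of a single vertex is excluded.\<close>

definition plane_tree :: "('v, 'e) bicolored_map \<Rightarrow> bool" where
  "plane_tree T \<longleftrightarrow>
     finite (vertices T) \<and> finite (edges T) \<and> blacks T \<inter> whites T = {} \<and>
     black_end T ` edges T \<subseteq> blacks T \<and> white_end T ` edges T \<subseteq> whites T \<and>
     connected_graph T \<and> (\<nexists>vs es. graph_cycle T vs es) \<and>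
     (\<forall>v\<in>vertices T. cyclic_on (rot T v) (incident T v))"

text \<open>Isomorphisms preserve the colors and the cyclic orders, hence the orientation of the plane.\<close>

definition map_iso :: "('v, 'e) bicolored_map \<Rightarrow> ('w, 'f) bicolored_map \<Rightarrow> bool" where
  "map_iso T T' \<longleftrightarrow> (\<exists>f g.
     bij_betw f (vertices T) (vertices T') \<and> f ` blacks T = blacks T' \<and> f ` whites T = whites T' \<and>
     bij_betw g (edges T) (edges T') \<and>
     (\<forall>e\<in>edges T. black_end T' (g e) = f (black_end T e) \<and> white_end T' (g e) = f (white_end T e)) \<and>
     (\<forall>v\<in>vertices T. \<forall>e\<in>incident T v. rot T' (f v) (g e) = g (rot T v e)))"

text \<open>The passport \<open>[\<alpha>;\<beta>;n]\<close>, with the partitions as multisets of parts.\<close>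

definition has_passport ::
    "('v, 'e) bicolored_map \<Rightarrow> nat multiset \<Rightarrow> nat multiset \<Rightarrow> nat \<Rightarrow> bool" where
  "has_passport T \<alpha> \<beta> n \<longleftrightarrow>
     image_mset (vdegree T) (mset_set (blacks T)) = \<alpha> \<and>
     image_mset (vdegree T) (mset_set (whites T)) = \<beta> \<and>
     card (edges T) = n"

section \<open>The monodromy group\<close>

definition edge_labelling :: "('v, 'e) bicolored_map \<Rightarrow> ('e \<Rightarrow> nat) \<Rightarrow> bool" where
  "edge_labelling T l \<longleftrightarrow> bij_betw l (edges T) {1..card (edges T)}"

definition black_perm :: "('v, 'e) bicolored_map \<Rightarrow> ('e \<Rightarrow> nat) \<Rightarrow> nat \<Rightarrow> nat" where
  "black_perm T l i =
     (if i \<in> {1..card (edges T)}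
      then let e = inv_into (edges T) l i in l (rot T (black_end T e) e) else i)"

definition white_perm :: "('v, 'e) bicolored_map \<Rightarrow> ('e \<Rightarrow> nat) \<Rightarrow> nat \<Rightarrow> nat" where
  "white_perm T l i =
     (if i \<in> {1..card (edges T)}
      then let e = inv_into (edges T) l i in l (rot T (white_end T e) e) else i)"

definition monodromy_group :: "('v, 'e) bicolored_map \<Rightarrow> ('e \<Rightarrow> nat) \<Rightarrow> (nat \<Rightarrow> nat) monoid" where
  "monodromy_group T l =
     subgroup_generated (sym_group (card (edges T))) {black_perm T l, white_perm T l}"

text \<open>\<^const>\<open>subgroup_generated\<close> ignores generators outside the ambient group; the following shows
  that none is lost.\<close>

lemma rot_bij_incident:
  assumes "plane_tree T" "v \<in> vertices T"
  shows "bij_betw (rot T v) (incident T v) (incident T v)"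
proof -
  have c: "cyclic_on (rot T v) (incident T v)" using assms by (simp add: plane_tree_def)
  have "rot T v ` incident T v = incident T v"
    using c by (auto simp: cyclic_on_alldef intro: orbit.base) (metis image_eqI orbit.cases)
  moreover have "finite (incident T v)" using c by (rule finite_cyclic_on)
  ultimately show ?thesis by (simp add: bij_betw_def finite_surj_inj)
qed

lemma labelled_perm_permutes:
  assumes T: "plane_tree T" and l: "edge_labelling T l"
    and c: "\<And>e. e \<in> edges T \<Longrightarrow> c e \<in> vertices T"
    and inc: "\<And>e v. v \<in> c ` edges T \<Longrightarrow> e \<in> incident T v \<longleftrightarrow> e \<in> edges T \<and> c e = v"
  shows "(\<lambda>i. if i \<in> {1..card (edges T)}
      then let e = inv_into (edges T) l i in l (rot T (c e) e) else i) permutes {1..card (edges T)}"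
    (is "?p permutes ?N")
proof -
  let ?r = "\<lambda>e. rot T (c e) e"
  have rinc: "?r e \<in> incident T (c e)" if "e \<in> edges T" for e
    using rot_bij_incident[OF T c[OF that]] inc[of "c e" e] that by (auto dest: bij_betwE)
  hence r1: "?r e \<in> edges T" "c (?r e) = c e" if "e \<in> edges T" for e
    using inc[of "c e"] that by auto
  have inj: "inj_on ?r (edges T)"
  proof (rule inj_onI)
    fix e f assume ef: "e \<in> edges T" "f \<in> edges T" "?r e = ?r f"
    then have "c e = c f" using r1(2) by metis
    then show "e = f"
      using ef rot_bij_incident[OF T c[OF ef(1)]] inc[of "c e"]
      by (auto simp: bij_betw_def inj_on_def)
  qed
  have fin: "finite (edges T)" using T by (simp add: plane_tree_def)
  have "bij_betw ?r (edges T) (edges T)"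
    using inj r1(1) fin by (simp add: bij_betw_def endo_inj_surj image_subset_iff)
  moreover have "bij_betw (inv_into (edges T) l) ?N (edges T)"
    using l by (simp add: edge_labelling_def bij_betw_inv_into)
  ultimately have "bij_betw (l \<circ> (?r \<circ> inv_into (edges T) l)) ?N ?N"
    using l unfolding edge_labelling_def by (blast intro: bij_betw_trans)
  then have "bij_betw ?p ?N ?N"
    by (rule bij_betw_cong[THEN iffD1, rotated]) (simp add: Let_def)
  then show ?thesis by (rule bij_imp_permutes) auto
qed

lemma black_perm_permutes:
  assumes "plane_tree T" "edge_labelling T l"
  shows "black_perm T l permutes {1..card (edges T)}"
  unfolding black_perm_def
  by (rule labelled_perm_permutes[OF assms])
     (use assms(1) in \<open>auto simp: plane_tree_def vertices_def incident_def\<close>)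

lemma white_perm_permutes:
  assumes "plane_tree T" "edge_labelling T l"
  shows "white_perm T l permutes {1..card (edges T)}"
  unfolding white_perm_def
  by (rule labelled_perm_permutes[OF assms])
     (use assms(1) in \<open>auto simp: plane_tree_def vertices_def incident_def\<close>)

section \<open>The center\<close>

definition is_center :: "('v, 'e) bicolored_map \<Rightarrow> nat \<Rightarrow> 'v \<Rightarrow> bool" where
  "is_center T r c \<longleftrightarrow> c \<in> whites T \<and>
     (\<forall>b\<in>blacks T. vdegree T b = r \<longrightarrow> adjacent T c b) \<and>
     card {b \<in> blacks T. vdegree T b = 1 \<and> adjacent T c b} = 2"

definition consecutive_leaves :: "('v, 'e) bicolored_map \<Rightarrow> 'v \<Rightarrow> bool" where
  "consecutive_leaves T c \<longleftrightarrow>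
     (\<exists>e\<in>incident T c. \<exists>f\<in>incident T c. e \<noteq> f \<and> rot T c e = f \<and>
        vdegree T (black_end T e) = 1 \<and> vdegree T (black_end T f) = 1)"

section \<open>Semidirect products\<close>

definition semidirect_product ::
    "('a, 'c) monoid_scheme \<Rightarrow> ('b, 'd) monoid_scheme \<Rightarrow> ('b \<Rightarrow> 'a \<Rightarrow> 'a) \<Rightarrow> ('a \<times> 'b) monoid" where
  "semidirect_product N H \<phi> =
     \<lparr>carrier = carrier N \<times> carrier H,
      monoid.mult = (\<lambda>(a, h) (b, k). (a \<otimes>\<^bsub>N\<^esub> \<phi> h b, h \<otimes>\<^bsub>H\<^esub> k)),
      one = (\<one>\<^bsub>N\<^esub>, \<one>\<^bsub>H\<^esub>)\<rparr>"

text \<open>The possible actions of \<open>H\<close> on \<open>N\<close> by automorphisms.\<close>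

definition actions :: "('a, 'c) monoid_scheme \<Rightarrow> ('b, 'd) monoid_scheme \<Rightarrow> ('b \<Rightarrow> 'a \<Rightarrow> 'a) set" where
  "actions N H = hom H (AutoGroup N)"

lemma group_semidirect_product:
  assumes N: "group N" and H: "group H" and \<phi>: "\<phi> \<in> actions N H"
  shows "group (semidirect_product N H \<phi>)"
proof -
  interpret N: group N by (rule N)
  interpret H: group H by (rule H)
  interpret A: group "AutoGroup N" by (rule N.AutoGroup)
  interpret \<phi>: group_hom H "AutoGroup N" \<phi>
    using \<phi> by unfold_locales (simp add: actions_def)
  have au: "\<phi> h \<in> auto N" if "h \<in> carrier H" for h
    using \<phi>.hom_closed[OF that] by (simp add: AutoGroup_def)
  have cl [simp]: "\<phi> h a \<in> carrier N" if "h \<in> carrier H" "a \<in> carrier N" for h a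
    using au[OF that(1)] that(2) by (auto simp: auto_def hom_def)
  have mu [simp]: "\<phi> h (a \<otimes>\<^bsub>N\<^esub> b) = \<phi> h a \<otimes>\<^bsub>N\<^esub> \<phi> h b"
    if "h \<in> carrier H" "a \<in> carrier N" "b \<in> carrier N" for h a b
    using au[OF that(1)] that(2,3) by (auto simp: auto_def hom_def)
  have co [simp]: "\<phi> (h \<otimes>\<^bsub>H\<^esub> k) a = \<phi> h (\<phi> k a)"
    if "h \<in> carrier H" "k \<in> carrier H" "a \<in> carrier N" for h k a
    using \<phi>.hom_mult[OF that(1,2)] au[OF that(1)] au[OF that(2)] that(3)
    by (simp add: AutoGroup_def BijGroup_def auto_def compose_def)
  have on [simp]: "\<phi> \<one>\<^bsub>H\<^esub> a = a" if "a \<in> carrier N" for a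
    using \<phi>.hom_one that by (simp add: AutoGroup_def BijGroup_def)
  show ?thesis
  proof (rule groupI)
    fix x assume "x \<in> carrier (semidirect_product N H \<phi>)"
    then obtain a h where x: "x = (a, h)" "a \<in> carrier N" "h \<in> carrier H"
      by (auto simp: semidirect_product_def)
    have inv: "\<phi> k (inv\<^bsub>N\<^esub> a) \<otimes>\<^bsub>N\<^esub> \<phi> k a = \<one>\<^bsub>N\<^esub>" if k: "k \<in> carrier H" for k
    proof -
      have "\<phi> k \<one>\<^bsub>N\<^esub> \<otimes>\<^bsub>N\<^esub> \<phi> k \<one>\<^bsub>N\<^esub> = \<phi> k \<one>\<^bsub>N\<^esub>"
        using mu[OF k, of "\<one>\<^bsub>N\<^esub>" "\<one>\<^bsub>N\<^esub>"] by simp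
      then have "\<phi> k \<one>\<^bsub>N\<^esub> = \<one>\<^bsub>N\<^esub>" using k by simp
      then show ?thesis using mu[OF k, of "inv\<^bsub>N\<^esub> a" a] x by simp
    qed
    show "\<exists>y\<in>carrier (semidirect_product N H \<phi>).
        y \<otimes>\<^bsub>semidirect_product N H \<phi>\<^esub> x = \<one>\<^bsub>semidirect_product N H \<phi>\<^esub>"
      using x by (intro bexI[of _ "(\<phi> (inv\<^bsub>H\<^esub> h) (inv\<^bsub>N\<^esub> a), inv\<^bsub>H\<^esub> h)"])
        (auto simp: semidirect_product_def inv simp del: \<phi>.hom_inv)
  qed (auto simp: semidirect_product_def N.m_assoc H.m_assoc simp del: \<phi>.hom_mult \<phi>.hom_one)
qed

definition iso_semidirect ::
    "('g, 'm) monoid_scheme \<Rightarrow> ('a, 'c) monoid_scheme \<Rightarrow> ('b, 'd) monoid_scheme \<Rightarrow> bool" where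
  "iso_semidirect G N H \<longleftrightarrow> (\<exists>\<phi>\<in>actions N H. G \<cong> semidirect_product N H \<phi>)"

definition power_group :: "('a, 'c) monoid_scheme \<Rightarrow> nat \<Rightarrow> (nat \<Rightarrow> 'a) monoid" where
  "power_group G k = product_group {..<k} (\<lambda>_. G)"

end

theory Submission
  imports Defs
begin

text \<open>The numerical hypotheses force \<open>p = 2r - 1\<close>. Every white vertex is adjacent to one of the two
  black vertices \<open>A\<close>, \<open>B\<close> of degree \<open>r\<close>, so by counting exactly one, the center, is adjacent to both.
  Number the four edges at each white vertex by levels in \<open>\<int>\<^sub>4\<close> so that the edges at \<open>A\<close> have level \<open>0\<close>
  and those at \<open>B\<close> have level \<open>k\<close>; exchanging \<open>A\<close> and \<open>B\<close> if necessary, \<open>k = 2\<close> (leaves at the center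
  not consecutive) or \<open>k = 1\<close> (consecutive). These coordinates determine the tree. Then \<open>\<sigma>\<^sub>1\<close> shifts the
  levels, while \<open>\<sigma>\<^sub>0\<close> acts on the levels \<open>0\<close> and \<open>k\<close> by \<open>r\<close>-cycles \<open>a\<close> and \<open>b\<close> on the \<open>p\<close> white vertices
  with a single common point. The commutator of \<open>a\<close> and \<open>b\<close> is a 3-cycle, and \<open>\<langle>a, b\<rangle>\<close> is \<open>A\<^sub>p\<close> or \<open>S\<^sub>p\<close>
  according to the parity of \<open>r\<close>.

  The monodromy group is the product of its level preserving part and \<open>\<langle>\<sigma>\<^sub>1\<rangle>\<close>. If \<open>k = 2\<close>, an involution
  exchanging \<open>a\<close> and \<open>b\<close> by conjugation ties level \<open>i + 2\<close> to level \<open>i\<close>, and two free copies of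
  \<open>\<langle>a, b\<rangle>\<close> remain. If \<open>k = 1\<close>, the commutator of \<open>\<sigma>\<^sub>0\<close> and its shift is a 3-cycle on a single level, so
  the group contains \<open>A\<^sub>p\<^sup>4\<close>; for even \<open>r\<close> the level preserving part consists of the quadruples with
  even total parity, and the transposition \<open>(1 2)\<close> splits off the factor \<open>\<int>\<^sub>2\<^sup>3\<close>.\<close>

section \<open>Internal semidirect products\<close>

text \<open>Everything rests on the supports of \<open>a\<close> and \<open>b\<close> meeting in a
  single point: their commutator moves only that point and its two images. For \<open>k = 1\<close>,
  \<open>\<sigma>\<^sub>0\<close> carries the cycles on levels 0 and 1 and its shift carries them on
  levels 1 and 2, so their commutator lives on level 1 alone, and conjugation spreads the 3-cycle
  within that level. For \<open>k = 2\<close> every level preserving element repeats level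
  \<open>i\<close> on level \<open>i + 2\<close> in mirrored form, so nothing nontrivial is confined
  to one level.

  A factor Z_4 always splits off, since only the trivial power of the level shift preserves levels.
  The delicate case is even \<open>r\<close> with \<open>k = 1\<close>: the quotient of the level
  preserving part by A_p^4 has to be realised by a subgroup that the shift normalises. One and the
  same transposition on all four levels achieves this.

  The existence of both trees is shown by an explicit model, and they are told apart by a property
  of their edge permutations that isomorphisms preserve.\<close>

lemma semidirect_product_hom:
  assumes N: "group N" and H: "group H" and G: "group G"
    and \<alpha>: "\<alpha> \<in> hom N G" "inj_on \<alpha> (carrier N)"
    and \<beta>: "\<beta> \<in> hom H G" "inj_on \<beta> (carrier H)"
    and swap: "\<And>h a. h \<in> carrier H \<Longrightarrow> a \<in> carrier N \<Longrightarrow>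
      \<exists>a'\<in>carrier N. \<beta> h \<otimes>\<^bsub>G\<^esub> \<alpha> a = \<alpha> a' \<otimes>\<^bsub>G\<^esub> \<beta> h"
    and triv: "\<And>a h. a \<in> carrier N \<Longrightarrow> h \<in> carrier H \<Longrightarrow> \<alpha> a = \<beta> h \<Longrightarrow> h = \<one>\<^bsub>H\<^esub>"
  shows "\<exists>\<phi>\<in>actions N H. (\<lambda>(a, h). \<alpha> a \<otimes>\<^bsub>G\<^esub> \<beta> h) \<in> hom (semidirect_product N H \<phi>) G \<and>
    inj_on (\<lambda>(a, h). \<alpha> a \<otimes>\<^bsub>G\<^esub> \<beta> h) (carrier (semidirect_product N H \<phi>))"
proof -
  interpret N: group N by (rule N)
  interpret H: group H by (rule H)
  interpret G: group G by (rule G)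
  interpret a: group_hom N G \<alpha> using \<alpha>(1) by unfold_locales
  interpret b: group_hom H G \<beta> using \<beta>(1) by unfold_locales
  \<comment> \<open>Conjugation by \<open>\<beta> h\<close>, pulled back along
    \<open>\<alpha>\<close>. Injectivity of \<open>\<alpha>\<close> makes the witness unique, so
    each law of an action reduces to a computation in \<open>G\<close>.\<close>
  obtain \<psi> where \<psi>: "\<And>h a. h \<in> carrier H \<Longrightarrow> a \<in> carrier N \<Longrightarrow>
      \<psi> h a \<in> carrier N \<and> \<beta> h \<otimes>\<^bsub>G\<^esub> \<alpha> a = \<alpha> (\<psi> h a) \<otimes>\<^bsub>G\<^esub> \<beta> h"
    using swap by metis
  have cl [simp]: "\<psi> h a \<in> carrier N" if "h \<in> carrier H" "a \<in> carrier N" for h a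
    using \<psi> that by blast
  have uniq: "\<psi> h a = a'" if "h \<in> carrier H" "a \<in> carrier N" "a' \<in> carrier N"
      "\<beta> h \<otimes>\<^bsub>G\<^esub> \<alpha> a = \<alpha> a' \<otimes>\<^bsub>G\<^esub> \<beta> h" for h a a'
    using \<psi>[OF that(1,2)] that \<alpha>(2) by (auto simp: inj_on_def)
  have mu: "\<psi> h (a \<otimes>\<^bsub>N\<^esub> b) = \<psi> h a \<otimes>\<^bsub>N\<^esub> \<psi> h b"
    if "h \<in> carrier H" "a \<in> carrier N" "b \<in> carrier N" for h a b
  proof (rule uniq)
    have "\<beta> h \<otimes>\<^bsub>G\<^esub> \<alpha> (a \<otimes>\<^bsub>N\<^esub> b) = (\<beta> h \<otimes>\<^bsub>G\<^esub> \<alpha> a) \<otimes>\<^bsub>G\<^esub> \<alpha> b"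
      using that by (simp add: G.m_assoc)
    also have "\<dots> = \<alpha> (\<psi> h a) \<otimes>\<^bsub>G\<^esub> (\<beta> h \<otimes>\<^bsub>G\<^esub> \<alpha> b)"
      using that by (simp add: \<psi> G.m_assoc)
    also have "\<dots> = \<alpha> (\<psi> h a \<otimes>\<^bsub>N\<^esub> \<psi> h b) \<otimes>\<^bsub>G\<^esub> \<beta> h"
      using that by (simp add: \<psi> G.m_assoc)
    finally show "\<beta> h \<otimes>\<^bsub>G\<^esub> \<alpha> (a \<otimes>\<^bsub>N\<^esub> b) = \<alpha> (\<psi> h a \<otimes>\<^bsub>N\<^esub> \<psi> h b) \<otimes>\<^bsub>G\<^esub> \<beta> h" .
  qed (use that in auto)
  have co: "\<psi> (h \<otimes>\<^bsub>H\<^esub> k) a = \<psi> h (\<psi> k a)"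
    if "h \<in> carrier H" "k \<in> carrier H" "a \<in> carrier N" for h k a
  proof (rule uniq)
    have "\<beta> (h \<otimes>\<^bsub>H\<^esub> k) \<otimes>\<^bsub>G\<^esub> \<alpha> a = \<beta> h \<otimes>\<^bsub>G\<^esub> (\<beta> k \<otimes>\<^bsub>G\<^esub> \<alpha> a)"
      using that by (simp add: G.m_assoc)
    also have "\<dots> = (\<beta> h \<otimes>\<^bsub>G\<^esub> \<alpha> (\<psi> k a)) \<otimes>\<^bsub>G\<^esub> \<beta> k"
      using that \<psi>[of k a] by (simp add: G.m_assoc)
    also have "\<dots> = \<alpha> (\<psi> h (\<psi> k a)) \<otimes>\<^bsub>G\<^esub> \<beta> (h \<otimes>\<^bsub>H\<^esub> k)"
      using that \<psi>[of h "\<psi> k a"] by (simp add: G.m_assoc)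
    finally show "\<beta> (h \<otimes>\<^bsub>H\<^esub> k) \<otimes>\<^bsub>G\<^esub> \<alpha> a = \<alpha> (\<psi> h (\<psi> k a)) \<otimes>\<^bsub>G\<^esub> \<beta> (h \<otimes>\<^bsub>H\<^esub> k)" .
  qed (use that in auto)
  have on: "\<psi> \<one>\<^bsub>H\<^esub> a = a" if "a \<in> carrier N" for a
    by (rule uniq) (use that in auto)
  \<comment> \<open>Members of \<open>Bij\<close> are extensional, so the action has to be
    restricted to the carrier.\<close>
  define \<phi> where "\<phi> h = restrict (\<psi> h) (carrier N)" for h
  have au: "\<phi> h \<in> auto N" if h: "h \<in> carrier H" for h
  proof -
    have "bij_betw (\<psi> h) (carrier N) (carrier N)"
      by (rule bij_betw_byWitness[where f' = "\<psi> (inv\<^bsub>H\<^esub> h)"])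
        (use h in \<open>auto simp: co[symmetric] on\<close>)
    then show ?thesis
      using h by (auto simp: auto_def hom_def Bij_def \<phi>_def mu)
  qed
  have act: "\<phi> \<in> actions N H"
    unfolding actions_def
  proof (rule homI)
    fix h k assume hk: "h \<in> carrier H" "k \<in> carrier H"
    then have "\<phi> h \<in> Bij (carrier N)" "\<phi> k \<in> Bij (carrier N)"
      using au by (auto simp: auto_def)
    then show "\<phi> (h \<otimes>\<^bsub>H\<^esub> k) = \<phi> h \<otimes>\<^bsub>AutoGroup N\<^esub> \<phi> k"
      using hk by (auto simp: AutoGroup_def BijGroup_def compose_def \<phi>_def co fun_eq_iff)
  qed (simp add: au AutoGroup_def)
  have hom: "(\<lambda>(a, h). \<alpha> a \<otimes>\<^bsub>G\<^esub> \<beta> h) \<in> hom (semidirect_product N H \<phi>) G"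
  proof (rule homI)
    fix x y assume xy: "x \<in> carrier (semidirect_product N H \<phi>)" "y \<in> carrier (semidirect_product N H \<phi>)"
    obtain a h b k where e: "x = (a, h)" "y = (b, k)" by (cases x, cases y)
    with xy have c: "a \<in> carrier N" "h \<in> carrier H" "b \<in> carrier N" "k \<in> carrier H"
      by (auto simp: semidirect_product_def)
    have "\<alpha> (a \<otimes>\<^bsub>N\<^esub> \<psi> h b) \<otimes>\<^bsub>G\<^esub> \<beta> (h \<otimes>\<^bsub>H\<^esub> k) =
        \<alpha> a \<otimes>\<^bsub>G\<^esub> ((\<alpha> (\<psi> h b) \<otimes>\<^bsub>G\<^esub> \<beta> h) \<otimes>\<^bsub>G\<^esub> \<beta> k)"
      using c by (simp add: G.m_assoc)
    also have "\<dots> = (\<alpha> a \<otimes>\<^bsub>G\<^esub> \<beta> h) \<otimes>\<^bsub>G\<^esub> (\<alpha> b \<otimes>\<^bsub>G\<^esub> \<beta> k)"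
      using c by (simp add: G.m_assoc flip: \<psi>[THEN conjunct2])
    finally show "(case x \<otimes>\<^bsub>semidirect_product N H \<phi>\<^esub> y of (a, h) \<Rightarrow> \<alpha> a \<otimes>\<^bsub>G\<^esub> \<beta> h) =
        (case x of (a, h) \<Rightarrow> \<alpha> a \<otimes>\<^bsub>G\<^esub> \<beta> h) \<otimes>\<^bsub>G\<^esub> (case y of (a, h) \<Rightarrow> \<alpha> a \<otimes>\<^bsub>G\<^esub> \<beta> h)"
      using c by (simp add: e semidirect_product_def \<phi>_def)
  qed (auto simp: semidirect_product_def)
  interpret S: group_hom "semidirect_product N H \<phi>" G "\<lambda>(a, h). \<alpha> a \<otimes>\<^bsub>G\<^esub> \<beta> h"
    using group_semidirect_product[OF N H act] hom G by (simp add: group_hom_def group_hom_axioms_def)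
  have "inj_on (\<lambda>(a, h). \<alpha> a \<otimes>\<^bsub>G\<^esub> \<beta> h) (carrier (semidirect_product N H \<phi>))"
  proof (rule S.inj_on_one_iff[THEN iffD2], clarify)
    fix a h assume "(a, h) \<in> carrier (semidirect_product N H \<phi>)" and one: "\<alpha> a \<otimes>\<^bsub>G\<^esub> \<beta> h = \<one>\<^bsub>G\<^esub>"
    then have c: "a \<in> carrier N" "h \<in> carrier H" by (auto simp: semidirect_product_def)
    \<comment> \<open>A trivial product puts \<open>\<beta> h\<close> into the image of
      \<open>\<alpha>\<close>, where \<open>triv\<close> applies.\<close>
    have "\<alpha> (inv\<^bsub>N\<^esub> a) = \<beta> h"
      using one c by (metis G.inv_equality G.inv_inv N.inv_closed a.hom_closed a.hom_inv b.hom_closed)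
    then have h: "h = \<one>\<^bsub>H\<^esub>" using triv c by blast
    have "a = \<one>\<^bsub>N\<^esub>"
      by (rule inj_onD[OF \<alpha>(2)]) (use one c h in auto)
    with h show "(a, h) = \<one>\<^bsub>semidirect_product N H \<phi>\<^esub>" by (simp add: semidirect_product_def)
  qed
  with act hom show ?thesis by blast
qed

text \<open>The preceding embedding together with \<open>surj\<close>. Here \<open>\<beta>\<close>
  may itself come from an embedded semidirect product; the iterated product for even
  \<open>r\<close> is obtained in this way.\<close>

lemma iso_semidirectI:
  assumes N: "group N" and H: "group H" and G: "group G"
    and \<alpha>: "\<alpha> \<in> hom N G" "inj_on \<alpha> (carrier N)"
    and \<beta>: "\<beta> \<in> hom H G" "inj_on \<beta> (carrier H)"
    and swap: "\<And>h a. h \<in> carrier H \<Longrightarrow> a \<in> carrier N \<Longrightarrow>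
      \<exists>a'\<in>carrier N. \<beta> h \<otimes>\<^bsub>G\<^esub> \<alpha> a = \<alpha> a' \<otimes>\<^bsub>G\<^esub> \<beta> h"
    and triv: "\<And>a h. a \<in> carrier N \<Longrightarrow> h \<in> carrier H \<Longrightarrow> \<alpha> a = \<beta> h \<Longrightarrow> h = \<one>\<^bsub>H\<^esub>"
    and surj: "\<And>g. g \<in> carrier G \<Longrightarrow> \<exists>a\<in>carrier N. \<exists>h\<in>carrier H. g = \<alpha> a \<otimes>\<^bsub>G\<^esub> \<beta> h"
  shows "iso_semidirect G N H"
proof -
  have "\<exists>\<phi>\<in>actions N H. (\<lambda>(a, h). \<alpha> a \<otimes>\<^bsub>G\<^esub> \<beta> h) \<in> hom (semidirect_product N H \<phi>) G \<and>
      inj_on (\<lambda>(a, h). \<alpha> a \<otimes>\<^bsub>G\<^esub> \<beta> h) (carrier (semidirect_product N H \<phi>))"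
    by (rule semidirect_product_hom[OF N H G \<alpha> \<beta>]) (use swap triv in blast)+
  then obtain \<phi> where act: "\<phi> \<in> actions N H"
    and f: "(\<lambda>(a, h). \<alpha> a \<otimes>\<^bsub>G\<^esub> \<beta> h) \<in> hom (semidirect_product N H \<phi>) G"
      "inj_on (\<lambda>(a, h). \<alpha> a \<otimes>\<^bsub>G\<^esub> \<beta> h) (carrier (semidirect_product N H \<phi>))"
    by blast
  let ?f = "\<lambda>(a, h). \<alpha> a \<otimes>\<^bsub>G\<^esub> \<beta> h"
  have "?f ` carrier (semidirect_product N H \<phi>) = carrier G"
  proof
    show "?f ` carrier (semidirect_product N H \<phi>) \<subseteq> carrier G"
      using f(1) unfolding hom_def by blast
    show "carrier G \<subseteq> ?f ` carrier (semidirect_product N H \<phi>)"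
      using surj by (fastforce simp: semidirect_product_def)
  qed
  with f have "?f \<in> iso (semidirect_product N H \<phi>) G" by (simp add: iso_def bij_betw_def)
  then have "semidirect_product N H \<phi> \<cong> G" by (auto simp: is_iso_def)
  then have "G \<cong> semidirect_product N H \<phi>"
    using group.iso_sym[OF group_semidirect_product[OF N H act]] by blast
  with act show ?thesis by (auto simp: iso_semidirect_def)
qed

section \<open>Two cycles with one common point\<close>

text \<open>The cycles \<open>acyc r = (1 2 \<dots> r)\<close> and \<open>bcyc r = (1 r+1 \<dots> 2r-1)\<close> share the point \<open>1\<close> only.\<close>

definition acyc :: "nat \<Rightarrow> nat \<Rightarrow> nat" where
  "acyc r w = (if 1 \<le> w \<and> w < r then Suc w else if w = r then 1 else w)"

definition bcyc :: "nat \<Rightarrow> nat \<Rightarrow> nat" where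
  "bcyc r w = (if w = 1 then Suc r else if r < w \<and> w < 2 * r - 1 then Suc w
     else if w = 2 * r - 1 then 1 else w)"

text \<open>The involution that fixes the common point \<open>1\<close> and exchanges the remaining
  points of the two cycles in order. It conjugates \<open>acyc r\<close> to
  \<open>bcyc r\<close>.\<close>

definition mirror :: "nat \<Rightarrow> nat \<Rightarrow> nat" where
  "mirror r w = (if 2 \<le> w \<and> w \<le> r then w + r - 1 else if r < w \<and> w < 2 * r then w + 1 - r else w)"

text \<open>Written as \<open>cycle_of_list\<close> so that the library facts on conjugated cycles
  and on \<open>three_cycles\<close> as generators of the alternating group apply.\<close>

definition three_cycle :: "'a \<Rightarrow> 'a \<Rightarrow> 'a \<Rightarrow> 'a \<Rightarrow> 'a" where
  "three_cycle u v w = cycle_of_list [u, v, w]"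

section \<open>The two cycles, their mirror symmetry and their parity\<close>

lemma permutes_of_inj:
  assumes "finite S" "\<And>x. x \<in> S \<Longrightarrow> f x \<in> S" "inj_on f S" "\<And>x. x \<notin> S \<Longrightarrow> f x = x"
  shows "f permutes S"
  by (rule bij_imp_permutes) (use assms in \<open>auto simp: bij_betw_def endo_inj_surj image_subset_iff\<close>)

lemma acyc_permutes: "2 \<le> r \<Longrightarrow> acyc r permutes {1..2 * r - 1}"
  by (rule permutes_of_inj) (auto simp: acyc_def inj_on_def split: if_splits)

lemma bcyc_permutes: "2 \<le> r \<Longrightarrow> bcyc r permutes {1..2 * r - 1}"
  by (rule permutes_of_inj) (auto simp: bcyc_def inj_on_def split: if_splits)

lemma mirror_mirror: "2 \<le> r \<Longrightarrow> mirror r (mirror r w) = w"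
  by (auto simp: mirror_def)

lemma mirror_permutes: "2 \<le> r \<Longrightarrow> mirror r permutes {1..2 * r - 1}"
  by (rule permutes_of_inj) (auto simp: mirror_def inj_on_def split: if_splits)

lemma mirror_acyc:
  assumes r: "2 \<le> r" shows "mirror r \<circ> acyc r \<circ> mirror r = bcyc r"
proof
  fix w
  \<comment> \<open>Replacing \<open>r\<close> by \<open>q + 2\<close> removes truncated
    subtraction.\<close>
  obtain q where q: "r = q + 2" using r by (metis le_add_diff_inverse2)
  consider "w = 0 \<or> 2 * r \<le> w" | "w = 1" | "2 \<le> w" "w \<le> r" | d where "w = r + 1 + d" "d < q" | "w = 2 * q + 3"
    using q le_Suc_ex[of "r + 1" w] by fastforce
  then show "(mirror r \<circ> acyc r \<circ> mirror r) w = bcyc r w"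
    by cases (use r in \<open>auto simp: q mirror_def acyc_def bcyc_def split del: if_split\<close>)
qed

lemma mirror_bcyc: "2 \<le> r \<Longrightarrow> mirror r \<circ> bcyc r \<circ> mirror r = acyc r"
  by (simp add: fun_eq_iff mirror_mirror flip: mirror_acyc)

text \<open>Peels off one transposition, so that the parity of \<open>acyc r\<close> follows by
  induction from \<open>acyc 1\<close>, which is the identity.\<close>

lemma acyc_Suc:
  assumes "1 \<le> r" shows "acyc (Suc r) = acyc r \<circ> transpose r (Suc r)"
proof
  fix w
  consider "w < r" | "w = r" | "w = Suc r" | "Suc r < w" by linarith
  then show "acyc (Suc r) w = (acyc r \<circ> transpose r (Suc r)) w"
    by cases (use assms in \<open>auto simp: acyc_def transpose_def\<close>)
qed

lemma permutation_acyc: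
  assumes "1 \<le> r" shows "permutation (acyc r)"
proof (cases "r = 1")
  case True
  have "acyc 1 = id" by (rule ext) (simp add: acyc_def)
  then show ?thesis using True by simp
next
  case False
  then show ?thesis using acyc_permutes[of r] assms permutation_permutes by force
qed

lemma evenperm_acyc: "1 \<le> r \<Longrightarrow> evenperm (acyc r) \<longleftrightarrow> odd r"
proof (induction r rule: nat_induct_at_least)
  case base
  have "acyc 1 = id" by (rule ext) (simp add: acyc_def)
  then show ?case by simp
next
  case (Suc r)
  then show ?case
    by (subst acyc_Suc)
      (auto simp: evenperm_comp permutation_acyc permutation_swap_id evenperm_swap simp del: comp_apply)
qed

text \<open>The mirror conjugates one cycle into the other, and conjugation preserves
  parity.\<close>

lemma evenperm_bcyc:
  assumes r: "2 \<le> r" shows "evenperm (bcyc r) \<longleftrightarrow> odd r"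
proof -
  have p: "permutation (mirror r)" using mirror_permutes[OF r] permutation_permutes by blast
  have "evenperm (mirror r \<circ> acyc r \<circ> mirror r) \<longleftrightarrow> evenperm (acyc r)"
    using p using r by (auto simp: evenperm_comp permutation_acyc permutation_compose)
  then show ?thesis using evenperm_acyc[of r] r by (simp add: mirror_acyc)
qed

section \<open>3-cycles and generation of the alternating group\<close>

lemma three_cycle_simps:
  assumes "u \<noteq> v" "v \<noteq> w" "u \<noteq> w"
  shows "three_cycle u v w x = (if x = u then v else if x = v then w else if x = w then u else x)"
  using assms by (auto simp: three_cycle_def transpose_def)

lemma three_cycle_conj:
  assumes "distinct [u, v, w]" "bij f"
  shows "f \<circ> three_cycle u v w \<circ> inv' f = three_cycle (f u) (f v) (f w)"
  using conjugation_of_cycle[OF assms] by (simp add: three_cycle_def)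

text \<open>With \<open>y\<close> as base point, the first identity gives transitivity of the
  relation that \<open>(y u v)\<close> lies in a set closed under composition; the second eliminates
  the base point.\<close>

lemma three_cycle_compose:
  assumes "distinct [y, u, v, w]"
  shows "three_cycle y v w \<circ> three_cycle y u v = three_cycle y u w"
    and "three_cycle y u v \<circ> three_cycle y v w = three_cycle u v w"
  using assms by (auto simp: fun_eq_iff three_cycle_simps)

lemma three_cycle_sq:
  assumes "distinct [u, v, w]"
  shows "three_cycle u v w \<circ> three_cycle u v w = three_cycle u w v"
    "three_cycle v w u = three_cycle u v w"
  using assms by (auto simp: fun_eq_iff three_cycle_simps)

text \<open>The cycles meet in \<open>1\<close> only, so their commutator moves just
  \<open>1\<close> and its images \<open>2\<close> and \<open>r + 1\<close>. The identity is
  multiplied out: no inverse occurs and it can be checked pointwise.\<close>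

lemma acyc_bcyc_commutator:
  assumes r: "2 \<le> r"
  shows "acyc r \<circ> bcyc r = three_cycle 1 2 (Suc r) \<circ> (bcyc r \<circ> acyc r)"
proof
  fix w
  obtain q where q: "r = q + 2" using r by (metis le_add_diff_inverse2)
  consider "w = 0 \<or> 2 * r \<le> w" | "w = 1" | "2 \<le> w" "w < r" | "w = r" | "r < w" "w < 2 * q + 3"
    | "w = 2 * q + 3" using q by linarith
  then show "(acyc r \<circ> bcyc r) w = (three_cycle 1 2 (Suc r) \<circ> (bcyc r \<circ> acyc r)) w"
    by cases (use r in \<open>auto simp: q three_cycle_simps acyc_def bcyc_def split del: if_split\<close>)
qed

text \<open>For fixed \<open>y\<close>, the relation \<open>(y u v) \<in> L\<close> is an equivalence relation on the points other
  than \<open>y\<close>, once the diagonal is added.\<close>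

lemma three_cycle_chain:
  assumes comp: "\<And>f g. f \<in> L \<Longrightarrow> g \<in> L \<Longrightarrow> f \<circ> g \<in> L"
    and inj: "inj_on x {m..n}" and y: "y \<notin> x ` {m..n}"
    and step: "\<And>i. m \<le> i \<Longrightarrow> i < n \<Longrightarrow> three_cycle y (x i) (x (Suc i)) \<in> L"
    and ij: "m \<le> i" "i < j" "j \<le> n"
  shows "three_cycle y (x i) (x j) \<in> L"
proof -
  have "Suc i \<le> j" using ij by simp
  then show ?thesis using \<open>j \<le> n\<close>
  proof (induction j rule: dec_induct)
    case base
    then show ?case using step ij by simp
  next
    case (step j)
    have "distinct [y, x i, x j, x (Suc j)]"
      using inj y ij step.hyps step.prems by (auto simp: inj_on_eq_iff)
    then show ?case
      using comp[OF assms(4)[of j] step.IH] step.hyps step.prems ij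
      by (simp add: three_cycle_compose)
  qed
qed

text \<open>The two cycles themselves are not assumed to lie in \<open>L\<close>; they only
  normalise its 3-cycles. Conjugating the given 3-cycle by \<open>acyc r\<close> yields a chain
  based at \<open>r + 1\<close>, conjugating by \<open>bcyc r\<close> a chain based at
  \<open>2\<close>. The chains are glued at these two points, and all 3-cycles follow.\<close>

lemma alternating_subset:
  assumes r: "2 \<le> r"
    and one: "id \<in> L" and comp: "\<And>f g. f \<in> L \<Longrightarrow> g \<in> L \<Longrightarrow> f \<circ> g \<in> L"
    and acyc: "\<And>u v w. distinct [u, v, w] \<Longrightarrow> three_cycle u v w \<in> L \<Longrightarrow>
      three_cycle (acyc r u) (acyc r v) (acyc r w) \<in> L"
    and bcyc: "\<And>u v w. distinct [u, v, w] \<Longrightarrow> three_cycle u v w \<in> L \<Longrightarrow>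
      three_cycle (bcyc r u) (bcyc r v) (bcyc r w) \<in> L"
    and start: "three_cycle 1 2 (Suc r) \<in> L"
  shows "carrier (alt_group (2 * r - 1)) \<subseteq> L"
proof -
  let ?y = "Suc r"
  have rot: "three_cycle v w u \<in> L" if "distinct [u, v, w]" "three_cycle u v w \<in> L" for u v w
    using that by (simp add: three_cycle_sq)
  have rev: "three_cycle u w v \<in> L" if "distinct [u, v, w]" "three_cycle u v w \<in> L" for u v w
    using comp[OF that(2,2)] that(1) by (simp add: three_cycle_sq)
  \<comment> \<open>\<open>acyc r\<close> fixes \<open>r + 1\<close>, so conjugation pushes
    \<open>(r+1 1 2)\<close> along the points \<open>1, ..., r\<close>.\<close>
  have A1: "three_cycle ?y i (Suc i) \<in> L" if "1 \<le> i" "i < r" for i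
    using that
  proof (induction i rule: nat_induct_at_least)
    case base
    show ?case using rot[OF _ rot[OF _ start]] r by (simp add: numeral_2_eq_2)
  next
    case (Suc i)
    then show ?case using acyc[of ?y i "Suc i"] by (simp add: acyc_def)
  qed
  have A: "three_cycle ?y i j \<in> L" if "1 \<le> i" "i < j" "j \<le> r" for i j
    by (rule three_cycle_chain[where x = "\<lambda>i. i" and m = 1 and n = r, OF comp]) (use A1 that in auto)
  \<comment> \<open>\<open>bcyc r\<close> fixes \<open>2\<close>, which is the base point here. The
    first link is the conjugate \<open>(r+1 2 r+2)\<close> of the given 3-cycle, reoriented.\<close>
  have B1: "three_cycle 2 j (Suc j) \<in> L" if "?y \<le> j" "j < 2 * r - 1" for j
    using that
  proof (induction j rule: nat_induct_at_least)
    case base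
    then have "three_cycle ?y 2 (Suc ?y) \<in> L"
      using bcyc[OF _ start] r by (simp add: bcyc_def)
    then show ?case using rev[of 2 "Suc ?y" ?y] rot[of ?y 2 "Suc ?y"] r by simp
  next
    case (Suc j)
    then show ?case using bcyc[of 2 j "Suc j"] r by (simp add: bcyc_def)
  qed
  have B: "three_cycle 2 ?y j \<in> L" if "?y < j" "j \<le> 2 * r - 1" for j
    by (rule three_cycle_chain[where x = "\<lambda>i. i" and m = ?y and n = "2 * r - 1", OF comp])
      (use B1 that r in auto)
  \<comment> \<open>For the base point \<open>r + 1\<close>, every other point is now related to
    \<open>2\<close> in both directions, so \<open>2\<close> serves as a hub joining any two
    points.\<close>
  have two: "three_cycle ?y 2 u \<in> L \<and> three_cycle ?y u 2 \<in> L"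
    if u: "1 \<le> u" "u \<le> 2 * r - 1" "u \<noteq> 2" "u \<noteq> ?y" for u
  proof -
    consider "u = 1" | "2 < u" "u \<le> r" | "?y < u" using u by linarith
    then have "three_cycle ?y 2 u \<in> L \<or> three_cycle ?y u 2 \<in> L"
    proof cases
      case 1
      then show ?thesis using A[of 1 2] r by simp
    next
      case 2
      then show ?thesis using A[of 2 u] by simp
    next
      case 3
      then show ?thesis using B[of u] u r rot[of 2 ?y u] by simp
    qed
    then show ?thesis using rev[of ?y 2 u] rev[of ?y u 2] u r by auto
  qed
  have C: "three_cycle ?y u v \<in> L"
    if "u \<in> {1..2 * r - 1}" "v \<in> {1..2 * r - 1}" "distinct [?y, u, v]" for u v
  proof (cases "u = 2 \<or> v = 2")
    case True
    then show ?thesis using two that by auto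
  next
    case False
    then have "three_cycle ?y 2 v \<circ> three_cycle ?y u 2 \<in> L"
      using two that by (intro comp) auto
    then show ?thesis
      using False that r by (subst (asm) three_cycle_compose) auto
  qed
  \<comment> \<open>A 3-cycle avoiding the base point is a product of two that contain it.\<close>
  have D: "three_cycle u v w \<in> L" if uvw: "{u, v, w} \<subseteq> {1..2 * r - 1}" "distinct [u, v, w]" for u v w
  proof -
    consider "u = ?y" | "v = ?y" | "w = ?y" | "?y \<notin> {u, v, w}" by blast
    then show ?thesis
    proof cases
      case 1
      then show ?thesis using C uvw by auto
    next
      case 2
      then have "three_cycle v w u \<in> L" using C uvw by auto
      then show ?thesis using rot[of w u v] rot[of v w u] uvw by auto
    next
      case 3
      then have "three_cycle w u v \<in> L" using C uvw by auto
      then show ?thesis using rot[of w u v] uvw by auto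
    next
      case 4
      then have "three_cycle ?y u v \<circ> three_cycle ?y v w \<in> L"
        using uvw by (intro comp C) auto
      then show ?thesis using 4 uvw by (subst (asm) three_cycle_compose) auto
    qed
  qed
  have E: "\<exists>u v w. f = three_cycle u v w \<and> distinct [u, v, w] \<and> {u, v, w} \<subseteq> {1..2 * r - 1}"
    if f: "f \<in> three_cycles (2 * r - 1)" for f
  proof -
    obtain cs where "f = cycle_of_list cs" "distinct cs" "length cs = 3" "set cs \<subseteq> {1..2 * r - 1}"
      using f by blast
    moreover from this obtain u v w where "cs = [u, v, w]" using stupid_lemma by metis
    ultimately show ?thesis unfolding three_cycle_def by fastforce
  qed
  have "f \<in> L" if "f \<in> generate (alt_group (2 * r - 1)) (three_cycles (2 * r - 1))" for f
    using that
  proof induction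
    case one
    then show ?case using assms(2) by (simp only: alt_group_one)
  next
    case (incl f)
    from E[OF incl] obtain u v w
      where "f = three_cycle u v w" "distinct [u, v, w]" "{u, v, w} \<subseteq> {1..2 * r - 1}"
      by blast
    then show ?case using D by simp
  next
    case (inv f)
    from E[OF inv] obtain u v w
      where f: "f = three_cycle u v w" "distinct [u, v, w]" "{u, v, w} \<subseteq> {1..2 * r - 1}"
      by blast
    have *: "f \<in> carrier (alt_group (2 * r - 1))" using inv three_cycles_incl by blast
    \<comment> \<open>The inverse of a 3-cycle is its square, so closure under composition
      suffices.\<close>
    have "f \<circ> f \<circ> f = id"
      using f(2) by (auto simp: f(1) fun_eq_iff three_cycle_simps)
    then have "inv\<^bsub>alt_group (2 * r - 1)\<^esub> f = f \<circ> f"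
      using * group.inv_equality[OF alt_group_is_group, of "2 * r - 1" "f \<circ> f" f]
        monoid.m_closed[OF group.is_monoid[OF alt_group_is_group], of f "2 * r - 1" f]
      by (simp add: alt_group_mult alt_group_one)
    moreover have "f \<in> L" using D f by simp
    ultimately show ?case using comp[of f f] by (simp only:)
  next
    case (eng f g)
    then show ?case using comp[of f g] by (simp only: alt_group_mult)
  qed
  then show ?thesis using alt_group_carrier_as_three_cycles by blast
qed

section \<open>Permutations of a grid\<close>

text \<open>Levels are naturals below 4, so a shift by \<open>j\<close> is undone by adding
  \<open>4 - j\<close>.\<close>

lemma mod4_back:
  fixes i j :: nat
  assumes "i < 4" "j < 4" shows "((i + j) mod 4 + (4 - j)) mod 4 = i"
proof -
  have "((i + j) mod 4 + (4 - j)) mod 4 = (i + j + (4 - j)) mod 4" by (simp add: mod_simps)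
  also have "i + j + (4 - j) = i + 4" using assms by simp
  finally show ?thesis using assms by simp
qed

text \<open>\<open>q w i\<close> is the label of the point in column \<open>w\<close> on level
  \<open>i\<close>. Thanks to \<open>nonempty\<close> there is a point on which the shift of an
  element can be observed.\<close>

locale grid =
  fixes W :: "'w set" and D :: "'x set" and q :: "'w \<Rightarrow> nat \<Rightarrow> 'x"
  assumes q: "bij_betw (\<lambda>(w, i). q w i) (W \<times> {..<4}) D"
    and nonempty: "W \<noteq> {}" and finite: "finite D"
begin

text \<open>\<open>act f j\<close> is the element of the wreath product with \<open>\<int>\<^sub>4\<close> that applies \<open>f i\<close> on level \<open>i\<close> and then
  shifts the levels by \<open>j\<close>. Only \<open>f 0, \<dots>, f 3\<close> matter.\<close>

definition act :: "(nat \<Rightarrow> 'w \<Rightarrow> 'w) \<Rightarrow> nat \<Rightarrow> 'x \<Rightarrow> 'x" where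
  "act f j x = (if x \<in> D
     then case inv_into (W \<times> {..<4}) (\<lambda>(w, i). q w i) x of (w, i) \<Rightarrow> q (f i w) ((i + j) mod 4)
     else x)"

text \<open>Values at indices from 4 on are unconstrained, so tuples are compared only below 4, as
  in \<open>act_cong\<close> and \<open>act_inj\<close>.\<close>

definition tuples :: "(nat \<Rightarrow> 'w \<Rightarrow> 'w) set" where
  "tuples = {f. \<forall>i<4. f i permutes W}"

lemma q_in: "w \<in> W \<Longrightarrow> i < 4 \<Longrightarrow> q w i \<in> D"
  using q by (auto dest!: bij_betwE)

lemma q_inj: "q w i = q v j \<longleftrightarrow> w = v \<and> i = j" if "w \<in> W" "v \<in> W" "i < 4" "j < 4"
  using inj_onD[OF bij_betw_imp_inj_on[OF q], of "(w, i)" "(v, j)"] that by auto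

lemma q_cases:
  assumes "x \<in> D" obtains w i where "x = q w i" "w \<in> W" "i < 4"
proof -
  from assms obtain z where "z \<in> W \<times> {..<4}" "x = (\<lambda>(w, i). q w i) z"
    using bij_betw_imp_surj_on[OF q] by (metis imageE)
  then show ?thesis using that by (cases z) simp
qed

lemma act_q [simp]:
  assumes "w \<in> W" "i < 4" shows "act f j (q w i) = q (f i w) ((i + j) mod 4)"
proof -
  have "inv_into (W \<times> {..<4}) (\<lambda>(w, i). q w i) (q w i) = (w, i)"
    using inv_into_f_f[OF bij_betw_imp_inj_on[OF q], of "(w, i)"] assms by simp
  then show ?thesis using q_in[OF assms] by (simp add: act_def)
qed

lemma act_outside [simp]: "x \<notin> D \<Longrightarrow> act f j x = x"
  unfolding act_def by (rule if_not_P)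

lemma act_cong:
  assumes "\<And>i. i < 4 \<Longrightarrow> f i = g i" shows "act f j = act g j"
proof
  fix x show "act f j x = act g j x"
    by (cases "x \<in> D") (auto elim!: q_cases simp: assms)
qed

lemma tuples_in: "f \<in> tuples \<Longrightarrow> w \<in> W \<Longrightarrow> i < 4 \<Longrightarrow> f i w \<in> W"
  unfolding tuples_def by (blast dest: permutes_in_image)

text \<open>The multiplication rule of the wreath product: level \<open>i\<close> has already been
  moved to \<open>i + j\<close> when \<open>g\<close> is applied.\<close>

lemma act_comp:
  assumes "f \<in> tuples"
  shows "act g k \<circ> act f j = act (\<lambda>i. g ((i + j) mod 4) \<circ> f i) ((j + k) mod 4)"
proof
  fix x show "(act g k \<circ> act f j) x = act (\<lambda>i. g ((i + j) mod 4) \<circ> f i) ((j + k) mod 4) x"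
  proof (cases "x \<in> D")
    case True
    then obtain w i where "x = q w i" "w \<in> W" "i < 4" by (rule q_cases)
    moreover from this have "f i w \<in> W" using assms tuples_in by blast
    ultimately show ?thesis by (simp add: mod_simps add.assoc)
  qed simp
qed

lemma act_comp0:
  assumes "f \<in> tuples" shows "act g 0 \<circ> act f 0 = act (\<lambda>i. g i \<circ> f i) 0"
  by (subst act_comp[OF assms]) (auto intro!: act_cong)

lemma act_id: "act (\<lambda>_. id) 0 = id"
proof
  fix x show "act (\<lambda>_. id) 0 x = id x"
    by (cases "x \<in> D") (auto elim!: q_cases)
qed

text \<open>Uniqueness of the normal form: the shift shows in the level of an image point, the
  entries in its column. Outside \<open>W\<close> both entries are the identity.\<close>

lemma act_inj:
  assumes "act f j = act g k" "f \<in> tuples" "g \<in> tuples" "j < 4" "k < 4"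
  shows "j = k" "\<And>i. i < 4 \<Longrightarrow> f i = g i"
proof -
  have *: "f i w = g i w \<and> (i + j) mod 4 = (i + k) mod 4" if "w \<in> W" "i < 4" for w i
    using fun_cong[OF assms(1), of "q w i"] assms(2,3) that by (simp add: q_inj tuples_in)
  show "j = k" using * [where i = 0] nonempty assms(4,5) by auto
  show "f i = g i" if "i < 4" for i
  proof
    fix w show "f i w = g i w"
    proof (cases "w \<in> W")
      case False
      then have "f i w = w" "g i w = w"
        using assms(2,3) that by (auto simp: tuples_def intro!: permutes_not_in)
      then show ?thesis by simp
    qed (use * that in blast)
  qed
qed

lemma id_tuples: "(\<lambda>_. id) \<in> tuples"
  by (simp add: tuples_def permutes_id)

lemma inv_tuples: "f \<in> tuples \<Longrightarrow> (\<lambda>i. inv' (f i)) \<in> tuples"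
  by (simp add: tuples_def permutes_inv)

lemma comp_tuples: "f \<in> tuples \<Longrightarrow> g \<in> tuples \<Longrightarrow> (\<lambda>i. f i \<circ> g i) \<in> tuples"
  by (simp add: tuples_def permutes_compose)

lemma shift_tuples: "f \<in> tuples \<Longrightarrow> (\<lambda>i. f ((i + j) mod 4)) \<in> tuples"
  by (simp add: tuples_def)

lemma act_permutes:
  assumes "f \<in> tuples" shows "act f j permutes D"
proof (rule permutes_of_inj)
  show "act f j x \<in> D" if "x \<in> D" for x
    using that by (rule q_cases) (use assms in \<open>simp add: q_in tuples_in\<close>)
  show "inj_on (act f j) D"
  proof
    fix x y assume xy: "x \<in> D" "y \<in> D" "act f j x = act f j y"
    obtain w i where x: "x = q w i" "w \<in> W" "i < 4" using xy by (auto elim: q_cases)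
    obtain v k where y: "y = q v k" "v \<in> W" "k < 4" using xy by (auto elim: q_cases)
    have *: "f i w = f k v" "(i + j) mod 4 = (k + j) mod 4"
      using xy(3) x y assms by (simp_all add: q_inj tuples_in)
    have "i = k"
      using *(2) x y mod4_back[of i "j mod 4"] mod4_back[of k "j mod 4"] by (simp add: mod_add_right_eq)
    moreover have "w = v"
      using *(1) assms \<open>i = k\<close> y permutes_inj[of "f k"] by (auto simp: tuples_def inj_eq)
    ultimately show "x = y" using x y by simp
  qed
qed (simp_all add: finite)

text \<open>Shift first, then a level preserving factor; \<open>act_front\<close> uses the other
  order. Comparing the two shows how shifts act by conjugation.\<close>

lemma act_back:
  assumes "f \<in> tuples" "j < 4"
  shows "act (\<lambda>i. f ((i + (4 - j)) mod 4)) 0 \<circ> act (\<lambda>_. id) j = act f j"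
proof -
  have "f (((i + j) mod 4 + (4 - j)) mod 4) = f i" if "i < 4" for i
    using mod4_back[OF that assms(2)] by simp
  then show ?thesis
    using assms(2) by (subst act_comp[OF id_tuples]) (auto intro!: act_cong)
qed

lemma act_front:
  assumes "f \<in> tuples" "j < 4" shows "act (\<lambda>_. id) j \<circ> act f 0 = act f j"
  using assms by (subst act_comp) (auto intro!: act_cong)

end

declare One_nat_def [simp del]

section \<open>The group generated by one level preserving element and the shift\<close>

locale generated_grid = grid W "{1..n}" q
    for W :: "nat set" and n :: nat and q +
  fixes \<sigma> :: "nat \<Rightarrow> nat \<Rightarrow> nat"
  assumes \<sigma>: "\<sigma> \<in> tuples"
begin

abbreviation "S \<equiv> sym_group n"
text \<open>For a tree with coordinates, \<open>act \<sigma> 0\<close> is the black permutation and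
  \<open>act (\<lambda>_. id) 1\<close> the white one.\<close>

definition "G = subgroup_generated S {act \<sigma> 0, act (\<lambda>_. id) 1}"

lemma gens_in: "{act \<sigma> 0, act (\<lambda>_. id) 1} \<subseteq> carrier S"
  using act_permutes \<sigma> id_tuples by (auto simp: sym_group_carrier)

lemma carrier_G: "carrier G = generate S {act \<sigma> 0, act (\<lambda>_. id) 1}"
  using gens_in by (simp add: G_def carrier_subgroup_generated Int_absorb1)

lemma group_G: "group G"
  unfolding G_def by (rule group.group_subgroup_generated[OF sym_group_is_group])

lemma mult_G: "(\<otimes>\<^bsub>G\<^esub>) = (\<circ>)"
  unfolding G_def by (simp add: sym_group_mult)

lemma G_permutes: "g \<in> carrier G \<Longrightarrow> g permutes {1..n}"
  using group.generate_in_carrier[OF sym_group_is_group gens_in]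
  by (simp add: carrier_G sym_group_carrier)

lemma G_comp: "f \<in> carrier G \<Longrightarrow> g \<in> carrier G \<Longrightarrow> f \<circ> g \<in> carrier G"
  unfolding carrier_G using generate.eng[of f S _ g] by (simp only: sym_group_mult)

lemma G_inv:
  assumes "f \<in> carrier G" shows "inv' f \<in> carrier G"
proof -
  have "inv\<^bsub>S\<^esub> f \<in> carrier G"
    using group.generate_m_inv_closed[OF sym_group_is_group gens_in] assms by (simp add: carrier_G)
  then show ?thesis using G_permutes[OF assms] by (simp add: sym_group_carrier)
qed

text \<open>Lets elements of \<open>G\<close> be found from equations in which no inverse has to be
  computed.\<close>

lemma G_cancel:
  assumes "t \<circ> y = x" "x \<in> carrier G" "y \<in> carrier G"
  shows "t \<in> carrier G"
proof -
  have "x \<circ> inv' y = t"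
    using permutes_inv_o(1)[OF G_permutes[OF assms(3)]] by (simp add: assms(1)[symmetric] comp_assoc)
  then show ?thesis using G_comp[OF assms(2) G_inv[OF assms(3)]] by (simp only:)
qed

lemma act_\<sigma>_in: "act \<sigma> 0 \<in> carrier G"
  by (simp add: carrier_G generate.incl)

lemma act_rot_in: "act (\<lambda>_. id) j \<in> carrier G" if "j < 4" for j
  using that
proof (induction j)
  case 0
  then show ?case using generate.one[of S] by (simp only: act_id carrier_G sym_group_one)
next
  case (Suc j)
  have "act (\<lambda>_. id) j \<in> carrier G" by (rule Suc.IH) (use Suc.prems in simp)
  then have "act (\<lambda>_. id) 1 \<circ> act (\<lambda>_. id) j \<in> carrier G"
    by (rule G_comp[rotated]) (simp add: carrier_G generate.incl)
  then show ?case using Suc.prems by (subst (asm) act_comp[OF id_tuples]) (simp add: id_def comp_def One_nat_def)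
qed

text \<open>Conjugation by a power of the shift rotates the tuple.\<close>

lemma act_shift_in:
  assumes "f \<in> tuples" "act f 0 \<in> carrier G" "j < 4"
  shows "act (\<lambda>i. f ((i + j) mod 4)) 0 \<in> carrier G"
proof -
  \<comment> \<open>\<open>(4 - j) mod 4\<close> is the inverse shift; the reduction takes care of
    \<open>j = 0\<close>.\<close>
  have "act (\<lambda>i. f ((i + j) mod 4)) 0 \<in> carrier G"
    if "act (\<lambda>i. f ((i + j) mod 4)) 0 = act (\<lambda>_. id) ((4 - j) mod 4) \<circ> (act f 0 \<circ> act (\<lambda>_. id) j)"
    unfolding that using assms by (intro G_comp act_rot_in) auto
  moreover have "act f 0 \<circ> act (\<lambda>_. id) j = act (\<lambda>i. f ((i + j) mod 4)) j"
    using assms(3) by (subst act_comp[OF id_tuples]) simp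
  moreover have "act (\<lambda>_. id) ((4 - j) mod 4) \<circ> act (\<lambda>i. f ((i + j) mod 4)) j = act (\<lambda>i. f ((i + j) mod 4)) 0"
    using assms(3) by (subst act_comp[OF shift_tuples[OF assms(1)]]) (simp add: mod_simps)
  ultimately show ?thesis by simp
qed

text \<open>The upper bound on \<open>G\<close>: elements \<open>act f j\<close> with
  \<open>f\<close> in \<open>F\<close> compose to such elements because \<open>F\<close> is stable
  under rotation and pointwise composition. Induction over \<open>generate\<close> meets inverses of
  generators only, hence the single assumption on \<open>inv' (\<sigma> i)\<close>; the shift is
  inverted by the shift by 3.\<close>

lemma G_subset:
  assumes F: "F \<subseteq> tuples" "(\<lambda>_. id) \<in> F" "\<sigma> \<in> F" "(\<lambda>i. inv' (\<sigma> i)) \<in> F"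
    and comp: "\<And>f g. f \<in> F \<Longrightarrow> g \<in> F \<Longrightarrow> (\<lambda>i. f i \<circ> g i) \<in> F"
    and shift: "\<And>f j. f \<in> F \<Longrightarrow> (\<lambda>i. f ((i + j) mod 4)) \<in> F"
    and g: "g \<in> carrier G"
  shows "\<exists>f\<in>F. \<exists>j<4. g = act f j"
  using g unfolding carrier_G
proof induction
  case one
  show ?case using F(2) by (intro bexI[of _ "\<lambda>_. id"] exI[of _ 0]) (simp_all add: sym_group_one act_id del: id_apply)
next
  case (incl h)
  then show ?case
  proof (elim insertE emptyE)
    assume "h = act \<sigma> 0"
    then show ?case by (intro bexI[OF _ F(3)] exI[of _ 0]) simp
  next
    assume "h = act (\<lambda>_. id) 1"
    then show ?case by (intro bexI[OF _ F(2)] exI[of _ 1]) (simp add: id_def)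
  qed
next
  case (inv h)
  have h: "h \<in> carrier S" using inv gens_in by blast
  have I: "inv\<^bsub>S\<^esub> h = g" if "g \<in> carrier S" "g \<circ> h = id" for g
    by (rule group.inv_equality[OF sym_group_is_group])
      (use that h in \<open>simp_all add: sym_group_mult sym_group_one\<close>)
  from inv show ?case
  proof (elim insertE emptyE)
    assume h: "h = act \<sigma> 0"
    have "act (\<lambda>i. inv' (\<sigma> i)) 0 \<circ> h = act (\<lambda>_. id) 0"
      unfolding h act_comp0[OF \<sigma>]
      by (rule act_cong) (use \<sigma> in \<open>auto simp: tuples_def intro: permutes_inv_o\<close>)
    then have "inv\<^bsub>S\<^esub> h = act (\<lambda>i. inv' (\<sigma> i)) 0"
      by (intro I) (use act_permutes inv_tuples[OF \<sigma>] in \<open>auto simp: sym_group_carrier act_id\<close>)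
    then show ?case using F(4) by (intro bexI[OF _ F(4)] exI[of _ 0]) simp
  next
    assume h: "h = act (\<lambda>_. id) 1"
    have "act (\<lambda>_. id) 3 \<circ> h = act (\<lambda>_. id) 0"
      unfolding h by (subst act_comp[OF id_tuples]) simp
    then have "inv\<^bsub>S\<^esub> h = act (\<lambda>_. id) 3"
      by (intro I) (use act_permutes id_tuples in \<open>auto simp: sym_group_carrier act_id\<close>)
    then show ?case by (intro bexI[OF _ F(2)] exI[of _ 3]) (simp add: id_def)
  qed
next
  case (eng g h)
  then obtain f j f' j' where *: "g = act f j" "f \<in> F" "j < 4" "h = act f' j'" "f' \<in> F" "j' < 4"
    by blast
  have "f' \<in> tuples" using F(1) * by blast
  then have "g \<otimes>\<^bsub>S\<^esub> h = act (\<lambda>i. f ((i + j') mod 4) \<circ> f' i) ((j' + j) mod 4)"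
    using * by (simp add: sym_group_mult act_comp)
  moreover have "(\<lambda>i. f ((i + j') mod 4) \<circ> f' i) \<in> F"
    by (rule comp[OF shift[OF *(2)] *(5)])
  ultimately show ?case by (metis mod_less_divisor zero_less_numeral)
qed

section \<open>Splitting off the cyclic group of shifts\<close>

lemma rot_hom: "(\<lambda>j. act (\<lambda>_. id) (nat j)) \<in> hom (integer_mod_group 4) G"
proof (rule homI)
  fix x y :: int assume xy: "x \<in> carrier (integer_mod_group 4)" "y \<in> carrier (integer_mod_group 4)"
  then have "nat ((x + y) mod 4) = (nat y + nat x) mod 4"
    by (simp add: carrier_integer_mod_group nat_mod_distrib nat_add_distrib add.commute)
  then show "act (\<lambda>_. id) (nat (x \<otimes>\<^bsub>integer_mod_group 4\<^esub> y)) =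
      act (\<lambda>_. id) (nat x) \<otimes>\<^bsub>G\<^esub> act (\<lambda>_. id) (nat y)"
    by (simp add: mult_G act_comp[OF id_tuples])
qed (auto simp: carrier_integer_mod_group intro!: act_rot_in)

lemma rot_inj: "inj_on (\<lambda>j. act (\<lambda>_. id) (nat j)) (carrier (integer_mod_group 4))"
proof
  fix x y :: int assume xy: "x \<in> carrier (integer_mod_group 4)" "y \<in> carrier (integer_mod_group 4)"
    "act (\<lambda>_. id) (nat x) = act (\<lambda>_. id) (nat y)"
  then have "nat x = nat y"
    using act_inj(1)[OF xy(3) id_tuples id_tuples] by (auto simp: carrier_integer_mod_group)
  then show "x = y" using xy by (auto simp: carrier_integer_mod_group)
qed

text \<open>\<open>E\<close> reads elements of an abstract group as tuples. It will be the identity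
  for A_p^4, \<open>signs\<close> for Z_2^3 and a mirrored doubling for two copies of A_p or
  S_p.\<close>

lemma coord_hom:
  assumes E: "\<And>a. a \<in> carrier N \<Longrightarrow> E a \<in> tuples"
    and mult: "\<And>a b i. a \<in> carrier N \<Longrightarrow> b \<in> carrier N \<Longrightarrow> i < 4 \<Longrightarrow> E (a \<otimes>\<^bsub>N\<^esub> b) i = E a i \<circ> E b i"
    and closed: "\<And>a. a \<in> carrier N \<Longrightarrow> act (E a) 0 \<in> carrier G"
  shows "(\<lambda>a. act (E a) 0) \<in> hom N G"
proof (rule homI)
  fix a b assume "a \<in> carrier N" "b \<in> carrier N"
  then show "act (E (a \<otimes>\<^bsub>N\<^esub> b)) 0 = act (E a) 0 \<otimes>\<^bsub>G\<^esub> act (E b) 0"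
    by (auto simp: mult_G act_comp0 E mult intro!: act_cong)
qed (rule closed)

lemma coord_inj:
  assumes E: "\<And>a. a \<in> carrier N \<Longrightarrow> E a \<in> tuples"
    and inj: "\<And>a b. a \<in> carrier N \<Longrightarrow> b \<in> carrier N \<Longrightarrow> (\<And>i. i < 4 \<Longrightarrow> E a i = E b i) \<Longrightarrow> a = b"
  shows "inj_on (\<lambda>a. act (E a) 0) (carrier N)"
proof
  fix a b assume ab: "a \<in> carrier N" "b \<in> carrier N" "act (E a) 0 = act (E b) 0"
  show "a = b" by (rule inj[OF ab(1,2)]) (rule act_inj(2)[OF ab(3)], use ab E in auto)
qed

text \<open>Carrying a shift past a level preserving element rotates its tuple, so the range of
  \<open>E\<close> must be stable under rotation. By \<open>act_back\<close> the rotation is by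
  \<open>4 - j\<close>.\<close>

lemma coord_swap:
  assumes E: "\<And>a. a \<in> carrier N \<Longrightarrow> E a \<in> tuples"
    and shift: "\<And>a j. a \<in> carrier N \<Longrightarrow> \<exists>a'\<in>carrier N. \<forall>i<4. E a' i = E a ((i + j) mod 4)"
    and a: "a \<in> carrier N" and j: "j < 4"
  shows "\<exists>a'\<in>carrier N. act (\<lambda>_. id) j \<circ> act (E a) 0 = act (E a') 0 \<circ> act (\<lambda>_. id) j"
    and "\<exists>a'\<in>carrier N. act (E a) j = act (E a') 0 \<circ> act (\<lambda>_. id) j"
proof -
  obtain a' where a': "a' \<in> carrier N" "\<forall>i<4. E a' i = E a ((i + (4 - j)) mod 4)"
    using shift[OF a] by blast
  have "act (E a') 0 = act (\<lambda>i. E a ((i + (4 - j)) mod 4)) 0"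
    by (rule act_cong) (use a' in auto)
  then have *: "act (E a) j = act (E a') 0 \<circ> act (\<lambda>_. id) j"
    using act_back[OF E[OF a] j] by simp
  then show "\<exists>a'\<in>carrier N. act (E a) j = act (E a') 0 \<circ> act (\<lambda>_. id) j" using a' by blast
  show "\<exists>a'\<in>carrier N. act (\<lambda>_. id) j \<circ> act (E a) 0 = act (E a') 0 \<circ> act (\<lambda>_. id) j"
    using * a' act_front[OF E[OF a] j] by auto
qed

text \<open>The two images meet trivially because the shift is visible in the normal form
  \<open>act f j\<close>. What remains in each case is to describe the level preserving tuples by a
  group \<open>N\<close> stable under rotation.\<close>

lemma iso_semidirect_cyclic:
  assumes N: "group N" and E: "\<And>a. a \<in> carrier N \<Longrightarrow> E a \<in> tuples"
    and mult: "\<And>a b i. a \<in> carrier N \<Longrightarrow> b \<in> carrier N \<Longrightarrow> i < 4 \<Longrightarrow> E (a \<otimes>\<^bsub>N\<^esub> b) i = E a i \<circ> E b i"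
    and inj: "\<And>a b. a \<in> carrier N \<Longrightarrow> b \<in> carrier N \<Longrightarrow> (\<And>i. i < 4 \<Longrightarrow> E a i = E b i) \<Longrightarrow> a = b"
    and shift: "\<And>a j. a \<in> carrier N \<Longrightarrow> \<exists>a'\<in>carrier N. \<forall>i<4. E a' i = E a ((i + j) mod 4)"
    and closed: "\<And>a. a \<in> carrier N \<Longrightarrow> act (E a) 0 \<in> carrier G"
    and surj: "\<And>g. g \<in> carrier G \<Longrightarrow> \<exists>a\<in>carrier N. \<exists>j<4. g = act (E a) j"
  shows "iso_semidirect G N (integer_mod_group 4)"
proof (rule iso_semidirectI[OF N group_integer_mod_group group_G])
  show "(\<lambda>a. act (E a) 0) \<in> hom N G" using E mult closed by (rule coord_hom)
  show "inj_on (\<lambda>a. act (E a) 0) (carrier N)" using E inj by (rule coord_inj)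
  show "(\<lambda>j. act (\<lambda>_. id) (nat j)) \<in> hom (integer_mod_group 4) G" by (rule rot_hom)
  show "inj_on (\<lambda>j. act (\<lambda>_. id) (nat j)) (carrier (integer_mod_group 4))" by (rule rot_inj)
next
  fix h a assume ha: "h \<in> carrier (integer_mod_group 4)" "a \<in> carrier N"
  then have "nat h < 4" by (auto simp: carrier_integer_mod_group)
  then show "\<exists>a'\<in>carrier N. act (\<lambda>_. id) (nat h) \<otimes>\<^bsub>G\<^esub> act (E a) 0 =
      act (E a') 0 \<otimes>\<^bsub>G\<^esub> act (\<lambda>_. id) (nat h)"
    unfolding mult_G using coord_swap(1)[of N E, OF E shift ha(2)] by blast
next
  fix a h assume ah: "a \<in> carrier N" "h \<in> carrier (integer_mod_group 4)"
    "act (E a) 0 = act (\<lambda>_. id) (nat h)"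
  have "0 = nat h"
    by (rule act_inj(1)[OF ah(3)]) (use ah E id_tuples in \<open>auto simp: carrier_integer_mod_group\<close>)
  then show "h = \<one>\<^bsub>integer_mod_group 4\<^esub>" using ah by (simp add: carrier_integer_mod_group)
next
  fix g assume "g \<in> carrier G"
  then obtain a j where a: "a \<in> carrier N" "j < 4" "g = act (E a) j" using surj by blast
  obtain a' where "a' \<in> carrier N" "g = act (E a') 0 \<circ> act (\<lambda>_. id) j"
    using coord_swap(2)[of N E, OF E shift a(1,2)] a(3) by blast
  then show "\<exists>a\<in>carrier N. \<exists>h\<in>carrier (integer_mod_group 4).
      g = act (E a) 0 \<otimes>\<^bsub>G\<^esub> act (\<lambda>_. id) (nat h)"
    using a(2) by (auto simp: mult_G carrier_integer_mod_group intro!: bexI[of _ a'] bexI[of _ "int j"])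
qed

end

section \<open>Cycles on opposite levels\<close>

lemma mirror_comp: "2 \<le> r \<Longrightarrow> mirror r \<circ> mirror r = id"
  by (simp add: fun_eq_iff mirror_mirror)

text \<open>Conjugating a 3-cycle relabels its entries. This form fits sets of permutations that are
  normalised by the two cycles.\<close>

lemma alternating_subset_conj:
  assumes r: "2 \<le> r" and one: "id \<in> L" and comp: "\<And>f g. f \<in> L \<Longrightarrow> g \<in> L \<Longrightarrow> f \<circ> g \<in> L"
    and acyc: "\<And>f. f \<in> L \<Longrightarrow> acyc r \<circ> f \<circ> inv' (acyc r) \<in> L"
    and bcyc: "\<And>f. f \<in> L \<Longrightarrow> bcyc r \<circ> f \<circ> inv' (bcyc r) \<in> L"
    and start: "three_cycle 1 2 (Suc r) \<in> L"
  shows "carrier (alt_group (2 * r - 1)) \<subseteq> L"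
proof (rule alternating_subset[OF r one])
  have bij: "bij (acyc r)" "bij (bcyc r)"
    using acyc_permutes[OF r] bcyc_permutes[OF r] by (simp_all add: permutes_bij)
  fix u v w assume *: "distinct [u, v, w]" "three_cycle u v w \<in> L"
  show "three_cycle (acyc r u) (acyc r v) (acyc r w) \<in> L"
    using acyc[OF *(2)] by (simp only: three_cycle_conj[OF *(1) bij(1)])
  show "three_cycle (bcyc r u) (bcyc r v) (bcyc r w) \<in> L"
    using bcyc[OF *(2)] by (simp only: three_cycle_conj[OF *(1) bij(2)])
qed (fact comp start)+

text \<open>Once both cycles lie in \<open>L\<close>, their commutator supplies the initial 3-cycle.
  For even \<open>r\<close> the cycle \<open>acyc r\<close> is odd, and multiplication by it reaches
  the odd permutations.\<close>

lemma alternating_subset_subgroup: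
  assumes r: "2 \<le> r" and one: "id \<in> L" and comp: "\<And>f g. f \<in> L \<Longrightarrow> g \<in> L \<Longrightarrow> f \<circ> g \<in> L"
    and inv: "\<And>f. f \<in> L \<Longrightarrow> inv' f \<in> L" and ab: "acyc r \<in> L" "bcyc r \<in> L"
  shows "carrier (alt_group (2 * r - 1)) \<subseteq> L"
    and "even r \<Longrightarrow> carrier (sym_group (2 * r - 1)) \<subseteq> L"
proof -
  have "three_cycle 1 2 (Suc r) = (acyc r \<circ> bcyc r) \<circ> inv' (bcyc r \<circ> acyc r)"
    unfolding acyc_bcyc_commutator[OF r] comp_assoc
    using permutes_inv_o(1)[OF permutes_compose[OF acyc_permutes[OF r] bcyc_permutes[OF r]]]
    by (simp add: comp_assoc)
  also have "\<dots> \<in> L" by (intro comp inv ab)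
  finally have "three_cycle 1 2 (Suc r) \<in> L" .
  then show alt: "carrier (alt_group (2 * r - 1)) \<subseteq> L"
    by (intro alternating_subset_conj[OF r one]) (blast intro: comp inv ab)+
  show "carrier (sym_group (2 * r - 1)) \<subseteq> L" if "even r"
  proof
    fix f assume f: "f \<in> carrier (sym_group (2 * r - 1))"
    have *: "permutation f" "permutation (acyc r)"
      using sym_group_carrier'[OF f] permutation_acyc r by auto
    show "f \<in> L"
    proof (cases "evenperm f")
      case True
      then show ?thesis using alt f by (auto simp: alt_group_carrier sym_group_carrier)
    next
      case False
      have "evenperm (f \<circ> acyc r)"
        using False evenperm_acyc[of r] r \<open>even r\<close> by (simp add: evenperm_comp[OF *])
      moreover have "f \<circ> acyc r permutes {1..2 * r - 1}"
        using f acyc_permutes[OF r] by (intro permutes_compose) (simp_all add: sym_group_carrier)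
      ultimately have "f \<circ> acyc r \<in> carrier (alt_group (2 * r - 1))" by (simp add: alt_group_carrier)
      then have "f \<circ> acyc r \<in> L" using alt by blast
      then have "(f \<circ> acyc r) \<circ> inv' (acyc r) \<in> L" by (rule comp) (intro inv ab)
      then show ?thesis
        using permutes_inv_o(1)[OF acyc_permutes[OF r]] by (simp add: comp_assoc)
    qed
  qed
qed

text \<open>The tuple of \<open>\<sigma>\<^sub>0\<close>. Edges on the levels other than
  \<open>0\<close> and \<open>k\<close> end in black leaves, so they are fixed.\<close>

definition lev :: "nat \<Rightarrow> nat \<Rightarrow> nat \<Rightarrow> nat \<Rightarrow> nat" where
  "lev r k i = (if i = 0 then acyc r else if i = k then bcyc r else id)"

lemma lev_permutes: "2 \<le> r \<Longrightarrow> lev r k i permutes {1..2 * r - 1}"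
  by (simp add: lev_def acyc_permutes bcyc_permutes permutes_id)

lemma alt_group_comp: "f \<in> carrier (alt_group n) \<Longrightarrow> g \<in> carrier (alt_group n) \<Longrightarrow> f \<circ> g \<in> carrier (alt_group n)"
  using monoid.m_closed[OF group.is_monoid[OF alt_group_is_group], of f n g]
  by (simp only: alt_group_mult)

lemma group_power_group: "group H \<Longrightarrow> group (power_group H m)"
  by (simp add: power_group_def)

lemma less4_cases: "i < 4 \<Longrightarrow> i = 0 \<or> i = 1 \<or> i = 2 \<or> i = (3 :: nat)"
  by linarith

context
  fixes r :: nat assumes r: "2 \<le> r"
begin

lemma mirror_conj_comp:
  "mirror r \<circ> (f \<circ> g) \<circ> mirror r = (mirror r \<circ> f \<circ> mirror r) \<circ> (mirror r \<circ> g \<circ> mirror r)"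
  using r by (simp add: fun_eq_iff mirror_mirror)

lemma mirror_conj_conj: "mirror r \<circ> (mirror r \<circ> f \<circ> mirror r) \<circ> mirror r = f"
  using r by (simp add: fun_eq_iff mirror_mirror)

lemma mirror_conj_id: "mirror r \<circ> id \<circ> mirror r = id"
  using r by (simp add: fun_eq_iff mirror_mirror)

lemma mirror_conj_permutes:
  "f permutes {1..2 * r - 1} \<Longrightarrow> mirror r \<circ> f \<circ> mirror r permutes {1..2 * r - 1}"
  by (intro permutes_compose mirror_permutes r)

lemma mirror_conj_inv:
  assumes "f permutes {1..2 * r - 1}"
  shows "inv' (mirror r \<circ> f \<circ> mirror r) = mirror r \<circ> inv' f \<circ> mirror r"
proof (rule inv_unique_comp)
  show "(mirror r \<circ> f \<circ> mirror r) \<circ> (mirror r \<circ> inv' f \<circ> mirror r) = id"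
    using assms by (simp add: permutes_inv_o mirror_comp r flip: mirror_conj_comp)
  show "(mirror r \<circ> inv' f \<circ> mirror r) \<circ> (mirror r \<circ> f \<circ> mirror r) = id"
    using assms by (simp add: permutes_inv_o mirror_comp r flip: mirror_conj_comp)
qed

lemma mirror_conj_even:
  assumes "f permutes {1..2 * r - 1}" shows "evenperm (mirror r \<circ> f \<circ> mirror r) = evenperm f"
proof -
  have "permutation f" "permutation (mirror r)"
    using assms mirror_permutes[OF r] permutation_permutes by blast+
  then show ?thesis by (auto simp: evenperm_comp permutation_compose)
qed

end

locale opposite_cycles = generated_grid "{1..2 * r - 1}" n q "lev r 2" for r n q +
  assumes r: "2 \<le> r"
begin

definition H :: "(nat \<Rightarrow> nat) monoid" where
  "H = (if odd r then alt_group (2 * r - 1) else sym_group (2 * r - 1))"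

lemma group_H: "group H"
  by (simp add: H_def alt_group_is_group sym_group_is_group)

lemma mult_H: "(\<otimes>\<^bsub>H\<^esub>) = (\<circ>)"
  by (simp add: H_def alt_group_mult sym_group_mult)

lemma H_permutes: "f \<in> carrier H \<Longrightarrow> f permutes {1..2 * r - 1}"
  by (simp add: H_def alt_group_carrier sym_group_carrier split: if_splits)

lemma H_comp: "f \<in> carrier H \<Longrightarrow> g \<in> carrier H \<Longrightarrow> f \<circ> g \<in> carrier H"
  using monoid.m_closed[OF group.is_monoid[OF group_H], of f g] by (simp only: mult_H)

lemma H_id: "id \<in> carrier H"
  by (simp add: H_def alt_group_carrier sym_group_carrier permutes_id)

lemma H_inv: "f \<in> carrier H \<Longrightarrow> inv' f \<in> carrier H"
  by (auto simp: H_def alt_group_inv_closed sym_group_inv_closed)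

lemma H_mirror: "f \<in> carrier H \<Longrightarrow> mirror r \<circ> f \<circ> mirror r \<in> carrier H"
  using mirror_conj_permutes[OF r] mirror_conj_even[OF r]
  by (auto simp: H_def alt_group_carrier sym_group_carrier)

lemma H_acyc: "acyc r \<in> carrier H" "bcyc r \<in> carrier H"
  using r acyc_permutes bcyc_permutes evenperm_acyc[of r] evenperm_bcyc[of r]
  by (simp_all add: H_def alt_group_carrier sym_group_carrier)

text \<open>Level 2 is tied to level 0 by the mirror, as in \<open>\<sigma>\<^sub>0\<close>, where
  \<open>acyc r\<close> sits opposite its mirror image \<open>bcyc r\<close>.\<close>

definition diag :: "(nat \<Rightarrow> nat) \<Rightarrow> nat \<Rightarrow> nat \<Rightarrow> nat" where
  "diag f i = (if i = 0 then f else if i = 2 then mirror r \<circ> f \<circ> mirror r else id)"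

lemma diag_tuples: "f permutes {1..2 * r - 1} \<Longrightarrow> diag f \<in> tuples"
  by (simp add: tuples_def diag_def mirror_conj_permutes[OF r] permutes_id)

lemma diag_comp:
  "g permutes {1..2 * r - 1} \<Longrightarrow> act (diag f) 0 \<circ> act (diag g) 0 = act (diag (f \<circ> g)) 0"
  by (subst act_comp0[OF diag_tuples]) (auto intro!: act_cong simp: diag_def mirror_conj_comp[OF r] simp del: comp_apply)

text \<open>The \<open>f\<close> whose \<open>diag\<close> acts in \<open>G\<close> form a group. It
  contains \<open>acyc r\<close>, whose \<open>diag\<close> is \<open>\<sigma>\<^sub>0\<close>, and
  \<open>bcyc r\<close>, whose \<open>diag\<close> is \<open>\<sigma>\<^sub>0\<close> rotated by two
  levels, hence all of \<open>H\<close>.\<close>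

lemma diag_in: "f \<in> carrier H \<Longrightarrow> act (diag f) 0 \<in> carrier G"
proof -
  let ?L = "{f. f permutes {1..2 * r - 1} \<and> act (diag f) 0 \<in> carrier G}"
  have id: "id \<in> ?L"
  proof -
    have "act (diag id) 0 = act (\<lambda>_. id) 0"
      by (rule act_cong) (simp add: diag_def mirror_comp[OF r])
    then show ?thesis using act_rot_in[of 0] by (simp add: permutes_id)
  qed
  have comp: "f \<circ> g \<in> ?L" if "f \<in> ?L" "g \<in> ?L" for f g
    using that G_comp[of "act (diag f) 0" "act (diag g) 0"] by (simp add: diag_comp permutes_compose)
  have inv: "inv' f \<in> ?L" if "f \<in> ?L" for f
  proof -
    have "act (diag (inv' f)) 0 \<circ> act (diag f) 0 = act (diag id) 0"
      using that permutes_inv_o(2)[of f "{1..2 * r - 1}"] by (simp add: diag_comp)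
    from G_cancel[OF this] show ?thesis using that id by (simp add: permutes_inv)
  qed
  have a: "acyc r \<in> ?L"
  proof -
    have "act (diag (acyc r)) 0 = act (lev r 2) 0"
      by (rule act_cong) (simp add: diag_def lev_def mirror_acyc[OF r])
    then show ?thesis using act_\<sigma>_in by (simp add: acyc_permutes[OF r])
  qed
  have b: "bcyc r \<in> ?L"
  proof -
    have "act (diag (bcyc r)) 0 = act (\<lambda>i. lev r 2 ((i + 2) mod 4)) 0"
      by (rule act_cong, drule less4_cases) (auto simp: diag_def lev_def mirror_bcyc[OF r])
    then show ?thesis using act_shift_in[OF \<sigma> act_\<sigma>_in, of 2] by (simp add: bcyc_permutes[OF r])
  qed
  have "carrier H \<subseteq> ?L"
    using alternating_subset_subgroup[OF r id comp inv a b] by (auto simp: H_def)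
  then show "act (diag f) 0 \<in> carrier G" if "f \<in> carrier H" using that by blast
qed

text \<open>The free components occupy levels 0 and 1 and are repeated in mirrored form on levels 2
  and 3.\<close>

definition E :: "(nat \<Rightarrow> nat \<Rightarrow> nat) \<Rightarrow> nat \<Rightarrow> nat \<Rightarrow> nat" where
  "E a i = (if i < 2 then a i else mirror r \<circ> a (i - 2) \<circ> mirror r)"

lemma E_H:
  assumes "a \<in> carrier (power_group H 2)" "i < 4" shows "E a i \<in> carrier H"
  using assms by (auto simp: E_def power_group_def PiE_iff intro!: H_mirror)

text \<open>The mirror is an involution, so the relation persists when \<open>i + 2\<close> wraps
  around to levels 0 and 1.\<close>

lemma E_mirror:
  assumes "i < 4" shows "E a ((i + 2) mod 4) = mirror r \<circ> E a i \<circ> mirror r"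
  using less4_cases[OF assms] mirror_conj_conj[OF r]
  by (auto simp: E_def One_nat_def simp del: comp_apply)

lemma iso_opposite: "iso_semidirect G (power_group H 2) (integer_mod_group 4)"
proof (rule iso_semidirect_cyclic[where E = E])
  show "group (power_group H 2)" by (rule group_power_group[OF group_H])
next
  fix a assume "a \<in> carrier (power_group H 2)"
  then show "E a \<in> tuples" using E_H H_permutes by (auto simp: tuples_def)
next
  fix a b i assume ab: "a \<in> carrier (power_group H 2)" "b \<in> carrier (power_group H 2)" "i < (4 :: nat)"
  show "E (a \<otimes>\<^bsub>power_group H 2\<^esub> b) i = E a i \<circ> E b i"
    using ab(3) by (auto simp: E_def power_group_def mult_H mirror_conj_comp[OF r] simp del: comp_apply)
next
  fix a b assume ab: "a \<in> carrier (power_group H 2)" "b \<in> carrier (power_group H 2)"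
    and eq: "\<And>i. i < 4 \<Longrightarrow> E a i = E b i"
  show "a = b"
  proof (rule PiE_ext)
    show "a \<in> {..<2} \<rightarrow>\<^sub>E carrier H" "b \<in> {..<2} \<rightarrow>\<^sub>E carrier H"
      using ab by (simp_all add: power_group_def)
    show "a i = b i" if "i \<in> {..<2}" for i using eq[of i] that by (simp add: E_def)
  qed
next
  fix a and j :: nat assume a: "a \<in> carrier (power_group H 2)"
  \<comment> \<open>A rotated tuple is determined by its entries on levels 0 and 1; restricting to
    them gives an element of the product group.\<close>
  let ?a = "\<lambda>i\<in>{..<2}. E a ((i + j) mod 4)"
  have "?a \<in> carrier (power_group H 2)"
    using E_H[OF a] by (auto simp: power_group_def)
  moreover have "E ?a i = E a ((i + j) mod 4)" if "i < 4" for i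
  proof (cases "i < 2")
    case False
    then have "i = (i - 2) + 2" by simp
    then have "(i + j) mod 4 = ((i - 2 + j) mod 4 + 2) mod 4"
      by (metis add.assoc add.commute mod_add_left_eq)
    moreover have "E ?a i = mirror r \<circ> E a ((i - 2 + j) mod 4) \<circ> mirror r"
    proof -
      have "i - 2 < 2" using that by simp
      then show ?thesis using False by (simp add: E_def[of ?a i])
    qed
    ultimately show ?thesis using E_mirror[of "(i - 2 + j) mod 4" a] by simp
  qed (simp add: E_def)
  ultimately show "\<exists>a'\<in>carrier (power_group H 2). \<forall>i<4. E a' i = E a ((i + j) mod 4)" by blast
next
  fix a assume a: "a \<in> carrier (power_group H 2)"
  then have a': "a 0 \<in> carrier H" "a 1 \<in> carrier H" by (auto simp: power_group_def PiE_iff)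
  \<comment> \<open>Rotation by 3 moves the pair of levels 0, 2 to the pair 1, 3.\<close>
  have t: "(\<lambda>i. diag (a 1) ((i + 3) mod 4)) \<in> tuples"
    by (rule shift_tuples[OF diag_tuples[OF H_permutes[OF a'(2)]]])
  have "act (E a) 0 = act (diag (a 0)) 0 \<circ> act (\<lambda>i. diag (a 1) ((i + 3) mod 4)) 0"
    unfolding act_comp0[OF t]
    by (rule act_cong, drule less4_cases) (auto simp: E_def diag_def One_nat_def simp del: comp_apply)
  also have "\<dots> \<in> carrier G"
    by (intro G_comp diag_in act_shift_in diag_tuples H_permutes a') simp
  finally show "act (E a) 0 \<in> carrier G" .
next
  fix g assume g: "g \<in> carrier G"
  \<comment> \<open>The mirror relation between opposite levels holds for both generators and
    survives composition and rotation.\<close>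
  let ?F = "{f. \<forall>i<4. f i \<in> carrier H \<and> f ((i + 2) mod 4) = mirror r \<circ> f i \<circ> mirror r}"
  have "\<exists>f\<in>?F. \<exists>j<4. g = act f j"
  proof (rule G_subset[OF _ _ _ _ _ _ g])
    show "?F \<subseteq> tuples" using H_permutes by (auto simp: tuples_def)
    show "(\<lambda>_. id) \<in> ?F" using H_id mirror_conj_id[OF r] by simp
    have "lev r 2 i \<in> carrier H \<and> lev r 2 ((i + 2) mod 4) = mirror r \<circ> lev r 2 i \<circ> mirror r"
      if "i < 4" for i
      using less4_cases[OF that] H_acyc H_id mirror_acyc[OF r] mirror_bcyc[OF r] mirror_conj_id[OF r]
      by (auto simp: lev_def simp del: comp_apply)
    then show lev: "lev r 2 \<in> ?F" by blast
    have "inv' (lev r 2 ((i + 2) mod 4)) = mirror r \<circ> inv' (lev r 2 i) \<circ> mirror r" if "i < 4" for i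
      using lev that mirror_conj_inv[OF r lev_permutes[OF r, of 2 i]] by simp
    then show "(\<lambda>i. inv' (lev r 2 i)) \<in> ?F" using H_inv lev by blast
    show "(\<lambda>i. f i \<circ> g i) \<in> ?F" if "f \<in> ?F" "g \<in> ?F" for f g
      using that H_comp by (auto simp: mirror_conj_comp[OF r] simp del: comp_apply)
    show "(\<lambda>i. f ((i + j) mod 4)) \<in> ?F" if f: "f \<in> ?F" for f and j :: nat
    proof -
      have "f (((i + 2) mod 4 + j) mod 4) = mirror r \<circ> f ((i + j) mod 4) \<circ> mirror r" for i
      proof -
        have "((i + 2) mod 4 + j) mod 4 = ((i + j) mod 4 + 2) mod 4"
          by (simp add: mod_simps add.commute add.left_commute)
        then show ?thesis using f by simp
      qed
      then show ?thesis using f by simp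
    qed
  qed
  then obtain f j where f: "f \<in> ?F" "j < 4" "g = act f j" by blast
  have "restrict f {..<2} \<in> carrier (power_group H 2)" using f(1) by (auto simp: power_group_def)
  moreover have "E (restrict f {..<2}) i = f i" if i: "i < 4" for i
  proof (cases "i < 2")
    case False
    then have "(i - 2 + 2) mod 4 = i" "i - 2 < 2" using i by auto
    then show ?thesis using f(1)[THEN CollectD, rule_format, of "i - 2"] False by (simp add: E_def)
  qed (simp add: E_def)
  then have "g = act (E (restrict f {..<2})) j" unfolding f(3) by (intro act_cong) simp
  ultimately show "\<exists>a\<in>carrier (power_group H 2). \<exists>j<4. g = act (E a) j" using f(2) by blast
qed

end

section \<open>Cycles on adjacent levels\<close>

locale adjacent_cycles = generated_grid "{1..2 * r - 1}" n q "lev r 1" for r n q +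
  assumes r: "2 \<le> r"
begin

definition single :: "nat \<Rightarrow> (nat \<Rightarrow> nat) \<Rightarrow> nat \<Rightarrow> nat \<Rightarrow> nat" where
  "single m f i = (if i = m then f else id)"

lemma single_tuples: "f permutes {1..2 * r - 1} \<Longrightarrow> single m f \<in> tuples"
  by (simp add: tuples_def single_def permutes_id)

lemma single_comp:
  "g permutes {1..2 * r - 1} \<Longrightarrow> act (single m f) 0 \<circ> act (single m g) 0 = act (single m (f \<circ> g)) 0"
  by (subst act_comp0[OF single_tuples]) (auto intro!: act_cong simp: single_def simp del: comp_apply)

text \<open>\<open>\<sigma>\<^sub>0\<close> rotated so that the cycles sit on levels
  \<open>m\<close> and \<open>m + 1\<close>. There is no wrap-around: \<open>m = 3\<close> would
  need a level 4, hence the bound \<open>m < 3\<close> below.\<close>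

definition pair :: "nat \<Rightarrow> nat \<Rightarrow> nat \<Rightarrow> nat" where
  "pair m i = (if i = m then acyc r else if i = Suc m then bcyc r else id)"

lemma pair_tuples: "pair m \<in> tuples"
  using r by (simp add: tuples_def pair_def acyc_permutes bcyc_permutes permutes_id)

lemma pair_in:
  assumes "m < 3" shows "act (pair m) 0 \<in> carrier G"
proof -
  have "m = 0 \<or> m = 1 \<or> m = 2" using assms by linarith
  \<comment> \<open>Rotation by \<open>(4 - m) mod 4\<close> carries level 0 to level
    \<open>m\<close>; the reduction is for \<open>m = 0\<close>.\<close>
  then have "act (pair m) 0 = act (\<lambda>i. lev r 1 ((i + (4 - m) mod 4) mod 4)) 0"
    by (intro act_cong, drule_tac less4_cases) (auto simp: pair_def lev_def simp flip: One_nat_def)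
  then show ?thesis using act_shift_in[OF \<sigma> act_\<sigma>_in, of "(4 - m) mod 4"] by simp
qed

text \<open>An element supported on level 1 feels only the entry \<open>pair m 1\<close>, which is
  \<open>bcyc r\<close> for \<open>m = 0\<close> and \<open>acyc r\<close> for
  \<open>m = 1\<close>.\<close>

lemma single1_conj:
  assumes f: "f permutes {1..2 * r - 1}" "act (single 1 f) 0 \<in> carrier G"
    and m: "m < 3" and g: "g = pair m 1"
  shows "act (single 1 (g \<circ> f \<circ> inv' g)) 0 \<in> carrier G"
proof (rule G_cancel)
  have "g permutes {1..2 * r - 1}" using pair_tuples[of m] by (simp add: tuples_def g)
  then have "g \<circ> f \<circ> inv' g \<circ> g = g \<circ> f" by (simp add: comp_assoc permutes_inv_o)
  then show "act (single 1 (g \<circ> f \<circ> inv' g)) 0 \<circ> act (pair m) 0 = act (pair m) 0 \<circ> act (single 1 f) 0"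
    unfolding act_comp0[OF pair_tuples] act_comp0[OF single_tuples[OF f(1)]]
    by (intro act_cong) (auto simp: single_def g simp del: comp_apply)
  show "act (pair m) 0 \<circ> act (single 1 f) 0 \<in> carrier G" by (intro G_comp pair_in m f)
  show "act (pair m) 0 \<in> carrier G" by (intro pair_in m)
qed

text \<open>The permutations that occur alone on level 1 are normalised by both cycles but need not
  include them: for even \<open>r\<close> a lone cycle has the wrong total parity. Hence the
  conjugation form of the generation lemma.\<close>

lemma single_in:
  assumes f: "f \<in> carrier (alt_group (2 * r - 1))" and m: "m < 4"
  shows "act (single m f) 0 \<in> carrier G"
proof -
  let ?L = "{f. f permutes {1..2 * r - 1} \<and> act (single 1 f) 0 \<in> carrier G}"
  have conj: "g \<circ> f \<circ> inv' g \<in> ?L" if "f \<in> ?L" "m < 3" "g = pair m 1" for f g m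
  proof -
    have "g permutes {1..2 * r - 1}" using pair_tuples[of m] by (simp add: tuples_def that(3))
    then have "g \<circ> f \<circ> inv' g permutes {1..2 * r - 1}"
      using that(1) by (intro permutes_compose permutes_inv) auto
    then show ?thesis using single1_conj[OF _ _ that(2,3)] that(1) by blast
  qed
  have "carrier (alt_group (2 * r - 1)) \<subseteq> ?L"
  proof (rule alternating_subset_conj[OF r])
    have "act (single 1 id) 0 = act (\<lambda>_. id) 0" by (rule act_cong) (simp add: single_def)
    then show "id \<in> ?L" using act_rot_in[of 0] by (simp add: permutes_id)
    show "f \<circ> g \<in> ?L" if "f \<in> ?L" "g \<in> ?L" for f g
      using that G_comp[of "act (single 1 f) 0" "act (single 1 g) 0"]
      by (simp add: single_comp permutes_compose)
    show "acyc r \<circ> f \<circ> inv' (acyc r) \<in> ?L" if "f \<in> ?L" for f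
      by (rule conj[OF that, of 1]) (simp_all add: pair_def)
    show "bcyc r \<circ> f \<circ> inv' (bcyc r) \<in> ?L" if "f \<in> ?L" for f
      by (rule conj[OF that, of 0]) (simp_all add: pair_def One_nat_def)
    \<comment> \<open>\<open>pair 0\<close> and \<open>pair 1\<close> overlap on level 1 only, with
      entries \<open>bcyc r\<close> and \<open>acyc r\<close>; on every other level at least one of
      them is trivial. Their commutator is thus a 3-cycle confined to level 1.\<close>
    have "act (single 1 (three_cycle 1 2 (Suc r))) 0 \<circ> (act (pair 0) 0 \<circ> act (pair 1) 0) =
        act (pair 1) 0 \<circ> act (pair 0) 0"
      unfolding act_comp0[OF pair_tuples] act_comp0[OF comp_tuples[OF pair_tuples pair_tuples]]
      by (rule act_cong)
        (auto simp: single_def pair_def One_nat_def acyc_bcyc_commutator[OF r, unfolded One_nat_def] simp del: comp_apply)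
    then have "act (single 1 (three_cycle 1 2 (Suc r))) 0 \<in> carrier G"
      by (rule G_cancel) (intro G_comp pair_in; simp)+
    moreover have "three_cycle 1 2 (Suc r) permutes {1..2 * r - 1}"
      unfolding three_cycle_def by (rule permutes_subset[OF cycle_permutes]) (use r in auto)
    ultimately show "three_cycle 1 2 (Suc r) \<in> ?L" by blast
  qed
  then have f': "f permutes {1..2 * r - 1}" "act (single 1 f) 0 \<in> carrier G" using f by auto
  \<comment> \<open>Rotation by \<open>5 - m\<close> carries level 1 to level \<open>m\<close>, as
    \<open>m + (5 - m)\<close> is 1 modulo 4.\<close>
  have "act (single m f) 0 = act (\<lambda>i. single 1 f ((i + (5 - m) mod 4) mod 4)) 0"
    by (rule act_cong, drule less4_cases)
      (use less4_cases[OF m] in \<open>auto simp: single_def One_nat_def\<close>)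
  then show ?thesis using act_shift_in[OF single_tuples[OF f'(1)] f'(2), of "(5 - m) mod 4"] by simp
qed

lemma even_in:
  assumes f: "\<And>i. i < 4 \<Longrightarrow> f i \<in> carrier (alt_group (2 * r - 1))"
  shows "act f 0 \<in> carrier G"
proof -
  have p: "f i permutes {1..2 * r - 1}" if "i < 4" for i using f[OF that] by (simp add: alt_group_carrier)
  have "act f 0 = act (single 0 (f 0)) 0 \<circ> (act (single 1 (f 1)) 0 \<circ>
      (act (single 2 (f 2)) 0 \<circ> act (single 3 (f 3)) 0))"
    using p
    by (simp add: act_comp0 single_tuples comp_tuples)
      (rule act_cong, drule less4_cases, auto simp: single_def simp del: comp_apply)
  also have "\<dots> \<in> carrier G" by (intro G_comp single_in f) simp_all
  finally show ?thesis .
qed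

abbreviation "N \<equiv> power_group (alt_group (2 * r - 1)) 4"

lemma N_carrier: "a \<in> carrier N \<longleftrightarrow>
    (\<forall>i<4. a i \<in> carrier (alt_group (2 * r - 1))) \<and> (\<forall>i\<ge>4. a i = undefined)"
  by (auto simp: power_group_def PiE_iff extensional_def)

lemma N_tuples: "a \<in> carrier N \<Longrightarrow> a \<in> tuples"
  by (simp add: N_carrier tuples_def alt_group_carrier)

lemma N_mult: "i < 4 \<Longrightarrow> (a \<otimes>\<^bsub>N\<^esub> b) i = a i \<circ> b i"
  by (simp add: power_group_def alt_group_mult)

lemma N_inj: "a \<in> carrier N \<Longrightarrow> b \<in> carrier N \<Longrightarrow> (\<And>i. i < 4 \<Longrightarrow> a i = b i) \<Longrightarrow> a = b"
  unfolding power_group_def carrier_product_group by (rule PiE_ext) auto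

lemma N_restrict:
  assumes "\<And>i. i < 4 \<Longrightarrow> f i \<in> carrier (alt_group (2 * r - 1))"
  shows "restrict f {..<4} \<in> carrier N"
  using assms by (auto simp: N_carrier)

lemma N_shift: "a \<in> carrier N \<Longrightarrow> \<exists>a'\<in>carrier N. \<forall>i<4. a' i = a ((i + j) mod 4)"
  by (rule bexI[of _ "restrict (\<lambda>i. a ((i + j) mod 4)) {..<4}"]) (auto simp: N_carrier)

lemma N_in: "a \<in> carrier N \<Longrightarrow> act a 0 \<in> carrier G"
  by (rule even_in) (simp add: N_carrier)

text \<open>For odd \<open>r\<close> both cycles are even, so all level entries in \<open>G\<close>
  are even; conversely \<open>even_in\<close> provides all tuples of even permutations.\<close>

lemma iso_adjacent_odd:
  assumes "odd r" shows "iso_semidirect G N (integer_mod_group 4)"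
proof (rule iso_semidirect_cyclic[where E = "\<lambda>a. a"])
  fix g assume g: "g \<in> carrier G"
  let ?F = "{f. \<forall>i<4. f i \<in> carrier (alt_group (2 * r - 1))}"
  have "\<exists>f\<in>?F. \<exists>j<4. g = act f j"
  proof (rule G_subset[OF _ _ _ _ _ _ g])
    show "?F \<subseteq> tuples" by (auto simp: tuples_def alt_group_carrier)
    show "(\<lambda>_. id) \<in> ?F" by (simp add: alt_group_carrier permutes_id)
    show lev: "lev r 1 \<in> ?F"
      using assms r evenperm_acyc[of r] evenperm_bcyc[of r]
      by (auto simp: alt_group_carrier lev_permutes) (simp add: lev_def)
    show "(\<lambda>i. inv' (lev r 1 i)) \<in> ?F" using lev by (auto simp: alt_group_inv_closed)
    show "(\<lambda>i. f i \<circ> g i) \<in> ?F" if "f \<in> ?F" "g \<in> ?F" for f g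
      using that alt_group_comp by simp
  qed simp
  then obtain f j where f: "f \<in> ?F" "j < 4" "g = act f j" by blast
  have "restrict f {..<4} \<in> carrier N" using f(1) by (intro N_restrict) simp
  moreover have "g = act (restrict f {..<4}) j" unfolding f(3) by (intro act_cong) simp
  ultimately show "\<exists>a\<in>carrier N. \<exists>j<4. g = act a j" using f(2) by blast
qed (use N_tuples N_mult N_inj N_shift N_in in \<open>auto intro!: group_power_group alt_group_is_group\<close>)

text \<open>The nested equality of truth values says that the number of odd entries is even.\<close>

definition even_tuples :: "(nat \<Rightarrow> nat \<Rightarrow> nat) set" where
  "even_tuples = {f \<in> tuples. (evenperm (f 0) = evenperm (f 1)) = (evenperm (f 2) = evenperm (f 3))}"

lemma tuples_permutation: "f \<in> tuples \<Longrightarrow> i < 4 \<Longrightarrow> permutation (f i)"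
  unfolding tuples_def permutation_permutes by blast

lemma even_tuples_comp: "f \<in> even_tuples \<Longrightarrow> g \<in> even_tuples \<Longrightarrow> (\<lambda>i. f i \<circ> g i) \<in> even_tuples"
  using tuples_permutation[of f] tuples_permutation[of g] comp_tuples[of f g]
  by (auto simp: even_tuples_def evenperm_comp)

lemma even_tuples_inv: "f \<in> even_tuples \<Longrightarrow> (\<lambda>i. inv' (f i)) \<in> even_tuples"
  using tuples_permutation[of f] inv_tuples[of f]
  by (auto simp: even_tuples_def evenperm_inv)

lemma even_tuples_shift:
  assumes "f \<in> even_tuples" shows "(\<lambda>i. f ((i + j) mod 4)) \<in> even_tuples"
proof -
  define m where "m = j mod 4"
  have m: "m < 4" "(i + j) mod 4 = (i + m) mod 4" for i by (simp_all add: m_def mod_simps)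
  have "(\<lambda>i. f ((i + m) mod 4)) \<in> even_tuples"
    using less4_cases[OF m(1)] assms shift_tuples[of f m]
    by (elim disjE) (simp_all add: even_tuples_def del: add_2_eq_Suc add_2_eq_Suc', blast+)
  then show ?thesis by (simp only: m(2))
qed

text \<open>Multiplying by \<open>pair m\<close> flips the parity on levels \<open>m\<close> and
  \<open>m + 1\<close>. Doing this where necessary for \<open>m = 0, 1, 2\<close> makes the first
  three entries even, and the last is then even by total parity.\<close>

lemma act_even_tuples:
  assumes "even r" shows "f \<in> even_tuples \<Longrightarrow> act f 0 \<in> carrier G"
proof -
  have odd: "\<not> evenperm (acyc r)" "\<not> evenperm (bcyc r)"
    using assms r evenperm_acyc[of r] evenperm_bcyc[of r] by auto
  have pair: "pair m \<in> even_tuples" if "m = 0 \<or> m = 1 \<or> m = 2" for m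
    using that pair_tuples[of m] odd by (auto simp: even_tuples_def pair_def simp flip: One_nat_def)
  \<comment> \<open>One elimination: the entries below \<open>m\<close> are already even and
    \<open>pair m\<close> leaves them alone; \<open>IH\<close> covers the tuples whose entry
    \<open>m\<close> is even too.\<close>
  have step: "act f 0 \<in> carrier G"
    if f: "f \<in> even_tuples" "\<And>i. i < m \<Longrightarrow> evenperm (f i)" and m: "m = 0 \<or> m = 1 \<or> m = 2"
      and IH: "\<And>f. f \<in> even_tuples \<Longrightarrow> (\<And>i. i < Suc m \<Longrightarrow> evenperm (f i)) \<Longrightarrow> act f 0 \<in> carrier G"
    for f m
  proof (cases "evenperm (f m)")
    case True
    then show ?thesis using f by (intro IH) (auto simp: less_Suc_eq)
  next
    case False
    have "act (\<lambda>i. f i \<circ> pair m i) 0 \<in> carrier G"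
    proof (rule IH[OF even_tuples_comp[OF f(1) pair[OF m]]])
      fix i assume i: "i < Suc m"
      then have "i < 4" using m by auto
      then have "permutation (f i)" "permutation (pair m i)"
        using f(1) pair_tuples by (auto simp: even_tuples_def intro: tuples_permutation)
      then show "evenperm (f i \<circ> pair m i)"
        using i f(2)[of i] False odd by (auto simp: evenperm_comp pair_def less_Suc_eq)
    qed
    then show ?thesis
      using G_cancel[OF act_comp0[OF pair_tuples, of f m]] pair_in[of m] m by auto
  qed
  have 3: "act f 0 \<in> carrier G" if "f \<in> even_tuples" "\<And>i. i < 3 \<Longrightarrow> evenperm (f i)" for f
  proof (rule even_in)
    fix i :: nat assume "i < 4"
    then show "f i \<in> carrier (alt_group (2 * r - 1))"
      using that(1) that(2)[of 0] that(2)[of 1] that(2)[of 2] less4_cases[of i]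
      by (auto simp: even_tuples_def alt_group_carrier tuples_def)
  qed
  have 2: "act f 0 \<in> carrier G" if "f \<in> even_tuples" "\<And>i. i < 2 \<Longrightarrow> evenperm (f i)" for f
    by (rule step[where m = 2]) (use that 3 in auto)
  have 1: "act f 0 \<in> carrier G" if "f \<in> even_tuples" "\<And>i. i < 1 \<Longrightarrow> evenperm (f i)" for f
    by (rule step[where m = 1]) (use that 2 in auto)
  show "act f 0 \<in> carrier G" if "f \<in> even_tuples"
    by (rule step[where m = 0]) (use that 1 in \<open>auto simp: One_nat_def\<close>)
qed

text \<open>For even \<open>r\<close> the tuple of \<open>\<sigma>\<^sub>0\<close> has exactly two
  odd entries, and even total parity survives composition and rotation.\<close>

lemma G_even_tuples:
  assumes "even r" "g \<in> carrier G" shows "\<exists>f\<in>even_tuples. \<exists>j<4. g = act f j"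
proof (rule G_subset[OF _ _ _ _ _ _ assms(2)])
  show "even_tuples \<subseteq> tuples" by (auto simp: even_tuples_def)
  show "(\<lambda>_. id) \<in> even_tuples" by (simp add: even_tuples_def id_tuples del: id_apply)
  show "lev r 1 \<in> even_tuples"
    using \<sigma> r assms(1) evenperm_acyc[of r] evenperm_bcyc[of r] by (simp add: even_tuples_def lev_def)
  then show "(\<lambda>i. inv' (lev r 1 i)) \<in> even_tuples" by (rule even_tuples_inv)
qed (fact even_tuples_comp even_tuples_shift)+

text \<open>The parities of a tuple of permutations in the group have even sum, so three of them determine
  the fourth; odd entries are represented by the transposition \<open>(1 2)\<close>.\<close>

abbreviation "V \<equiv> power_group (integer_mod_group 2) 3"

definition parity :: "(nat \<Rightarrow> int) \<Rightarrow> nat \<Rightarrow> int" where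
  "parity v i = (if i < 3 then v i else (v 0 + v 1 + v 2) mod 2)"

definition signs :: "(nat \<Rightarrow> int) \<Rightarrow> nat \<Rightarrow> nat \<Rightarrow> nat" where
  "signs v i = (if parity v i = 0 then id else transpose 1 2)"

lemma group_V: "group V"
  by (rule group_power_group) simp

lemma V_carrier: "v \<in> carrier V \<longleftrightarrow> (\<forall>i<3. v i = 0 \<or> v i = 1) \<and> (\<forall>i\<ge>3. v i = undefined)"
proof -
  have "v i = 0 \<or> v i = 1 \<longleftrightarrow> v i \<in> {0..<2}" for i by auto
  then show ?thesis
    by (auto simp: power_group_def PiE_iff extensional_def carrier_integer_mod_group)
qed

lemma V_eqI: "v \<in> carrier V \<Longrightarrow> w \<in> carrier V \<Longrightarrow> (\<And>i. i < 3 \<Longrightarrow> v i = w i) \<Longrightarrow> v = w"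
  unfolding power_group_def carrier_product_group by (rule PiE_ext) auto

lemma parity_01:
  assumes "v \<in> carrier V" shows "parity v i = 0 \<or> parity v i = 1"
proof (cases "i < 3")
  case True
  then show ?thesis using assms by (simp add: V_carrier parity_def)
next
  case False
  then show ?thesis by (simp add: parity_def) presburger
qed

lemma parity_mult:
  assumes "i < 4" shows "parity (v \<otimes>\<^bsub>V\<^esub> w) i = (parity v i + parity w i) mod 2"
proof (cases "i < 3")
  case True
  then show ?thesis by (simp add: parity_def power_group_def)
next
  case False
  then have "i = 3" using assms by simp
  then show ?thesis by (auto simp: parity_def power_group_def mod2_eq_if)
qed

text \<open>The sum of the four parities is even and rotation does not change it, so a rotated
  vector is again determined by its first three entries.\<close>

lemma parity_shift:
  assumes "v \<in> carrier V"
  shows "\<exists>w\<in>carrier V. \<forall>i<4. parity w i = parity v ((i + j) mod 4)"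
proof -
  define m where "m = j mod 4"
  have m: "m < 4" "(i + j) mod 4 = (i + m) mod 4" for i by (simp_all add: m_def mod_simps)
  define w where "w = (\<lambda>i\<in>{..<3}. parity v ((i + m) mod 4))"
  have "w \<in> carrier V"
    using parity_01[OF assms] by (simp add: V_carrier w_def)
  moreover have "parity w i = parity v ((i + m) mod 4)" if "i < 4" for i
  proof (cases "i < 3")
    case True
    then show ?thesis by (subst parity_def) (simp add: w_def)
  next
    case False
    then have "i = 3" using that by simp
    obtain a b c where abc: "v 0 = a" "v 1 = b" "v 2 = c" by blast
    have 01: "a = 0 \<or> a = 1" "b = 0 \<or> b = 1" "c = 0 \<or> c = 1"
      using assms by (simp_all add: V_carrier flip: abc)
    have w3: "parity w 3 = (parity v (m mod 4) + parity v ((1 + m) mod 4) + parity v ((2 + m) mod 4)) mod 2"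
      by (subst parity_def) (simp add: w_def)
    have pv: "parity v 0 = a" "parity v 1 = b" "parity v 2 = c" "parity v 3 = (a + b + c) mod 2"
      by (simp_all add: parity_def abc)
    consider "m = 0" | "m = 1" | "m = 2" | "m = 3" using m(1) by linarith
    then show ?thesis
      unfolding \<open>i = 3\<close> w3
      by cases (use 01 in \<open>simp_all add: pv del: add_2_eq_Suc add_2_eq_Suc'\<close>, presburger+)
  qed
  ultimately show ?thesis unfolding m(2) by blast
qed

lemma transpose_permutes: "transpose 1 2 permutes {1..2 * r - 1}"
  using r by (intro permutes_swap_id) auto

lemma signs_permutes: "signs v i permutes {1..2 * r - 1}"
  by (simp add: signs_def transpose_permutes permutes_id)

lemma evenperm_signs: "evenperm (signs v i) \<longleftrightarrow> parity v i = 0"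
  by (simp add: signs_def evenperm_swap)

lemma signs_signs: "signs v i \<circ> signs v i = id"
  by (simp add: signs_def)

text \<open>All entries are powers of one fixed involution, so adding parities amounts to
  composing.\<close>

lemma signs_mult:
  assumes "v \<in> carrier V" "w \<in> carrier V" "i < 4"
  shows "signs (v \<otimes>\<^bsub>V\<^esub> w) i = signs v i \<circ> signs w i"
  using parity_01[OF assms(1), of i] parity_01[OF assms(2), of i]
  by (auto simp: signs_def parity_mult[OF assms(3)])

lemma signs_even:
  assumes "v \<in> carrier V" shows "signs v \<in> even_tuples"
proof -
  have "(v 0 = 0 \<or> v 0 = 1) \<and> (v 1 = 0 \<or> v 1 = 1) \<and> (v 2 = 0 \<or> v 2 = 1)"
    using assms by (simp add: V_carrier)
  then show ?thesis
    by (auto simp: even_tuples_def tuples_def signs_permutes evenperm_signs parity_def)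
qed

lemma signs_inj:
  assumes "v \<in> carrier V" "w \<in> carrier V" "\<And>i. i < 4 \<Longrightarrow> signs v i = signs w i"
  shows "v = w"
proof (rule V_eqI[OF assms(1,2)])
  fix i :: nat assume i: "i < 3"
  then have "parity v i = 0 \<longleftrightarrow> parity w i = 0"
    using assms(3)[of i] evenperm_signs[of v i] evenperm_signs[of w i] by simp
  then show "v i = w i"
    using parity_01[OF assms(1), of i] parity_01[OF assms(2), of i] i by (auto simp: parity_def)
qed

text \<open>The same transposition is used on every level, so rotating the parities rotates the
  permutations.\<close>

lemma signs_shift:
  assumes "v \<in> carrier V" shows "\<exists>w\<in>carrier V. \<forall>i<4. signs w i = signs v ((i + j) mod 4)"
proof -
  obtain w where "w \<in> carrier V" "\<forall>i<4. parity w i = parity v ((i + j) mod 4)"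
    using parity_shift[OF assms] by blast
  then show ?thesis by (intro bexI[of _ w]) (simp_all add: signs_def)
qed

text \<open>Every coset of A_p^4 among the tuples of even total parity is represented by some
  \<open>signs v\<close>.\<close>

lemma signs_of:
  assumes "f \<in> even_tuples"
  shows "\<exists>v\<in>carrier V. \<forall>i<4. f i \<circ> signs v i \<in> carrier (alt_group (2 * r - 1))"
proof (rule bexI)
  let ?v = "\<lambda>i\<in>{..<3}. if evenperm (f i) then 0 else 1 :: int"
  show v: "?v \<in> carrier V" by (simp add: V_carrier)
  have f: "f \<in> tuples" using assms by (simp add: even_tuples_def)
  have par: "evenperm (f i) \<longleftrightarrow> parity ?v i = 0" if "i < 4" for i
    using less4_cases[OF that] assms by (auto simp: even_tuples_def parity_def)
  show "\<forall>i<4. f i \<circ> signs ?v i \<in> carrier (alt_group (2 * r - 1))"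
  proof (intro allI impI)
    fix i :: nat assume i: "i < 4"
    have "permutation (signs ?v i)" using signs_permutes permutation_permutes by blast
    then have "evenperm (f i \<circ> signs ?v i)"
      using par[OF i] tuples_permutation[OF f i] by (simp add: evenperm_comp evenperm_signs)
    moreover have "f i \<circ> signs ?v i permutes {1..2 * r - 1}"
      using f i by (intro permutes_compose signs_permutes) (simp add: tuples_def)
    ultimately show "f i \<circ> signs ?v i \<in> carrier (alt_group (2 * r - 1))"
      by (simp add: alt_group_carrier)
  qed
qed

text \<open>Two nested splittings. Signs and shifts embed a semidirect product of Z_2^3 and Z_4 into
  \<open>G\<close>. It meets A_p^4 trivially, since parity detects the signs and the normal form
  detects the shift, and together they exhaust \<open>G\<close>.\<close>

lemma iso_adjacent_even:
  assumes ev: "even r"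
  shows "\<exists>\<psi>\<in>actions V (integer_mod_group 4).
    iso_semidirect G N (semidirect_product V (integer_mod_group 4) \<psi>)"
proof -
  let ?Z = "integer_mod_group 4"
  let ?rot = "\<lambda>j :: int. act (\<lambda>_. id) (nat j)"
  have tup: "signs v \<in> tuples" for v by (simp add: tuples_def signs_permutes)
  have tup': "signs v \<in> tuples" if "v \<in> carrier V" for v by (rule tup)
  have sg: "act (signs v) 0 \<in> carrier G" if "v \<in> carrier V" for v
    using act_even_tuples[OF ev signs_even[OF that]] .
  have shom: "(\<lambda>v. act (signs v) 0) \<in> hom V G" by (rule coord_hom) (fact tup' signs_mult sg)+
  have sinj: "inj_on (\<lambda>v. act (signs v) 0) (carrier V)" by (rule coord_inj) (fact tup' signs_inj)+
  have ahom: "(\<lambda>a. act a 0) \<in> hom N G" by (rule coord_hom) (simp_all only: N_tuples N_mult N_in)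
  have ainj: "inj_on (\<lambda>a. act a 0) (carrier N)" by (rule coord_inj) (fact N_tuples N_inj)+
  have "\<exists>\<psi>\<in>actions V ?Z.
      (\<lambda>(v, j). act (signs v) 0 \<otimes>\<^bsub>G\<^esub> ?rot j) \<in> hom (semidirect_product V ?Z \<psi>) G \<and>
      inj_on (\<lambda>(v, j). act (signs v) 0 \<otimes>\<^bsub>G\<^esub> ?rot j) (carrier (semidirect_product V ?Z \<psi>))"
  proof (rule semidirect_product_hom[OF group_V group_integer_mod_group group_G shom sinj rot_hom rot_inj])
    fix j v assume jv: "j \<in> carrier ?Z" "v \<in> carrier V"
    then have "nat j < 4" by (auto simp: carrier_integer_mod_group)
    then show "\<exists>v'\<in>carrier V. ?rot j \<otimes>\<^bsub>G\<^esub> act (signs v) 0 = act (signs v') 0 \<otimes>\<^bsub>G\<^esub> ?rot j"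
      unfolding mult_G by (intro coord_swap(1)[where E = signs] tup' signs_shift jv(2))
  next
    fix v j assume vj: "v \<in> carrier V" "j \<in> carrier ?Z" "act (signs v) 0 = ?rot j"
    have "0 = nat j"
      by (rule act_inj(1)[OF vj(3)]) (use vj tup id_tuples in \<open>auto simp: carrier_integer_mod_group\<close>)
    then show "j = \<one>\<^bsub>?Z\<^esub>" using vj by (simp add: carrier_integer_mod_group)
  qed
  then obtain \<psi> where \<psi>: "\<psi> \<in> actions V ?Z"
    and hom: "(\<lambda>(v, j). act (signs v) 0 \<otimes>\<^bsub>G\<^esub> ?rot j) \<in> hom (semidirect_product V ?Z \<psi>) G"
    and inj: "inj_on (\<lambda>(v, j). act (signs v) 0 \<otimes>\<^bsub>G\<^esub> ?rot j) (carrier (semidirect_product V ?Z \<psi>))"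
    by blast
  let ?K = "semidirect_product V ?Z \<psi>"
  have "iso_semidirect G N ?K"
  proof (rule iso_semidirectI[OF _ _ group_G ahom ainj hom inj])
    show "group N" by (rule group_power_group[OF alt_group_is_group])
    show "group ?K" by (rule group_semidirect_product[OF group_V group_integer_mod_group \<psi>])
  next
    fix h a assume h: "h \<in> carrier ?K" and a: "a \<in> carrier N"
    obtain v j where vj: "h = (v, j)" "v \<in> carrier V" "j \<in> carrier ?Z"
      using h by (auto simp: semidirect_product_def)
    have j: "nat j < 4" using vj by (auto simp: carrier_integer_mod_group)
    obtain b where b: "b \<in> carrier N" "?rot j \<circ> act a 0 = act b 0 \<circ> ?rot j"
      using coord_swap(1)[where N = N and E = "\<lambda>a. a" and a = a and j = "nat j"] N_tuples N_shift a j
      by blast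
    \<comment> \<open>\<open>signs v\<close> is its own inverse on each level, and conjugation by it
      preserves parity.\<close>
    let ?c = "restrict (\<lambda>i. signs v i \<circ> b i \<circ> signs v i) {..<4}"
    have bi: "permutation (b i)" "evenperm (b i)" "b i permutes {1..2 * r - 1}" if "i < 4" for i
      using b(1) that tuples_permutation[OF N_tuples[OF b(1)] that] by (auto simp: N_carrier alt_group_carrier)
    have c: "?c \<in> carrier N"
    proof (rule N_restrict)
      fix i :: nat assume i: "i < 4"
      have "evenperm (signs v i \<circ> b i \<circ> signs v i)"
        using bi[OF i] tuples_permutation[OF tup i] by (auto simp: evenperm_comp permutation_compose)
      then show "signs v i \<circ> b i \<circ> signs v i \<in> carrier (alt_group (2 * r - 1))"
        using bi(3)[OF i] by (simp add: alt_group_carrier permutes_compose signs_permutes)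
    qed
    have c': "act (signs v) 0 \<circ> act b 0 = act ?c 0 \<circ> act (signs v) 0"
      unfolding act_comp0[OF tup] act_comp0[OF N_tuples[OF b(1)]]
      by (rule act_cong) (simp add: comp_assoc signs_signs)
    have "(act (signs v) 0 \<circ> ?rot j) \<circ> act a 0 = act (signs v) 0 \<circ> (act b 0 \<circ> ?rot j)"
      by (simp only: comp_assoc b(2))
    also have "\<dots> = act ?c 0 \<circ> (act (signs v) 0 \<circ> ?rot j)"
      by (simp only: c' flip: comp_assoc)
    finally show "\<exists>a'\<in>carrier N. (case h of (v, j) \<Rightarrow> act (signs v) 0 \<otimes>\<^bsub>G\<^esub> ?rot j) \<otimes>\<^bsub>G\<^esub> act a 0 =
        act a' 0 \<otimes>\<^bsub>G\<^esub> (case h of (v, j) \<Rightarrow> act (signs v) 0 \<otimes>\<^bsub>G\<^esub> ?rot j)"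
      using c vj(1) by (auto simp: mult_G simp del: comp_apply intro!: bexI[of _ ?c])
  next
    fix a h assume a: "a \<in> carrier N" and h: "h \<in> carrier ?K"
      and eq: "act a 0 = (case h of (v, j) \<Rightarrow> act (signs v) 0 \<otimes>\<^bsub>G\<^esub> ?rot j)"
    obtain v j where vj: "h = (v, j)" "v \<in> carrier V" "j \<in> carrier ?Z"
      using h by (auto simp: semidirect_product_def)
    have j: "nat j < 4" using vj by (auto simp: carrier_integer_mod_group)
    \<comment> \<open>Bringing this side to normal form lets \<open>act_inj\<close> separate the
      shift from the entries.\<close>
    have "act (signs v) 0 \<circ> ?rot j = act (\<lambda>i. signs v ((i + nat j) mod 4)) (nat j)"
      using j by (subst act_comp[OF id_tuples]) simp
    then have eq': "act a 0 = act (\<lambda>i. signs v ((i + nat j) mod 4)) (nat j)"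
      using eq vj(1) by (simp add: mult_G)
    have j0: "0 = nat j"
      by (rule act_inj(1)[OF eq' N_tuples[OF a] shift_tuples[OF tup]]) (use j in auto)
    have ai: "a i = signs v i" if i: "i < 4" for i
    proof -
      have "a i = signs v ((i + nat j) mod 4)"
        by (rule act_inj(2)[OF eq' N_tuples[OF a] shift_tuples[OF tup] _ j i]) simp
      then show ?thesis using i by (simp only: flip: j0) simp
    qed
    have "parity v i = 0" if "i < 4" for i
    proof -
      have "evenperm (a i)" using a that by (simp add: N_carrier alt_group_carrier)
      then show ?thesis by (simp add: ai[OF that] evenperm_signs)
    qed
    from this[of 0] this[of 1] this[of 2] have "v 0 = 0" "v 1 = 0" "v 2 = 0"
      by (simp_all add: parity_def)
    then have "v i = 0" if "i < 3" for i
      using that less4_cases[of i] by auto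
    then have "v = \<one>\<^bsub>V\<^esub>"
      by (intro V_eqI[OF vj(2) group.is_monoid[OF group_V, THEN monoid.one_closed]])
        (simp add: power_group_def)
    then show "h = \<one>\<^bsub>?K\<^esub>"
      using vj(1,3) j0 by (simp add: semidirect_product_def carrier_integer_mod_group)
  next
    fix g assume "g \<in> carrier G"
    then obtain f j where f: "f \<in> even_tuples" "j < 4" "g = act f j"
      using G_even_tuples[OF ev] by blast
    \<comment> \<open>The shift is split off on the right; each remaining entry is then corrected by
      its sign to an even permutation.\<close>
    let ?f = "\<lambda>i. f ((i + (4 - j)) mod 4)"
    have g: "g = act ?f 0 \<circ> ?rot (int j)"
      using f act_back[of f j] by (simp add: even_tuples_def)
    obtain v where v: "v \<in> carrier V" "\<forall>i<4. ?f i \<circ> signs v i \<in> carrier (alt_group (2 * r - 1))"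
      using signs_of[OF even_tuples_shift[OF f(1)]] by blast
    let ?a = "restrict (\<lambda>i. ?f i \<circ> signs v i) {..<4}"
    have a: "?a \<in> carrier N" using v(2) by (intro N_restrict) simp
    have "act ?f 0 = act ?a 0 \<circ> act (signs v) 0"
      unfolding act_comp0[OF tup] by (rule act_cong) (simp add: comp_assoc signs_signs)
    then have "g = act ?a 0 \<circ> (act (signs v) 0 \<circ> ?rot (int j))"
      using g by (simp add: comp_assoc)
    moreover have "(v, int j) \<in> carrier ?K"
      using v(1) f(2) by (simp add: semidirect_product_def carrier_integer_mod_group)
    ultimately show "\<exists>a\<in>carrier N. \<exists>h\<in>carrier ?K.
        g = act a 0 \<otimes>\<^bsub>G\<^esub> (case h of (v, j) \<Rightarrow> act (signs v) 0 \<otimes>\<^bsub>G\<^esub> ?rot j)"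
      using a by (intro bexI[of _ ?a] bexI[of _ "(v, int j)"]) (simp_all add: mult_G)
  qed
  with \<psi> show ?thesis by blast
qed

end

section \<open>Coordinates on the edges of a tree\<close>

text \<open>The cardinality of the cycle is the first return time of \<open>s\<close>.\<close>

lemma cyclic_on_enum:
  assumes "cyclic_on f S" "s \<in> S"
  shows "bij_betw (\<lambda>j. (f ^^ j) s) {..<card S} S" and "(f ^^ card S) s = s"
proof -
  have S: "S = orbit f s" and s: "s \<in> orbit f s"
    using assms by (auto simp: cyclic_on_alldef)
  let ?d = "funpow_dist1 f s s"
  have "bij_betw (\<lambda>j. (f ^^ j) s) {0..<?d} S"
    unfolding bij_betw_def using orbit_conv_funpow_dist1[OF s] inj_on_funpow_dist1[OF s] S by metis
  moreover from this have "?d = card S" by (simp add: bij_betw_same_card[symmetric])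
  ultimately show "bij_betw (\<lambda>j. (f ^^ j) s) {..<card S} S" "(f ^^ card S) s = s"
    using funpow_dist1_prop[OF s] by (metis lessThan_atLeast0)+
qed

lemma cyclic_on_ex:
  assumes "cyclic_on f S" "s \<in> S" "t \<in> S" shows "\<exists>j<card S. t = (f ^^ j) s"
  using bij_betw_imp_surj_on[OF cyclic_on_enum(1)[OF assms(1,2)]] assms(3) by (auto simp: image_iff)

text \<open>\<open>brot\<close> and \<open>wrot\<close> are the permutations of the edges behind
  \<open>black_perm\<close> and \<open>white_perm\<close>, before any labelling.\<close>

definition brot :: "('v, 'e) bicolored_map \<Rightarrow> 'e \<Rightarrow> 'e" where
  "brot T e = rot T (black_end T e) e"

definition wrot :: "('v, 'e) bicolored_map \<Rightarrow> 'e \<Rightarrow> 'e" where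
  "wrot T e = rot T (white_end T e) e"

section \<open>Edges and vertices of a plane tree\<close>

locale tree =
  fixes T :: "('v, 'e) bicolored_map"
  assumes T: "plane_tree T"
begin

lemma finite_edges: "finite (edges T)"
  and finite_blacks: "finite (blacks T)" and finite_whites: "finite (whites T)"
  and disjoint: "blacks T \<inter> whites T = {}"
  and conn: "connected_graph T"
  using T by (auto simp: plane_tree_def vertices_def)

lemma black_end_in: "e \<in> edges T \<Longrightarrow> black_end T e \<in> blacks T"
  and white_end_in: "e \<in> edges T \<Longrightarrow> white_end T e \<in> whites T"
  using T by (auto simp: plane_tree_def)

lemma incident_black: "b \<in> blacks T \<Longrightarrow> e \<in> incident T b \<longleftrightarrow> e \<in> edges T \<and> black_end T e = b"
  using disjoint white_end_in by (auto simp: incident_def)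

lemma incident_white: "c \<in> whites T \<Longrightarrow> e \<in> incident T c \<longleftrightarrow> e \<in> edges T \<and> white_end T e = c"
  using disjoint black_end_in by (auto simp: incident_def)

lemma cyclic_black: "b \<in> blacks T \<Longrightarrow> cyclic_on (brot T) (incident T b)"
  using T cyclic_cong[of "incident T b" "brot T" "rot T b"]
  by (simp add: plane_tree_def vertices_def brot_def incident_black)

lemma cyclic_white: "c \<in> whites T \<Longrightarrow> cyclic_on (wrot T) (incident T c)"
  using T cyclic_cong[of "incident T c" "wrot T" "rot T c"]
  by (simp add: plane_tree_def vertices_def wrot_def incident_white)

lemma brot_funpow:
  assumes "e \<in> edges T"
  shows "(brot T ^^ j) e \<in> edges T" "black_end T ((brot T ^^ j) e) = black_end T e"
  using cyclic_on_funpow_in[OF cyclic_black[OF black_end_in[OF assms]], of e j] assms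
  by (simp_all add: incident_black black_end_in)

lemma wrot_funpow:
  assumes "e \<in> edges T"
  shows "(wrot T ^^ j) e \<in> edges T" "white_end T ((wrot T ^^ j) e) = white_end T e"
  using cyclic_on_funpow_in[OF cyclic_white[OF white_end_in[OF assms]], of e j] assms
  by (simp_all add: incident_white white_end_in)

lemma brot_ends: "e \<in> edges T \<Longrightarrow> brot T e \<in> edges T" "e \<in> edges T \<Longrightarrow> black_end T (brot T e) = black_end T e"
  using brot_funpow[of e 1] by (simp_all add: One_nat_def)

lemma wrot_ends: "e \<in> edges T \<Longrightarrow> wrot T e \<in> edges T" "e \<in> edges T \<Longrightarrow> white_end T (wrot T e) = white_end T e"
  using wrot_funpow[of e 1] by (simp_all add: One_nat_def)

lemma same_black:
  assumes "e \<in> edges T" "f \<in> edges T" "black_end T f = black_end T e"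
  shows "\<exists>j<vdegree T (black_end T e). f = (brot T ^^ j) e"
  unfolding vdegree_def
  by (rule cyclic_on_ex[OF cyclic_black]) (use assms in \<open>auto simp: incident_black black_end_in\<close>)

lemma same_white:
  assumes "e \<in> edges T" "f \<in> edges T" "white_end T f = white_end T e"
  shows "\<exists>j<vdegree T (white_end T e). f = (wrot T ^^ j) e"
  unfolding vdegree_def
  by (rule cyclic_on_ex[OF cyclic_white]) (use assms in \<open>auto simp: incident_white white_end_in\<close>)

lemma brot_degree: "e \<in> edges T \<Longrightarrow> (brot T ^^ vdegree T (black_end T e)) e = e"
  unfolding vdegree_def
  by (rule cyclic_on_enum(2)[OF cyclic_black]) (auto simp: incident_black black_end_in)

lemma wrot_degree: "e \<in> edges T \<Longrightarrow> (wrot T ^^ vdegree T (white_end T e)) e = e"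
  unfolding vdegree_def
  by (rule cyclic_on_enum(2)[OF cyclic_white]) (auto simp: incident_white white_end_in)

lemma degree_one_iff:
  assumes "e \<in> edges T" shows "vdegree T (black_end T e) = 1 \<longleftrightarrow> brot T e = e"
  using assms eq_on_cyclic_on_iff1[OF cyclic_black[OF black_end_in[OF assms]], of e]
  by (auto simp: vdegree_def incident_black black_end_in)

lemma black_nonempty: "b \<in> blacks T \<Longrightarrow> \<exists>e\<in>edges T. black_end T e = b"
  using cyclic_black[of b] incident_black[of b] by (auto simp: cyclic_on_alldef)

lemma white_nonempty: "c \<in> whites T \<Longrightarrow> \<exists>e\<in>edges T. white_end T e = c"
  using cyclic_white[of c] incident_white[of c] by (auto simp: cyclic_on_alldef)

lemma adjacent_white_black:
  assumes "c \<in> whites T" "b \<in> blacks T"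
  shows "adjacent T c b \<longleftrightarrow> (\<exists>e\<in>edges T. white_end T e = c \<and> black_end T e = b)"
  unfolding adjacent_def using assms black_end_in white_end_in disjoint
  by (auto simp: doubleton_eq_iff)

text \<open>Two parallel edges would form a cycle of length 2. Consequently a black vertex has as
  many white neighbours as edges.\<close>

lemma no_parallel:
  assumes e: "e \<in> edges T" "f \<in> edges T" "black_end T e = black_end T f" "white_end T e = white_end T f"
  shows "e = f"
proof (rule ccontr)
  assume "e \<noteq> f"
  have "black_end T e \<noteq> white_end T e"
    using black_end_in[OF e(1)] white_end_in[OF e(1)] disjoint by auto
  then have "graph_cycle T [black_end T e, white_end T e] [e, f]"
    using e \<open>e \<noteq> f\<close> by (auto simp: graph_cycle_def less_Suc_eq)
  then show False using T by (auto simp: plane_tree_def)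
qed

text \<open>A white vertex all of whose neighbours are leaves would form a connected component with them.\<close>

lemma white_big_neighbour:
  assumes c: "c \<in> whites T" and b: "b \<in> blacks T" "vdegree T b \<noteq> 1"
  shows "\<exists>e\<in>edges T. white_end T e = c \<and> vdegree T (black_end T e) \<noteq> 1"
proof (rule ccontr)
  assume "\<not> ?thesis"
  then have leaf: "vdegree T (black_end T e) = 1" if "e \<in> edges T" "white_end T e = c" for e
    using that by blast
  have "(adjacent T)\<^sup>*\<^sup>* c b"
    using conn c b by (simp add: connected_graph_def vertices_def)
  then have "b = c \<or> (\<exists>e\<in>edges T. white_end T e = c \<and> black_end T e = b)"
  proof (induction rule: rtranclp_induct)
    case (step u v)
    from step.hyps(2) obtain f where f: "f \<in> edges T" "{black_end T f, white_end T f} = {u, v}"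
      by (auto simp: adjacent_def)
    from step.IH show ?case
    proof
      assume "u = c"
      then show ?thesis
        using f c disjoint black_end_in[OF f(1)] by (auto simp: doubleton_eq_iff)
    next
      assume "\<exists>e\<in>edges T. white_end T e = c \<and> black_end T e = u"
      then obtain e where e: "e \<in> edges T" "white_end T e = c" "black_end T e = u" by blast
      have "black_end T f = u"
        using f disjoint white_end_in[OF f(1)] black_end_in[OF e(1)] e(3) by (auto simp: doubleton_eq_iff)
      \<comment> \<open>A leaf has a single edge, so a path that reaches it can only return to
        \<open>c\<close>.\<close>
      then have "f = e" using same_black[OF e(1) f(1)] leaf[OF e(1,2)] e(3) by auto
      then have "v = c" using f(2) e by (auto simp: doubleton_eq_iff)
      then show ?thesis by simp
    qed
  qed simp
  then show False using c b disjoint leaf by auto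
qed

end

text \<open>\<open>h w i\<close> is the \<open>i\<close>-th edge around the white vertex number \<open>w\<close>, the center having number \<open>1\<close>.
  The two black vertices of degree \<open>r\<close> are incident to edges of level \<open>0\<close> and \<open>k\<close> only.\<close>

definition coords :: "('v, 'e) bicolored_map \<Rightarrow> nat \<Rightarrow> nat \<Rightarrow> (nat \<Rightarrow> nat \<Rightarrow> 'e) \<Rightarrow> bool" where
  "coords T r k h \<longleftrightarrow> bij_betw (\<lambda>(w, i). h w i) ({1..2 * r - 1} \<times> {..<4}) (edges T) \<and>
     (\<forall>w\<in>{1..2 * r - 1}. \<forall>i<4. wrot T (h w i) = h w ((i + 1) mod 4) \<and>
        brot T (h w i) = h (lev r k i w) i)"

lemma funpow_eq_if_mod_eq:
  assumes "(f ^^ n) x = x" "a mod n = b mod n" shows "(f ^^ a) x = (f ^^ b) x"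
  using funpow_mod_eq[OF assms(1), of a] funpow_mod_eq[OF assms(1), of b] assms(2) by metis

context tree
begin

text \<open>Powers of \<open>brot T\<close> at \<open>e0\<close> and \<open>e1\<close> number the
  white vertices around the two big black vertices, which share number 1; powers of
  \<open>wrot T\<close> give the levels. The enumeration is onto by \<open>cover\<close>, hence
  injective by the count of edges. Edges away from the two big vertices end in leaves, where
  \<open>brot T\<close> is trivial.\<close>

lemma coords_of_center:
  assumes r: "2 \<le> r" and AB: "black_end T e0 \<noteq> black_end T e1"
    and deg: "vdegree T (black_end T e0) = r" "vdegree T (black_end T e1) = r"
    and leaf: "\<And>b. b \<in> blacks T \<Longrightarrow> b \<noteq> black_end T e0 \<Longrightarrow> b \<noteq> black_end T e1 \<Longrightarrow> vdegree T b = 1"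
    and white: "\<And>c. c \<in> whites T \<Longrightarrow> vdegree T c = 4"
    and card: "card (edges T) = 4 * (2 * r - 1)"
    and e: "e0 \<in> edges T" "e1 \<in> edges T" "e1 = (wrot T ^^ k) e0" and k: "k = 1 \<or> k = 2"
    and cover: "\<And>c. c \<in> whites T \<Longrightarrow> \<exists>e\<in>edges T. white_end T e = c \<and>
      (black_end T e = black_end T e0 \<or> black_end T e = black_end T e1)"
  shows "\<exists>h. coords T r k h"
proof -
  \<comment> \<open>\<open>e1\<close> must have level \<open>k\<close>, so levels at the vertices
    from \<open>r + 1\<close> on are counted with offset \<open>4 - k\<close>: for
    \<open>i = k\<close> the exponent is 4, a full turn.\<close>
  define h where "h w i = (if w \<le> r then (wrot T ^^ i) ((brot T ^^ (w - 1)) e0)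
     else (wrot T ^^ (i + (4 - k))) ((brot T ^^ (w - r)) e1))" for w i
  have wmod: "(wrot T ^^ a) f = (wrot T ^^ b) f" if "f \<in> edges T" "a mod 4 = b mod 4" for a b f
    using funpow_eq_if_mod_eq[of 4 "wrot T" f a b] wrot_degree[OF that(1)] white[OF white_end_in[OF that(1)]] that(2)
    by simp
  have brote: "(brot T ^^ j) e0 \<in> edges T" "(brot T ^^ j) e1 \<in> edges T" for j
    using brot_funpow e by blast+
  have hA: "h (Suc j) i = (wrot T ^^ i) ((brot T ^^ j) e0)" if "j < r" for i j
    using that by (simp add: h_def)
  have hB: "h (r + j) i = (wrot T ^^ (i + (4 - k))) ((brot T ^^ j) e1)" if "0 < j" for i j
    using that by (simp add: h_def)
  have hB0: "(wrot T ^^ i) e1 = h 1 ((i + k) mod 4)" for i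
  proof -
    have "(wrot T ^^ i) e1 = (wrot T ^^ (i + k)) e0" by (simp add: e(3) funpow_add)
    also have "\<dots> = (wrot T ^^ ((i + k) mod 4)) e0" by (rule wmod[OF e(1)]) simp
    finally show ?thesis using hA[of 0] r by (simp add: One_nat_def)
  qed
  have hBj: "(wrot T ^^ i) ((brot T ^^ j) e1) = h (r + j) ((i + k) mod 4)" if "0 < j" for i j
  proof -
    have "((i + k) mod 4 + (4 - k)) mod 4 = (i + k + (4 - k)) mod 4" by (simp add: mod_simps)
    also have "i + k + (4 - k) = i + 4" using k by auto
    finally show ?thesis unfolding hB[OF that] by (intro wmod[OF brote(2)]) simp
  qed
  let ?D = "{1..2 * r - 1} \<times> {..<4 :: nat}"
  have sub: "h w i \<in> edges T" if "w \<in> {1..2 * r - 1}" for w i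
    using brote wrot_funpow(1) by (simp add: h_def)
  have "edges T \<subseteq> (\<lambda>(w, i). h w i) ` ?D"
  proof
    fix f assume f: "f \<in> edges T"
    obtain e where e': "e \<in> edges T" "white_end T e = white_end T f"
        "black_end T e = black_end T e0 \<or> black_end T e = black_end T e1"
      using cover[OF white_end_in[OF f]] by blast
    obtain i where i: "i < 4" "f = (wrot T ^^ i) e"
      using same_white[OF e'(1) f] e'(2) white[OF white_end_in[OF f]] by auto
    from e'(3) show "f \<in> (\<lambda>(w, i). h w i) ` ?D"
    proof
      assume "black_end T e = black_end T e0"
      then obtain j where "j < r" "e = (brot T ^^ j) e0" using same_black[OF e(1) e'(1)] deg by auto
      then show ?thesis using i hA[of j i] by (intro image_eqI[of _ _ "(Suc j, i)"]) auto
    next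
      assume "black_end T e = black_end T e1"
      then obtain j where j: "j < r" "e = (brot T ^^ j) e1" using same_black[OF e(2) e'(1)] deg by auto
      show ?thesis
      proof (cases "j = 0")
        case True
        then show ?thesis using i j hB0[of i] r by (intro image_eqI[of _ _ "(1, (i + k) mod 4)"]) auto
      next
        case False
        then show ?thesis using i j hBj[of j i] r by (intro image_eqI[of _ _ "(r + j, (i + k) mod 4)"]) auto
      qed
    qed
  qed
  then have img: "(\<lambda>(w, i). h w i) ` ?D = edges T" using sub by auto
  \<comment> \<open>A surjection between finite sets of equal size is injective.\<close>
  then have inj: "inj_on (\<lambda>(w, i). h w i) ?D"
    by (intro eq_card_imp_inj_on) (simp_all add: card card_cartesian_product)
  have hinj: "w = v \<and> i = j" if "h w i = h v j" "w \<in> {1..2 * r - 1}" "v \<in> {1..2 * r - 1}" "i < 4" "j < 4" for w v i j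
    using inj_onD[OF inj, of "(w, i)" "(v, j)"] that by auto
  have W: "wrot T (h w i) = h w ((i + 1) mod 4)" for w i
  proof (cases "w \<le> r")
    case True
    have "(wrot T ^^ Suc i) ((brot T ^^ (w - 1)) e0) = (wrot T ^^ ((i + 1) mod 4)) ((brot T ^^ (w - 1)) e0)"
      by (rule wmod[OF brote(1)]) (simp add: One_nat_def)
    then show ?thesis using True by (simp add: h_def)
  next
    case False
    have "(wrot T ^^ Suc (i + (4 - k))) ((brot T ^^ (w - r)) e1) =
        (wrot T ^^ ((i + 1) mod 4 + (4 - k))) ((brot T ^^ (w - r)) e1)"
      by (rule wmod[OF brote(2)]) (simp add: mod_simps One_nat_def)
    then show ?thesis using False by (simp add: h_def)
  qed
  have r0: "(brot T ^^ r) e0 = e0" and r1: "(brot T ^^ r) e1 = e1"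
    using brot_degree[OF e(1)] brot_degree[OF e(2)] deg by simp_all
  have h1k: "h 1 k = e1" using hB0[of 0] k by auto
  have hBk: "h (r + j) k = (brot T ^^ j) e1" if "0 < j" for j
    using hBj[OF that, of 0] k by auto
  have B: "brot T (h w i) = h (lev r k i w) i" if w: "w \<in> {1..2 * r - 1}" and i: "i < 4" for w i
  proof -
    consider (A) "i = 0" "w \<le> r" | (B) "i = k" "w = 1 \<or> r < w"
      | (leaf) "\<not> (i = 0 \<and> w \<le> r)" "\<not> (i = k \<and> (w = 1 \<or> r < w))" by blast
    then show ?thesis
    proof cases
      case A
      then obtain j where j: "w = Suc j" "j < r" using w by (cases w) auto
      show ?thesis
      proof (cases "Suc j < r")
        case True
        then show ?thesis using hA[of j 0] hA[of "Suc j" 0] j A by (simp add: lev_def acyc_def)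
      next
        case False
        then have "w = r" "Suc j = r" using j by simp_all
        then show ?thesis using hA[of j 0] hA[of 0 0] A r r0 j by (auto simp: lev_def acyc_def One_nat_def)
      qed
    next
      case B
      then obtain j where j: "w = (if j = 0 then 1 else r + j)" "j < r"
        using w that r by (cases "w = 1") (auto intro: that[of 0] that[of "w - r"])
      have hw: "h w i = (brot T ^^ j) e1" using j h1k hBk[of j] B by simp
      have lw: "lev r k i w = (if Suc j = r then 1 else r + Suc j)"
        using k B j r by (auto simp: lev_def bcyc_def)
      show ?thesis
        using hBk[of "Suc j"] h1k r1 B unfolding hw lw by (cases "Suc j = r") auto
    next
      case leaf
      have "lev r k i w = w" using leaf w k by (auto simp: lev_def acyc_def bcyc_def)
      \<comment> \<open>An edge at a big vertex is one of those enumerated on level \<open>0\<close>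
        or \<open>k\<close>; injectivity of the coordinates excludes this here.\<close>
      moreover have "vdegree T (black_end T (h w i)) = 1"
      proof (rule assms(5))
        show "black_end T (h w i) \<in> blacks T" using black_end_in sub[OF w] by blast
        show "black_end T (h w i) \<noteq> black_end T e0"
        proof
          assume "black_end T (h w i) = black_end T e0"
          then obtain j where "j < r" "h w i = (brot T ^^ j) e0"
            using same_black[OF e(1) sub[OF w]] deg by auto
          then have "h w i = h (Suc j) 0" "Suc j \<in> {1..2 * r - 1}" "j < r" using hA[of j 0] by auto
          then show False using hinj[of w i "Suc j" 0] w i leaf(1) by auto
        qed
        show "black_end T (h w i) \<noteq> black_end T e1"
        proof
          assume "black_end T (h w i) = black_end T e1"
          then obtain j where j: "j < r" "h w i = (brot T ^^ j) e1"
            using same_black[OF e(2) sub[OF w]] deg by auto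
          then have "h w i = h (if j = 0 then 1 else r + j) k" using h1k hBk[of j] by simp
          moreover have "r + j \<le> 2 * r - 1" using j(1) by linarith
          ultimately show False
            using hinj[of w i "if j = 0 then 1 else r + j" k] w i leaf(2) j(1) r k by (auto split: if_splits)
        qed
      qed
      ultimately show ?thesis using degree_one_iff[OF sub[OF w]] by simp
    qed
  qed
  show ?thesis
    unfolding coords_def using img inj W B by (intro exI[of _ h]) (simp add: bij_betw_def)
qed

end

lemma count_image_mset_set:
  assumes "finite S" shows "count (image_mset f (mset_set S)) x = card {s \<in> S. f s = x}"
proof -
  have "f -` {x} \<inter> S = {s \<in> S. f s = x}" by auto
  then show ?thesis using assms by (simp add: count_image_mset)
qed

context tree
begin

lemma coords_of_passport:
  assumes r: "2 \<le> r" and p: "p = 2 * r - 1" and n: "n = 4 * p"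
    and pass: "has_passport T (replicate_mset 2 r + replicate_mset s 1) (replicate_mset p 4) n"
  shows "\<exists>k h. (k = 1 \<or> k = 2) \<and> coords T r k h"
proof -
  have b: "image_mset (vdegree T) (mset_set (blacks T)) = replicate_mset 2 r + replicate_mset s 1"
    and w: "image_mset (vdegree T) (mset_set (whites T)) = replicate_mset p 4"
    and card: "card (edges T) = 4 * (2 * r - 1)"
    using pass p n by (simp_all add: has_passport_def)
  have deg: "vdegree T v = r \<or> vdegree T v = 1" if "v \<in> blacks T" for v
  proof -
    have "vdegree T v \<in># replicate_mset 2 r + replicate_mset s 1"
      unfolding b[symmetric] using that finite_blacks by simp
    then show ?thesis by (auto split: if_splits)
  qed
  have white: "vdegree T v = 4" if "v \<in> whites T" for v
  proof -
    have "vdegree T v \<in># replicate_mset p 4"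
      unfolding w[symmetric] using that finite_whites by simp
    then show ?thesis by (auto split: if_splits)
  qed
  have "card {v \<in> blacks T. vdegree T v = r} = 2"
    using count_image_mset_set[OF finite_blacks, of "vdegree T" r] r by (simp add: b)
  then obtain A B where AB: "{v \<in> blacks T. vdegree T v = r} = {A, B}" "A \<noteq> B"
    by (auto simp: card_2_iff)
  then have A: "A \<in> blacks T" "vdegree T A = r" and B: "B \<in> blacks T" "vdegree T B = r" by auto
  have leaf: "vdegree T v = 1" if "v \<in> blacks T" "v \<noteq> A" "v \<noteq> B" for v
    using deg[OF that(1)] AB that by auto
  have cw: "card (whites T) = 2 * r - 1"
    using arg_cong[OF w, of size] p by simp
  define N where "N v = white_end T ` incident T v" for v
  have cN: "card (N v) = r" if "v \<in> blacks T" "vdegree T v = r" for v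
  proof -
    have "inj_on (white_end T) (incident T v)"
      using no_parallel by (auto simp: inj_on_def incident_black[OF that(1)])
    then show ?thesis using that(2) by (simp add: N_def card_image vdegree_def)
  qed
  have Nmem: "c \<in> N v \<longleftrightarrow> (\<exists>e\<in>edges T. white_end T e = c \<and> black_end T e = v)" if "v \<in> blacks T" for c v
    using that by (auto simp: N_def incident_black)
  have cover: "\<exists>e\<in>edges T. white_end T e = c \<and> (black_end T e = A \<or> black_end T e = B)"
    if c: "c \<in> whites T" for c
  proof -
    obtain e where e: "e \<in> edges T" "white_end T e = c" "vdegree T (black_end T e) \<noteq> 1"
      using white_big_neighbour[OF c A(1)] A(2) r by auto
    then show ?thesis using leaf[OF black_end_in[OF e(1)]] by blast
  qed
  have NN: "N A \<union> N B = whites T"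
  proof (intro equalityI subsetI)
    fix x assume "x \<in> N A \<union> N B"
    then obtain e where "e \<in> edges T" "white_end T e = x"
      using Nmem[OF A(1), of x] Nmem[OF B(1), of x] by blast
    then show "x \<in> whites T" using white_end_in by blast
  next
    fix x assume "x \<in> whites T"
    from cover[OF this] show "x \<in> N A \<union> N B"
      using Nmem[OF A(1), of x] Nmem[OF B(1), of x] by blast
  qed
  then have fin: "finite (N A)" "finite (N B)" using finite_whites by (metis finite_Un)+
  \<comment> \<open>Inclusion-exclusion: the sizes \<open>r\<close> and \<open>r\<close> add up to
    one more than the \<open>2 * r - 1\<close> white vertices.\<close>
  have "card (N A \<inter> N B) = 1"
    using card_Un_Int[OF fin] cN[OF A] cN[OF B] NN cw r by simp
  then obtain c where c: "c \<in> N A" "c \<in> N B" by (metis IntE card_1_singletonE insertI1)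
  obtain e0 where e0: "e0 \<in> edges T" "white_end T e0 = c" "black_end T e0 = A"
    using c(1) Nmem[OF A(1)] by blast
  obtain e1 where e1: "e1 \<in> edges T" "white_end T e1 = c" "black_end T e1 = B"
    using c(2) Nmem[OF B(1)] by blast
  have d4: "vdegree T c = 4" using white white_end_in[OF e0(1)] e0(2) by blast
  obtain k where k: "k < 4" "e1 = (wrot T ^^ k) e0"
    using same_white[OF e0(1) e1(1)] e0 e1 d4 by auto
  have "k \<noteq> 0" using k e0 e1 AB(2) by (cases k) auto
  then consider "k = 1 \<or> k = 2" | "k = 3" using k(1) by linarith
  then show ?thesis
  proof cases
    case 1
    have "\<exists>h. coords T r k h"
      by (rule coords_of_center[of r e0 e1 k]) (use r AB A B leaf white card e0 e1 k(2) 1 cover in auto)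
    then show ?thesis using 1 by blast
  next
    case 2
    \<comment> \<open>Seen from \<open>B\<close>, the edge at \<open>A\<close> comes one step later,
      so exchanging the two vertices turns \<open>k = 3\<close> into \<open>k = 1\<close>.\<close>
    have "(wrot T ^^ 1) e1 = (wrot T ^^ 4) e0"
      using k(2) 2 funpow_add[of 1 3 "wrot T"] by simp
    then have e01: "e0 = (wrot T ^^ 1) e1" using wrot_degree[OF e0(1)] e0(2) d4 by simp
    have cover': "\<exists>e\<in>edges T. white_end T e = c \<and> (black_end T e = B \<or> black_end T e = A)"
      if "c \<in> whites T" for c
      using cover[OF that] by blast
    have "\<exists>h. coords T r 1 h"
      by (rule coords_of_center[of r e1 e0 1, OF _ _ _ _ _ _ _ _ _ e01])
        (simp_all add: r e0 e1 A B AB(2)[symmetric] leaf white card cover')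
    then show ?thesis by blast
  qed
qed

end

section \<open>Isomorphisms as bijections of the edges\<close>

context tree
begin

lemma blacks_image: "blacks T = black_end T ` edges T"
proof (intro equalityI subsetI)
  fix v assume "v \<in> blacks T"
  then obtain e where "e \<in> edges T" "black_end T e = v" using black_nonempty by blast
  then show "v \<in> black_end T ` edges T" by blast
qed (use black_end_in in blast)

lemma whites_image: "whites T = white_end T ` edges T"
proof (intro equalityI subsetI)
  fix v assume "v \<in> whites T"
  then obtain e where "e \<in> edges T" "white_end T e = v" using white_nonempty by blast
  then show "v \<in> white_end T ` edges T" by blast
qed (use white_end_in in blast)

end

text \<open>Vertices correspond to the cycles of \<open>brot\<close> and \<open>wrot\<close>, so a
  bijection of the edges that commutes with both induces one of the vertices.\<close>

lemma map_isoI: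
  assumes T: "plane_tree T" and T': "plane_tree T'" and g: "bij_betw g (edges T) (edges T')"
    and b: "\<And>e. e \<in> edges T \<Longrightarrow> g (brot T e) = brot T' (g e)"
    and w: "\<And>e. e \<in> edges T \<Longrightarrow> g (wrot T e) = wrot T' (g e)"
  shows "map_iso T T'"
proof -
  interpret T: tree T by unfold_locales (rule T)
  interpret T': tree T' by unfold_locales (rule T')
  have ge: "g e \<in> edges T'" if "e \<in> edges T" for e using g that by (auto dest: bij_betwE)
  have inj: "g e = g f \<longleftrightarrow> e = f" if "e \<in> edges T" "f \<in> edges T" for e f
    using inj_on_eq_iff[OF bij_betw_imp_inj_on[OF g]] that by blast
  have gb: "g ((brot T ^^ j) e) = (brot T' ^^ j) (g e)" if "e \<in> edges T" for e j
    by (induction j) (simp_all add: b T.brot_funpow(1)[OF that])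
  have gw: "g ((wrot T ^^ j) e) = (wrot T' ^^ j) (g e)" if "e \<in> edges T" for e j
    by (induction j) (simp_all add: w T.wrot_funpow(1)[OF that])
  have sb: "black_end T' (g e) = black_end T' (g f) \<longleftrightarrow> black_end T e = black_end T f"
    if e: "e \<in> edges T" "f \<in> edges T" for e f
  proof
    assume "black_end T e = black_end T f"
    then obtain j where "f = (brot T ^^ j) e" using T.same_black[OF e] by auto
    then show "black_end T' (g e) = black_end T' (g f)"
      using T'.brot_funpow(2)[OF ge[OF e(1)]] by (simp add: gb[OF e(1)])
  next
    assume "black_end T' (g e) = black_end T' (g f)"
    then obtain j where "g f = (brot T' ^^ j) (g e)" using T'.same_black[OF ge[OF e(1)] ge[OF e(2)]] by auto
    then have "g f = g ((brot T ^^ j) e)" by (simp only: gb[OF e(1)])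
    then have "f = (brot T ^^ j) e"
      using inj[OF e(2) T.brot_funpow(1)[OF e(1)]] by blast
    then show "black_end T e = black_end T f" using T.brot_funpow(2)[OF e(1)] by simp
  qed
  have sw: "white_end T' (g e) = white_end T' (g f) \<longleftrightarrow> white_end T e = white_end T f"
    if e: "e \<in> edges T" "f \<in> edges T" for e f
  proof
    assume "white_end T e = white_end T f"
    then obtain j where "f = (wrot T ^^ j) e" using T.same_white[OF e] by auto
    then show "white_end T' (g e) = white_end T' (g f)"
      using T'.wrot_funpow(2)[OF ge[OF e(1)]] by (simp add: gw[OF e(1)])
  next
    assume "white_end T' (g e) = white_end T' (g f)"
    then obtain j where "g f = (wrot T' ^^ j) (g e)" using T'.same_white[OF ge[OF e(1)] ge[OF e(2)]] by auto
    then have "g f = g ((wrot T ^^ j) e)" by (simp only: gw[OF e(1)])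
    then have "f = (wrot T ^^ j) e"
      using inj[OF e(2) T.wrot_funpow(1)[OF e(1)]] by blast
    then show "white_end T e = white_end T f" using T.wrot_funpow(2)[OF e(1)] by simp
  qed
  \<comment> \<open>A vertex goes to the corresponding end of the image of some edge at it;
    \<open>sb\<close> and \<open>sw\<close> show independence of the chosen edge.\<close>
  define f where "f v = (if v \<in> blacks T then black_end T' (g (SOME e. e \<in> edges T \<and> black_end T e = v))
     else white_end T' (g (SOME e. e \<in> edges T \<and> white_end T e = v)))" for v
  have fb: "f (black_end T e) = black_end T' (g e)" if e: "e \<in> edges T" for e
  proof -
    let ?d = "SOME d. d \<in> edges T \<and> black_end T d = black_end T e"
    have "?d \<in> edges T \<and> black_end T ?d = black_end T e" by (rule someI[of _ e]) (simp add: e)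
    then show ?thesis using sb[of ?d e] e T.black_end_in[OF e] by (simp add: f_def)
  qed
  have fw: "f (white_end T e) = white_end T' (g e)" if e: "e \<in> edges T" for e
  proof -
    let ?d = "SOME d. d \<in> edges T \<and> white_end T d = white_end T e"
    have "?d \<in> edges T \<and> white_end T ?d = white_end T e" by (rule someI[of _ e]) (simp add: e)
    moreover have "white_end T e \<notin> blacks T" using T.white_end_in[OF e] T.disjoint by blast
    ultimately show ?thesis using sw[of ?d e] e by (simp add: f_def)
  qed
  have bl: "blacks T = black_end T ` edges T" "whites T = white_end T ` edges T"
    by (rule T.blacks_image T.whites_image)+
  have bl': "blacks T' = black_end T' ` g ` edges T" "whites T' = white_end T' ` g ` edges T"
    unfolding bij_betw_imp_surj_on[OF g] by (rule T'.blacks_image T'.whites_image)+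
  have 1: "bij_betw f (blacks T) (blacks T')"
    unfolding bij_betw_def inj_on_def bl bl' by (auto simp: fb sb image_image)
  have 2: "bij_betw f (whites T) (whites T')"
    unfolding bij_betw_def inj_on_def bl bl' by (auto simp: fw sw image_image)
  have 3: "bij_betw f (vertices T) (vertices T')"
    unfolding vertices_def by (rule bij_betw_combine[OF 1 2 T'.disjoint])
  have 4: "rot T' (f v) (g e) = g (rot T v e)" if "v \<in> vertices T" "e \<in> incident T v" for v e
  proof (cases "v \<in> blacks T")
    case True
    then have "e \<in> edges T" "v = black_end T e" using T.incident_black that by auto
    then show ?thesis using b[of e] fb[of e] by (simp add: brot_def)
  next
    case False
    then have "e \<in> edges T" "v = white_end T e" using T.incident_white that by (auto simp: vertices_def)
    then show ?thesis using w[of e] fw[of e] by (simp add: wrot_def)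
  qed
  show ?thesis
    unfolding map_iso_def
    using 1 2 3 4 g fb fw by (intro exI[of _ f] exI[of _ g]) (auto simp: bij_betw_def)
qed

lemma map_isoE:
  assumes "plane_tree T" "map_iso T T'"
  obtains g where "bij_betw g (edges T) (edges T')"
    "\<forall>e\<in>edges T. g (brot T e) = brot T' (g e)"
    "\<forall>e\<in>edges T. g (wrot T e) = wrot T' (g e)"
proof -
  interpret tree T by unfold_locales (rule assms(1))
  obtain f g where g: "bij_betw g (edges T) (edges T')"
    and ends: "\<forall>e\<in>edges T. black_end T' (g e) = f (black_end T e) \<and> white_end T' (g e) = f (white_end T e)"
    and rot: "\<forall>v\<in>vertices T. \<forall>e\<in>incident T v. rot T' (f v) (g e) = g (rot T v e)"
    using assms(2) unfolding map_iso_def by blast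
  show ?thesis
  proof (rule that[OF g]; intro ballI)
    fix e assume e: "e \<in> edges T"
    show "g (brot T e) = brot T' (g e)"
      using rot[rule_format, of "black_end T e" e] ends e black_end_in[OF e]
      by (simp add: brot_def vertices_def incident_black)
    show "g (wrot T e) = wrot T' (g e)"
      using rot[rule_format, of "white_end T e" e] ends e white_end_in[OF e]
      by (simp add: wrot_def vertices_def incident_white)
  qed
qed

section \<open>Center, leaves and monodromy in coordinates\<close>

locale coord_tree = tree +
  fixes r k :: nat and h
  assumes r: "2 \<le> r" and k: "k = 1 \<or> k = 2" and coords: "coords T r k h"
begin

lemma h_bij: "bij_betw (\<lambda>(w, i). h w i) ({1..2 * r - 1} \<times> {..<4}) (edges T)"
  using coords by (simp add: coords_def)

lemma h_in: "w \<in> {1..2 * r - 1} \<Longrightarrow> i < 4 \<Longrightarrow> h w i \<in> edges T"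
  using h_bij by (auto dest!: bij_betwE)

lemma h_inj: "h w i = h v j \<longleftrightarrow> w = v \<and> i = j"
  if "w \<in> {1..2 * r - 1}" "v \<in> {1..2 * r - 1}" "i < 4" "j < 4"
  using inj_onD[OF bij_betw_imp_inj_on[OF h_bij], of "(w, i)" "(v, j)"] that by auto

lemma h_cases:
  assumes "e \<in> edges T" obtains w i where "e = h w i" "w \<in> {1..2 * r - 1}" "i < 4"
proof -
  have "e \<in> (\<lambda>(w, i). h w i) ` ({1..2 * r - 1} \<times> {..<4})"
    using assms by (simp only: bij_betw_imp_surj_on[OF h_bij])
  then obtain z where "e = (\<lambda>(w, i). h w i) z" "z \<in> {1..2 * r - 1} \<times> {..<4}" by (rule imageE)
  then show ?thesis using that by (cases z) (simp del: atLeastAtMost_iff)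
qed

lemma wrot_h: "w \<in> {1..2 * r - 1} \<Longrightarrow> i < 4 \<Longrightarrow> wrot T (h w i) = h w ((i + 1) mod 4)"
  using coords by (simp add: coords_def)

lemma brot_h: "w \<in> {1..2 * r - 1} \<Longrightarrow> i < 4 \<Longrightarrow> brot T (h w i) = h (lev r k i w) i"
  using coords by (simp add: coords_def)

lemma lev_in: "w \<in> {1..2 * r - 1} \<Longrightarrow> lev r k i w \<in> {1..2 * r - 1}"
  using permutes_in_image[OF lev_permutes[OF r]] by blast

lemma brot_fixed: "w \<in> {1..2 * r - 1} \<Longrightarrow> i < 4 \<Longrightarrow> brot T (h w i) = h w i \<longleftrightarrow> lev r k i w = w"
  using h_inj[OF lev_in, of w w i i] by (simp add: brot_h)

text \<open>Together with \<open>brot_fixed\<close> this locates the edges that end in black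
  leaves.\<close>

lemma lev_fixed:
  assumes "w \<in> {1..2 * r - 1}"
  shows "lev r k i w = w \<longleftrightarrow> \<not> (i = 0 \<and> w \<le> r) \<and> \<not> (i = k \<and> (w = 1 \<or> r < w))"
  using assms k r by (auto simp: lev_def acyc_def bcyc_def)

lemma wrot_funpow_h: "w \<in> {1..2 * r - 1} \<Longrightarrow> i < 4 \<Longrightarrow> (wrot T ^^ j) (h w i) = h w ((i + j) mod 4)"
  by (induction j) (simp_all add: wrot_h mod_simps One_nat_def del: atLeastAtMost_iff)

lemma white_h:
  assumes "w \<in> {1..2 * r - 1}" "v \<in> {1..2 * r - 1}" "i < 4" "j < 4"
  shows "white_end T (h w i) = white_end T (h v j) \<longleftrightarrow> w = v"
proof
  assume "white_end T (h w i) = white_end T (h v j)"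
  then obtain m where "h v j = (wrot T ^^ m) (h w i)"
    using same_white[of "h w i" "h v j"] h_in assms by auto
  then have "h v j = h w ((i + m) mod 4)" using wrot_funpow_h assms by simp
  then show "w = v" using h_inj assms by simp
next
  assume "w = v"
  have "h w j = (wrot T ^^ (j + (4 - i))) (h w i)"
    using wrot_funpow_h assms by simp
  then show "white_end T (h w i) = white_end T (h v j)"
    using wrot_funpow(2)[OF h_in[OF assms(1,3)], of "j + (4 - i)"] \<open>w = v\<close> by simp
qed

definition c where "c = white_end T (h 1 0)"

lemma one_in: "1 \<in> {1..2 * r - 1}"
  using r by simp

lemma white_cases:
  assumes "v \<in> whites T" obtains w where "w \<in> {1..2 * r - 1}" "v = white_end T (h w 0)"
proof -
  obtain e where e: "e \<in> edges T" "white_end T e = v" using white_nonempty[OF assms] by blast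
  obtain w i where wi: "e = h w i" "w \<in> {1..2 * r - 1}" "i < 4" using e(1) by (rule h_cases)
  then have "v = white_end T (h w 0)" using e(2) white_h[of w w i 0] by auto
  then show ?thesis using that wi(2) by blast
qed

text \<open>A level on which \<open>lev\<close> fixes \<open>w\<close> is an edge ending in a leaf;
  different levels give different leaves because there are no parallel edges.\<close>

lemma leaf_neighbours:
  assumes w: "w \<in> {1..2 * r - 1}"
  shows "card {b \<in> blacks T. vdegree T b = 1 \<and> adjacent T (white_end T (h w 0)) b} =
    card {i \<in> {..<4}. lev r k i w = w}"
proof -
  let ?I = "{i \<in> {..<4}. lev r k i w = w}"
  let ?c = "white_end T (h w 0)"
  have c: "?c \<in> whites T" using white_end_in h_in[OF w] by simp
  have leaf: "vdegree T (black_end T (h w i)) = 1 \<longleftrightarrow> lev r k i w = w" if "i < 4" for i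
    using degree_one_iff[OF h_in[OF w that]] brot_fixed[OF w that] by simp
  have "{b \<in> blacks T. vdegree T b = 1 \<and> adjacent T ?c b} = (\<lambda>i. black_end T (h w i)) ` ?I"
  proof (intro equalityI subsetI)
    fix b assume "b \<in> {b \<in> blacks T. vdegree T b = 1 \<and> adjacent T ?c b}"
    then have b: "b \<in> blacks T" "vdegree T b = 1" "adjacent T ?c b" by auto
    then obtain e where e: "e \<in> edges T" "white_end T e = ?c" "black_end T e = b"
      using adjacent_white_black[OF c] by blast
    obtain v i where vi: "e = h v i" "v \<in> {1..2 * r - 1}" "i < 4" using e(1) by (rule h_cases)
    then have "v = w" using white_h[of v w i 0] w e(2) by simp
    then show "b \<in> (\<lambda>i. black_end T (h w i)) ` ?I" using vi e b(2) leaf by auto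
  next
    fix b assume "b \<in> (\<lambda>i. black_end T (h w i)) ` ?I"
    then obtain i where i: "i < 4" "lev r k i w = w" "b = black_end T (h w i)" by auto
    have "white_end T (h w i) = ?c" using white_h[OF w w i(1), of 0] by simp
    then show "b \<in> {b \<in> blacks T. vdegree T b = 1 \<and> adjacent T ?c b}"
      using i leaf h_in[OF w i(1)] adjacent_white_black[OF c] black_end_in by auto
  qed
  moreover have "inj_on (\<lambda>i. black_end T (h w i)) ?I"
  proof
    fix i j assume ij: "i \<in> ?I" "j \<in> ?I" "black_end T (h w i) = black_end T (h w j)"
    have "white_end T (h w i) = white_end T (h w j)" using ij white_h[OF w w] by simp
    then have "h w i = h w j" using no_parallel h_in[OF w] ij by simp
    then show "i = j" using h_inj[OF w w] ij by simp
  qed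
  ultimately show ?thesis by (simp add: card_image)
qed

lemma black_end_A: "w \<le> r \<Longrightarrow> 1 \<le> w \<Longrightarrow> black_end T (h w 0) = black_end T (h 1 0)"
proof (induction w)
  case (Suc w)
  show ?case
  proof (cases "w = 0")
    case False
    have w: "w \<in> {1..2 * r - 1}" using Suc.prems False by auto
    have "lev r k 0 w = Suc w" using Suc.prems False by (simp add: lev_def acyc_def)
    then have "h (Suc w) 0 = brot T (h w 0)" using brot_h[OF w, of 0] by simp
    then show ?thesis using Suc False brot_ends(2)[OF h_in[OF w, of 0]] by simp
  qed (simp add: One_nat_def)
qed simp

lemma black_end_B: "w \<le> 2 * r - 1 \<Longrightarrow> r < w \<Longrightarrow> black_end T (h w k) = black_end T (h 1 k)"
proof (induction w)
  case (Suc w)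
  have k4: "k < 4" "k \<noteq> 0" using k by auto
  show ?case
  proof (cases "w = r")
    case True
    have "lev r k k 1 = Suc r" using k4 by (simp add: lev_def bcyc_def)
    then show ?thesis using brot_h[OF one_in k4(1)] brot_ends(2)[OF h_in[OF one_in k4(1)]] True by simp
  next
    case False
    then have w: "w \<in> {1..2 * r - 1}" "r < w" using Suc.prems by auto
    have "lev r k k w = Suc w" using Suc.prems w k4 r by (simp add: lev_def bcyc_def)
    then have "h (Suc w) k = brot T (h w k)" using brot_h[OF w(1) k4(1)] by simp
    then show ?thesis using Suc w brot_ends(2)[OF h_in[OF w(1) k4(1)]] by simp
  qed
qed simp

text \<open>A white vertex other than number 1 is moved on one level only, hence has three leaf
  neighbours; number 1 is moved on the two levels \<open>0\<close> and \<open>k\<close>.\<close>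

lemma is_center_iff: "is_center T r v \<longleftrightarrow> v = c"
proof
  assume v: "is_center T r v"
  then obtain w where w: "w \<in> {1..2 * r - 1}" "v = white_end T (h w 0)"
    by (auto simp: is_center_def elim: white_cases)
  have "w = 1"
  proof (rule ccontr)
    assume "w \<noteq> 1"
    then have "{i \<in> {..<4}. lev r k i w = w} = {..<4} - {if w \<le> r then 0 else k}"
      using lev_fixed[OF w(1)] by auto
    moreover have "(if w \<le> r then 0 else k) \<in> {..<4}" using k by auto
    ultimately have "card {i \<in> {..<4}. lev r k i w = w} = 3" by (simp only: card_Diff_singleton) simp
    then show False using v leaf_neighbours[OF w(1)] by (simp add: is_center_def w(2))
  qed
  then show "v = c" by (simp add: c_def w(2))
next
  assume v: "v = c"
  have c: "c \<in> whites T" using h_in[OF one_in, of 0] white_end_in by (simp add: c_def)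
  have "{i \<in> {..<4}. lev r k i 1 = 1} = {..<4} - {0, k}"
    using lev_fixed[OF one_in] r by auto
  moreover have "{0, k} \<subseteq> {..<4}" "card {0, k} = 2" using k by auto
  ultimately have "card {i \<in> {..<4}. lev r k i 1 = 1} = 2" by (simp only: card_Diff_subset finite.intros) simp
  then have 1: "card {b \<in> blacks T. vdegree T b = 1 \<and> adjacent T c b} = 2"
    using leaf_neighbours[OF one_in] by (simp add: c_def)
  have 2: "adjacent T c b" if b: "b \<in> blacks T" "vdegree T b = r" for b
  proof -
    obtain e where e: "e \<in> edges T" "black_end T e = b" using black_nonempty[OF b(1)] by blast
    obtain w i where wi: "e = h w i" "w \<in> {1..2 * r - 1}" "i < 4" using e(1) by (rule h_cases)
    have "brot T e \<noteq> e" using degree_one_iff[OF e(1)] e(2) b(2) r by auto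
    then have "(i = 0 \<and> w \<le> r) \<or> (i = k \<and> (w = 1 \<or> r < w))"
      using brot_fixed[OF wi(2,3)] lev_fixed[OF wi(2)] wi(1) by auto
    then have "b = black_end T (h 1 i)"
      using black_end_A[of w] black_end_B[of w] wi e(2) by auto
    moreover have "white_end T (h 1 i) = c" using white_h[OF one_in one_in wi(3), of 0] by (simp add: c_def)
    ultimately show ?thesis
      using adjacent_white_black[OF c b(1)] h_in[OF one_in wi(3)] by blast
  qed
  show "is_center T r v" using 1 2 c by (simp add: is_center_def v)
qed

text \<open>The leaves at the center have levels 2 and 3 if \<open>k = 1\<close>, and levels 1 and 3
  if \<open>k = 2\<close>.\<close>

lemma consecutive_iff: "consecutive_leaves T c \<longleftrightarrow> k = 1"
proof -
  have c: "c \<in> whites T" using h_in[OF one_in, of 0] white_end_in by (simp add: c_def)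
  have leaf: "vdegree T (black_end T (h 1 i)) = 1 \<longleftrightarrow> i \<noteq> 0 \<and> i \<noteq> k" if "i < 4" for i
    using degree_one_iff[OF h_in[OF one_in that]] brot_fixed[OF one_in that] lev_fixed[OF one_in] r by auto
  have inc: "e \<in> incident T c \<longleftrightarrow> (\<exists>i<4. e = h 1 i)" for e
  proof
    assume "e \<in> incident T c"
    then have e: "e \<in> edges T" "white_end T e = c" using incident_white[OF c] by auto
    obtain w i where wi: "e = h w i" "w \<in> {1..2 * r - 1}" "i < 4" using e(1) by (rule h_cases)
    then show "\<exists>i<4. e = h 1 i" using e(2) white_h[OF wi(2) one_in wi(3), of 0] by (auto simp: c_def)
  next
    assume "\<exists>i<4. e = h 1 i"
    then obtain i where i: "i < 4" "e = h 1 i" by blast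
    then show "e \<in> incident T c"
      using incident_white[OF c, of e] h_in[OF one_in i(1)] white_h[OF one_in one_in i(1), of 0]
      by (simp add: c_def)
  qed
  have rot: "rot T c (h 1 i) = h 1 ((i + 1) mod 4)" if "i < 4" for i
    using wrot_h[OF one_in that] white_h[OF one_in one_in that, of 0] by (simp add: wrot_def c_def)
  have "consecutive_leaves T c \<longleftrightarrow> (\<exists>i<4. i \<noteq> 0 \<and> i \<noteq> k \<and> (i + 1) mod 4 \<noteq> 0 \<and> (i + 1) mod 4 \<noteq> k)"
    (is "_ \<longleftrightarrow> ?R")
  proof
    assume "consecutive_leaves T c"
    then obtain e where e: "e \<in> incident T c" "vdegree T (black_end T e) = 1"
        "vdegree T (black_end T (rot T c e)) = 1"
      unfolding consecutive_leaves_def by blast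
    then obtain i where i: "i < 4" "e = h 1 i" using inc by blast
    then have "i \<noteq> 0 \<and> i \<noteq> k \<and> (i + 1) mod 4 \<noteq> 0 \<and> (i + 1) mod 4 \<noteq> k"
      using e rot[OF i(1)] leaf[OF i(1)] leaf[of "(i + 1) mod 4"] by simp
    then show ?R using i(1) by blast
  next
    assume ?R
    then obtain i where i: "i < 4" "i \<noteq> 0" "i \<noteq> k" "(i + 1) mod 4 \<noteq> 0" "(i + 1) mod 4 \<noteq> k" by blast
    have "(i + 1) mod 4 \<noteq> i" using i(1) by presburger
    then have "h 1 i \<noteq> h 1 ((i + 1) mod 4)" using h_inj[OF one_in one_in i(1), of "(i + 1) mod 4"] by simp
    moreover have "h 1 i \<in> incident T c" using inc i(1) by blast
    moreover have "h 1 ((i + 1) mod 4) \<in> incident T c" unfolding inc by (intro exI[of _ "(i + 1) mod 4"]) simp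
    ultimately show "consecutive_leaves T c"
      unfolding consecutive_leaves_def
      using i leaf[OF i(1)] leaf[of "(i + 1) mod 4"] rot[OF i(1)]
      by (intro bexI[of _ "h 1 i"] bexI[of _ "h 1 ((i + 1) mod 4)"]) simp_all
  qed
  also have "\<dots> \<longleftrightarrow> k = 1"
  proof
    assume ?R
    then obtain i where i: "i < 4" "i \<noteq> 0" "i \<noteq> k" "(i + 1) mod 4 \<noteq> 0" "(i + 1) mod 4 \<noteq> k" by blast
    then show "k = 1" using less4_cases[OF i(1)] k by auto
  next
    assume "k = 1"
    then show ?R by (intro exI[of _ 2]) simp
  qed
  finally show ?thesis .
qed

text \<open>The labelling transports the coordinates to a grid of labels, on which the black
  permutation acts level by level and the white one is the pure shift.\<close>

lemma monodromy_grid: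
  assumes l: "edge_labelling T l"
  shows "generated_grid {1..2 * r - 1} (card (edges T)) (\<lambda>w i. l (h w i)) (lev r k)"
    and "monodromy_group T l =
      generated_grid.G {1..2 * r - 1} (card (edges T)) (\<lambda>w i. l (h w i)) (lev r k)"
proof -
  let ?n = "card (edges T)" and ?q = "\<lambda>w i. l (h w i)"
  have lb: "bij_betw l (edges T) {1..?n}" using l by (simp add: edge_labelling_def)
  have grid: "grid {1..2 * r - 1} {1..?n} ?q"
  proof
    have "bij_betw (l \<circ> (\<lambda>(w, i). h w i)) ({1..2 * r - 1} \<times> {..<4}) {1..?n}"
      by (rule bij_betw_trans[OF h_bij lb])
    then show "bij_betw (\<lambda>(w, i). l (h w i)) ({1..2 * r - 1} \<times> {..<4}) {1..?n}"
      by (simp add: comp_def case_prod_unfold)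
  qed (use r in auto)
  interpret grid "{1..2 * r - 1}" "{1..?n}" ?q by (rule grid)
  show gg: "generated_grid {1..2 * r - 1} ?n ?q (lev r k)"
    by unfold_locales (simp add: tuples_def lev_permutes[OF r])
  interpret generated_grid "{1..2 * r - 1}" ?n ?q "lev r k" by (rule gg)
  have inv: "inv_into (edges T) l (l e) = e" if "e \<in> edges T" for e
    using inv_into_f_f[OF bij_betw_imp_inj_on[OF lb] that] .
  have b: "black_perm T l = act (lev r k) 0"
  proof
    fix x show "black_perm T l x = act (lev r k) 0 x"
    proof (cases "x \<in> {1..?n}")
      case True
      then obtain w i where x: "x = l (h w i)" "w \<in> {1..2 * r - 1}" "i < 4" by (rule q_cases)
      have "black_perm T l x = l (brot T (h w i))"
        using True by (simp add: black_perm_def x(1) inv[OF h_in[OF x(2,3)]] brot_def Let_def del: atLeastAtMost_iff)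
      also have "\<dots> = l (h (lev r k i w) i)" by (simp only: brot_h[OF x(2,3)])
      also have "\<dots> = act (lev r k) 0 x" using x by (simp del: atLeastAtMost_iff)
      finally show ?thesis .
    qed (simp add: black_perm_def del: atLeastAtMost_iff)
  qed
  have w: "white_perm T l = act (\<lambda>_. id) 1"
  proof
    fix x show "white_perm T l x = act (\<lambda>_. id) 1 x"
    proof (cases "x \<in> {1..?n}")
      case True
      then obtain w i where x: "x = l (h w i)" "w \<in> {1..2 * r - 1}" "i < 4" by (rule q_cases)
      have "white_perm T l x = l (wrot T (h w i))"
        using True by (simp add: white_perm_def x(1) inv[OF h_in[OF x(2,3)]] wrot_def Let_def del: atLeastAtMost_iff)
      also have "\<dots> = l (h w ((i + 1) mod 4))" by (simp only: wrot_h[OF x(2,3)])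
      also have "\<dots> = act (\<lambda>_. id) 1 x" using x by (simp del: atLeastAtMost_iff)
      finally show ?thesis .
    qed (simp add: white_perm_def del: atLeastAtMost_iff)
  qed
  show "monodromy_group T l = G" by (simp add: monodromy_group_def G_def b w)
qed

lemma iso_semidirect_opposite:
  assumes "edge_labelling T l" "k = 2"
  shows "iso_semidirect (monodromy_group T l)
    (power_group (if odd r then alt_group (2 * r - 1) else sym_group (2 * r - 1)) 2) (integer_mod_group 4)"
proof -
  interpret opposite_cycles r "card (edges T)" "\<lambda>w i. l (h w i)"
    using monodromy_grid(1)[OF assms(1)] assms(2) r
    by (simp add: opposite_cycles_def opposite_cycles_axioms_def)
  show ?thesis using iso_opposite monodromy_grid(2)[OF assms(1)] assms(2) by (simp add: H_def)
qed

lemma iso_semidirect_consecutive: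
  assumes "edge_labelling T l" "k = 1"
  shows "odd r \<Longrightarrow> iso_semidirect (monodromy_group T l)
      (power_group (alt_group (2 * r - 1)) 4) (integer_mod_group 4)"
    and "even r \<Longrightarrow> \<exists>\<psi>\<in>actions (power_group (integer_mod_group 2) 3) (integer_mod_group 4).
      iso_semidirect (monodromy_group T l) (power_group (alt_group (2 * r - 1)) 4)
        (semidirect_product (power_group (integer_mod_group 2) 3) (integer_mod_group 4) \<psi>)"
proof -
  interpret adjacent_cycles r "card (edges T)" "\<lambda>w i. l (h w i)"
    using monodromy_grid(1)[OF assms(1)] assms(2) r
    by (simp add: adjacent_cycles_def adjacent_cycles_axioms_def)
  have G: "monodromy_group T l = G" using monodromy_grid(2)[OF assms(1)] assms(2) by simp
  show "odd r \<Longrightarrow> iso_semidirect (monodromy_group T l)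
      (power_group (alt_group (2 * r - 1)) 4) (integer_mod_group 4)"
    unfolding G by (rule iso_adjacent_odd)
  show "even r \<Longrightarrow> \<exists>\<psi>\<in>actions (power_group (integer_mod_group 2) 3) (integer_mod_group 4).
      iso_semidirect (monodromy_group T l) (power_group (alt_group (2 * r - 1)) 4)
        (semidirect_product (power_group (integer_mod_group 2) 3) (integer_mod_group 4) \<psi>)"
    unfolding G by (rule iso_adjacent_even)
qed

text \<open>The left-hand side is invariant under isomorphisms, so it distinguishes the two trees.\<close>

lemma opposite_iff:
  "(\<exists>e\<in>edges T. brot T e \<noteq> e \<and> brot T (wrot T (wrot T e)) \<noteq> wrot T (wrot T e)) \<longleftrightarrow> k = 2"
proof
  assume "\<exists>e\<in>edges T. brot T e \<noteq> e \<and> brot T (wrot T (wrot T e)) \<noteq> wrot T (wrot T e)"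
  then obtain e where e: "e \<in> edges T" "brot T e \<noteq> e" "brot T (wrot T (wrot T e)) \<noteq> wrot T (wrot T e)"
    by blast
  obtain w i where wi: "e = h w i" "w \<in> {1..2 * r - 1}" "i < 4" using e(1) by (rule h_cases)
  have "wrot T (wrot T e) = h w ((i + 2) mod 4)"
    using wrot_h[OF wi(2,3)] wrot_h[OF wi(2), of "(i + 1) mod 4"] wi(1) by (simp add: mod_simps One_nat_def)
  then have "lev r k i w \<noteq> w" "lev r k ((i + 2) mod 4) w \<noteq> w"
    using e brot_fixed[OF wi(2,3)] brot_fixed[OF wi(2), of "(i + 2) mod 4"] wi(1) by simp_all
  \<comment> \<open>A vertex moved on two different levels is the center, and these levels are
    \<open>0\<close> and \<open>k\<close>.\<close>
  then show "k = 2"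
    using k less4_cases[OF wi(3)] unfolding lev_fixed[OF wi(2)] by (elim disjE) simp_all
next
  assume k: "k = 2"
  have "wrot T (wrot T (h 1 0)) = h 1 2"
    using wrot_h[OF one_in, of 0] wrot_h[OF one_in, of 1] by simp
  then show "\<exists>e\<in>edges T. brot T e \<noteq> e \<and> brot T (wrot T (wrot T e)) \<noteq> wrot T (wrot T e)"
    using h_in[OF one_in, of 0] brot_fixed[OF one_in] lev_fixed[OF one_in] k r
    by (intro bexI[of _ "h 1 0"]) simp_all
qed

end

text \<open>In coordinates both edge permutations are given by formulas in \<open>r\<close> and
  \<open>k\<close> alone, so matching coordinates commutes with them.\<close>

lemma map_iso_of_coords:
  assumes "coord_tree T r k h" "coord_tree T' r k h'" shows "map_iso T T'"
proof -
  interpret A: coord_tree T r k h by fact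
  interpret B: coord_tree T' r k h' by fact
  let ?D = "{1..2 * r - 1} \<times> {..<4 :: nat}"
  define g where "g = (\<lambda>(w, i). h' w i) \<circ> inv_into ?D (\<lambda>(w, i). h w i)"
  have gh: "g (h w i) = h' w i" if "w \<in> {1..2 * r - 1}" "i < 4" for w i
    using inv_into_f_f[OF bij_betw_imp_inj_on[OF A.h_bij], of "(w, i)"] that by (simp add: g_def)
  show ?thesis
  proof (rule map_isoI[OF A.T B.T])
    show "bij_betw g (edges T) (edges T')"
      unfolding g_def by (rule bij_betw_trans[OF bij_betw_inv_into[OF A.h_bij] B.h_bij])
    fix e assume "e \<in> edges T"
    then obtain w i where e: "e = h w i" "w \<in> {1..2 * r - 1}" "i < 4" by (rule A.h_cases)
    show "g (brot T e) = brot T' (g e)"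
      using A.brot_h[OF e(2,3)] B.brot_h[OF e(2,3)] gh[OF A.lev_in[OF e(2)] e(3)] gh[OF e(2,3)] e(1) by simp
    show "g (wrot T e) = wrot T' (g e)"
      using A.wrot_h[OF e(2,3)] B.wrot_h[OF e(2,3)] gh[OF e(2), of "(i + 1) mod 4"] gh[OF e(2,3)] e(1) by simp
  qed
qed

lemma not_map_iso_of_coords:
  assumes "coord_tree T r 2 h" "coord_tree T' r 1 h'" shows "\<not> map_iso T T'"
proof
  interpret A: coord_tree T r 2 h by fact
  interpret B: coord_tree T' r 1 h' by fact
  assume "map_iso T T'"
  with A.T obtain g where g: "bij_betw g (edges T) (edges T')"
    "\<forall>e\<in>edges T. g (brot T e) = brot T' (g e)"
    "\<forall>e\<in>edges T. g (wrot T e) = wrot T' (g e)" by (rule map_isoE)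
  obtain e where e: "e \<in> edges T" "brot T e \<noteq> e" "brot T (wrot T (wrot T e)) \<noteq> wrot T (wrot T e)"
    using A.opposite_iff by auto
  have inj: "g a = g b \<longleftrightarrow> a = b" if "a \<in> edges T" "b \<in> edges T" for a b
    using inj_on_eq_iff[OF bij_betw_imp_inj_on[OF g(1)]] that by blast
  have w: "wrot T e \<in> edges T" "wrot T (wrot T e) \<in> edges T" using A.wrot_ends(1) e(1) by blast+
  have "brot T' (g e) \<noteq> g e"
    using inj[OF A.brot_ends(1)[OF e(1)] e(1)] e g(2) by simp
  moreover have "brot T' (wrot T' (wrot T' (g e))) \<noteq> wrot T' (wrot T' (g e))"
    using inj[OF A.brot_ends(1)[OF w(2)] w(2)] e(3) g(2,3) w e(1) by simp
  ultimately show False using B.opposite_iff bij_betwE[OF g(1)] e(1) by auto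
qed

section \<open>The two trees\<close>

lemma cyclic_on_image_lessThan:
  assumes m: "0 < m" and f: "\<And>j. j < m \<Longrightarrow> f (x j) = x (Suc j mod m)"
  shows "cyclic_on f (x ` {..<m})"
proof (rule cyclic_on_singleI[of "x 0"])
  show "x 0 \<in> x ` {..<m}" using m by auto
  have *: "(f ^^ j) (x 0) = x (j mod m)" for j
    by (induction j) (use f m in \<open>simp_all add: mod_Suc_eq\<close>)
  show "x ` {..<m} = orbit f (x 0)"
  proof (intro equalityI subsetI)
    fix y assume "y \<in> x ` {..<m}"
    then obtain j where "j < m" "y = x j" by auto
    \<comment> \<open>\<open>orbit_altdef\<close> ranges over positive powers, so a full turn is
      added to cover \<open>j = 0\<close>.\<close>
    then have "y = (f ^^ (j + m)) (x 0)" by (simp add: *)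
    then show "y \<in> orbit f (x 0)" using m by (auto simp: orbit_altdef)
  next
    fix y assume "y \<in> orbit f (x 0)"
    then show "y \<in> x ` {..<m}" using m by (auto simp: orbit_altdef *)
  qed
qed

text \<open>The property of cycles behind the proof of acyclicity: each end of an edge is shared
  with a neighbouring edge of the cycle. A cycle of length 1 would be a loop, which
  \<open>loop\<close> excludes.\<close>

lemma graph_cycle_edges:
  assumes cyc: "graph_cycle T vs es"
    and loop: "\<forall>e\<in>edges T. black_end T e \<noteq> white_end T e"
  shows "set es \<noteq> {}" "set es \<subseteq> edges T"
    and "\<And>e v. e \<in> set es \<Longrightarrow> v \<in> {black_end T e, white_end T e} \<Longrightarrow>
      \<exists>f\<in>set es. f \<noteq> e \<and> v \<in> {black_end T f, white_end T f}"
proof -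
  define m where "m = length es"
  have len: "length vs = m" and dist: "distinct es" and sub: "set es \<subseteq> edges T"
    and ends: "\<And>i. i < m \<Longrightarrow> {black_end T (es ! i), white_end T (es ! i)} = {vs ! i, vs ! (Suc i mod m)}"
    and ne: "es \<noteq> []"
    using cyc by (auto simp: graph_cycle_def m_def)
  show "set es \<noteq> {}" "set es \<subseteq> edges T" using ne sub by auto
  have "0 < m" using ne by (simp add: m_def)
  moreover have "m \<noteq> 1"
  proof
    assume "m = 1"
    then have "es ! 0 \<in> edges T" using sub by (auto simp: m_def)
    moreover have "{black_end T (es ! 0), white_end T (es ! 0)} = {vs ! 0}"
      using ends[of 0] \<open>m = 1\<close> by simp
    ultimately show False using loop by (metis doubleton_eq_iff insert_absorb2)
  qed
  ultimately have m: "2 \<le> m" by simp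
  have neq: "es ! j \<noteq> es ! i" if "i < m" "j < m" "i \<noteq> j" for i j
    using nth_eq_iff_index_eq[OF dist] that by (simp add: m_def)
  fix e v assume "e \<in> set es" and v: "v \<in> {black_end T e, white_end T e}"
  then obtain i where i: "i < m" "e = es ! i" by (auto simp: in_set_conv_nth m_def)
  from v have "v = vs ! i \<or> v = vs ! (Suc i mod m)" using ends[OF i(1)] i(2) by auto
  then obtain j where j: "j < m" "j \<noteq> i" "v \<in> {vs ! j, vs ! (Suc j mod m)}"
  proof
    assume *: "v = vs ! i"
    show ?thesis
    proof (cases i)
      case 0
      then show ?thesis using that[of "m - 1"] * m by simp
    next
      case (Suc j)
      then show ?thesis using that[of j] * i(1) by simp
    qed
  next
    assume *: "v = vs ! (Suc i mod m)"
    have "Suc i mod m \<noteq> i" using i(1) m by (cases "Suc i = m") auto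
    then show ?thesis using that[of "Suc i mod m"] * m by simp
  qed
  then have "es ! j \<in> set es" "es ! j \<noteq> e" "v \<in> {black_end T (es ! j), white_end T (es ! j)}"
    using neq[OF i(1) j(1)] i(2) ends[OF j(1)] by (auto simp: m_def)
  then show "\<exists>f\<in>set es. f \<noteq> e \<and> v \<in> {black_end T f, white_end T f}" by blast
qed

text \<open>The edge \<open>4 * w + i\<close> has coordinates \<open>(w, i)\<close>; its white vertex is \<open>w\<close>. The black vertices
  of degree \<open>r\<close> are \<open>0\<close> and \<open>2 * r\<close>.\<close>

definition model :: "nat \<Rightarrow> nat \<Rightarrow> (nat, nat) bicolored_map" where
  "model r k = (let b = \<lambda>e. if e mod 4 = 0 \<and> e div 4 \<le> r then 0
       else if e mod 4 = k \<and> (e div 4 = 1 \<or> r < e div 4) then 2 * r else 2 * r + 1 + e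
     in \<lparr>blacks = b ` {4..<8 * r}, whites = {1..2 * r - 1}, edges = {4..<8 * r},
      black_end = b, white_end = (\<lambda>e. e div 4),
      rot = (\<lambda>v e. if v \<in> {1..2 * r - 1} then 4 * (e div 4) + (e mod 4 + 1) mod 4
        else 4 * lev r k (e mod 4) (e div 4) + e mod 4)\<rparr>)"

section \<open>Verification of the model\<close>

context
  fixes r k :: nat
  assumes r: "2 \<le> r" and k: "k = 1 \<or> k = 2"
begin

abbreviation "M \<equiv> model r k"

lemma model_edges: "edges M = {4..<8 * r}"
  and model_whites: "whites M = {1..2 * r - 1}"
  and model_blacks: "blacks M = black_end M ` {4..<8 * r}"
  and model_white_end: "white_end M e = e div 4"
  by (simp_all add: model_def Let_def)

lemma model_edge_cases:
  assumes "e \<in> edges M" obtains w i where "e = 4 * w + i" "w \<in> {1..2 * r - 1}" "i < 4"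
proof (rule that)
  show "e = 4 * (e div 4) + e mod 4" by simp
  show "e div 4 \<in> {1..2 * r - 1}" using assms by (auto simp: model_edges)
qed simp

lemma model_edge: "w \<in> {1..2 * r - 1} \<Longrightarrow> i < 4 \<Longrightarrow> 4 * w + i \<in> edges M"
  by (auto simp: model_edges)

lemma model_black_end:
  "i < 4 \<Longrightarrow> black_end M (4 * w + i) = (if i = 0 \<and> w \<le> r then 0
     else if i = k \<and> (w = 1 \<or> r < w) then 2 * r else 2 * r + 1 + (4 * w + i))"
  by (simp add: model_def Let_def)

lemma model_rot:
  "i < 4 \<Longrightarrow> rot M v (4 * w + i) = (if v \<in> {1..2 * r - 1} then 4 * w + (i + 1) mod 4
     else 4 * lev r k i w + i)"
  by (simp add: model_def Let_def)

text \<open>The black numbers \<open>0\<close>, \<open>2 * r\<close> and, for leaves,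
  \<open>2 * r + 1 + e\<close> stay clear of the white ones.\<close>

lemma model_black_end_range: "black_end M e = 0 \<or> 2 * r \<le> black_end M e"
  by (simp add: model_def Let_def)

lemma model_disjoint: "blacks M \<inter> whites M = {}"
proof -
  have "v = 0 \<or> 2 * r \<le> v" if v: "v \<in> blacks M" for v
  proof -
    obtain e where "v = black_end M e" using v unfolding model_blacks by blast
    then show ?thesis using model_black_end_range by simp
  qed
  then show ?thesis using r unfolding disjoint_iff model_whites by force
qed

lemma model_ends_neq: "\<forall>e\<in>edges M. black_end M e \<noteq> white_end M e"
proof
  fix e assume "e \<in> edges M"
  then show "black_end M e \<noteq> white_end M e"
    using model_black_end_range[of e] r by (auto simp: model_white_end model_edges)
qed

lemma model_incident_white:
  assumes "w \<in> {1..2 * r - 1}" shows "incident M w = (\<lambda>i. 4 * w + i) ` {..<4}"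
proof (intro equalityI subsetI)
  fix e assume "e \<in> incident M w"
  then have e: "e \<in> edges M" "black_end M e = w \<or> white_end M e = w" by (auto simp: incident_def)
  moreover have "black_end M e \<noteq> w" using model_black_end_range[of e] assms by auto
  ultimately have "e = 4 * w + e mod 4" by (auto simp: model_white_end)
  then show "e \<in> (\<lambda>i. 4 * w + i) ` {..<4}" by (rule image_eqI) simp
next
  fix e assume "e \<in> (\<lambda>i. 4 * w + i) ` {..<4}"
  then obtain i where "i < 4" "e = 4 * w + i" by auto
  then show "e \<in> incident M w" using model_edge[OF assms] by (simp add: incident_def model_white_end)
qed

lemma model_incident_black:
  assumes "v \<notin> {1..2 * r - 1}" shows "incident M v = {e \<in> edges M. black_end M e = v}"
proof -
  have "white_end M e \<noteq> v" if "e \<in> edges M" for e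
    using that assms by (auto simp: model_white_end elim!: model_edge_cases)
  then show ?thesis by (auto simp: incident_def)
qed

lemma model_incident_A: "incident M 0 = (\<lambda>j. 4 * Suc j) ` {..<r}"
proof -
  have "incident M 0 = {e \<in> edges M. black_end M e = 0}"
    by (rule model_incident_black) simp
  also have "\<dots> = (\<lambda>j. 4 * Suc j) ` {..<r}"
  proof (intro equalityI subsetI)
    fix e assume e: "e \<in> {e \<in> edges M. black_end M e = 0}"
    then obtain w i where wi: "e = 4 * w + i" "w \<in> {1..2 * r - 1}" "i < 4"
      by (auto elim: model_edge_cases)
    then have "i = 0" "w \<le> r" using e r by (auto simp: model_black_end split: if_splits)
    then show "e \<in> (\<lambda>j. 4 * Suc j) ` {..<r}"
      using wi by (intro image_eqI[of _ _ "w - 1"]) auto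
  next
    fix e assume "e \<in> (\<lambda>j. 4 * Suc j) ` {..<r}"
    then obtain j where "e = 4 * Suc j + 0" "j < r" by auto
    then show "e \<in> {e \<in> edges M. black_end M e = 0}"
      using model_edge[of "Suc j" 0] model_black_end[of 0 "Suc j"] by simp
  qed
  finally show ?thesis .
qed

text \<open>The edges at the black vertex \<open>2 * r\<close> in cyclic order, starting from the
  one at the center.\<close>

definition enumB :: "nat \<Rightarrow> nat" where
  "enumB j = 4 * (if j = 0 then 1 else r + j) + k"

lemma model_incident_B: "incident M (2 * r) = enumB ` {..<r}"
proof -
  have "incident M (2 * r) = {e \<in> edges M. black_end M e = 2 * r}"
    by (rule model_incident_black) (use r in auto)
  also have "\<dots> = enumB ` {..<r}"
  proof (intro equalityI subsetI)
    fix e assume e: "e \<in> {e \<in> edges M. black_end M e = 2 * r}"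
    then obtain w i where wi: "e = 4 * w + i" "w \<in> {1..2 * r - 1}" "i < 4"
      by (auto elim: model_edge_cases)
    then have "i = k" "w = 1 \<or> r < w" using e r by (auto simp: model_black_end split: if_splits)
    then show "e \<in> enumB ` {..<r}"
      using wi r by (intro image_eqI[of _ _ "if w = 1 then 0 else w - r"]) (auto simp: enumB_def)
  next
    fix e assume "e \<in> enumB ` {..<r}"
    then obtain j where j: "e = enumB j" "j < r" by auto
    have k4: "k < 4" "k \<noteq> 0" using k by auto
    have "(if j = 0 then 1 else r + j) \<in> {1..2 * r - 1}" using j r by auto
    from model_edge[OF this k4(1)] show "e \<in> {e \<in> edges M. black_end M e = 2 * r}"
      using j k4 by (simp add: enumB_def model_black_end)
  qed
  finally show ?thesis .
qed

lemma model_incident_leaf: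
  assumes e: "e \<in> edges M" "black_end M e = 2 * r + 1 + e"
  shows "incident M (2 * r + 1 + e) = {e}"
proof -
  have "incident M (2 * r + 1 + e) = {f \<in> edges M. black_end M f = 2 * r + 1 + e}"
    by (rule model_incident_black) simp
  moreover have "black_end M f = 2 * r + 1 + e \<longleftrightarrow> f = e" for f
    using e(2) by (auto simp: model_def Let_def split: if_splits)
  ultimately show ?thesis using e(1) by auto
qed

lemma model_black_cases:
  assumes "v \<in> blacks M"
  obtains "v = 0" | "v = 2 * r" | e where "e \<in> edges M" "black_end M e = 2 * r + 1 + e" "v = 2 * r + 1 + e"
proof -
  obtain e where "e \<in> edges M" "v = black_end M e" using assms by (auto simp: model_blacks model_edges)
  moreover have "black_end M e = 0 \<or> black_end M e = 2 * r \<or> black_end M e = 2 * r + 1 + e"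
    by (simp add: model_def Let_def)
  ultimately show ?thesis using that by metis
qed

lemma model_leaf_fixed:
  assumes "e \<in> edges M" "black_end M e = 2 * r + 1 + e"
  shows "rot M (2 * r + 1 + e) e = e"
proof -
  obtain w i where wi: "e = 4 * w + i" "w \<in> {1..2 * r - 1}" "i < 4"
    using assms(1) by (rule model_edge_cases)
  have "lev r k i w = w"
    using assms(2) wi k r by (auto simp: model_black_end lev_def acyc_def bcyc_def split: if_splits)
  then show ?thesis using wi by (simp add: model_rot)
qed

lemma model_cyclic:
  assumes "v \<in> vertices M" shows "cyclic_on (rot M v) (incident M v)"
proof (cases "v \<in> whites M")
  case True
  then have v: "v \<in> {1..2 * r - 1}" by (simp add: model_whites)
  show ?thesis
    unfolding model_incident_white[OF v]
    by (rule cyclic_on_image_lessThan) (use v in \<open>simp_all add: model_rot One_nat_def del: atLeastAtMost_iff\<close>)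
next
  case False
  then have "v \<in> blacks M" using assms by (simp add: vertices_def)
  then show ?thesis
  proof (cases rule: model_black_cases)
    case 1
    show ?thesis
      unfolding 1 model_incident_A
    proof (rule cyclic_on_image_lessThan)
      fix j assume j: "j < r"
      have "lev r k 0 (Suc j) = Suc (Suc j mod r)"
        using j by (cases "Suc j = r") (auto simp: lev_def acyc_def One_nat_def)
      then show "rot M 0 (4 * Suc j) = 4 * Suc (Suc j mod r)"
        using model_rot[of 0 0 "Suc j"] by simp
    qed (use r in simp)
  next
    case 2
    show ?thesis
      unfolding 2 model_incident_B
    proof (rule cyclic_on_image_lessThan)
      fix j assume j: "j < r"
      have k4: "k < 4" "k \<noteq> 0" using k by auto
      have "lev r k k (if j = 0 then 1 else r + j) = (if Suc j mod r = 0 then 1 else r + Suc j mod r)"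
        using j k4 r by (cases "Suc j = r") (auto simp: lev_def bcyc_def)
      then show "rot M (2 * r) (enumB j) = enumB (Suc j mod r)"
        using r k4 by (simp add: model_rot enumB_def)
    qed (use r in simp)
  next
    case (3 e)
    show ?thesis
      unfolding 3(3) model_incident_leaf[OF 3(1,2)]
      using model_leaf_fixed[OF 3(1,2)] orbit_eq_singleton_iff[of "rot M (2 * r + 1 + e)" e]
      by (auto simp: cyclic_on_def)
  qed
qed

text \<open>A leaf edge lies on no cycle. White vertices other than 1 have a single edge that is not
  a leaf edge, so all edges of a cycle would be at vertex 1; the two candidates there end in
  different black vertices.\<close>

lemma model_acyclic: "\<not> graph_cycle M vs es"
proof
  assume cyc: "graph_cycle M vs es"
  note c = graph_cycle_edges[OF cyc model_ends_neq]
  have bw: "black_end M f \<in> blacks M" "white_end M f \<in> whites M" if "f \<in> edges M" for f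
    using that by (auto simp: model_blacks model_whites model_white_end model_edges)
  have black: "\<exists>f\<in>set es. f \<noteq> e \<and> black_end M f = black_end M e" if e: "e \<in> set es" for e
  proof -
    have "black_end M e \<in> {black_end M e, white_end M e}" by simp
    then obtain f where f: "f \<in> set es" "f \<noteq> e" "black_end M e \<in> {black_end M f, white_end M f}"
      using c(3)[OF e] by blast
    have "e \<in> edges M" "f \<in> edges M" using e f(1) c(2) by auto
    then have "black_end M e \<noteq> white_end M f" using bw model_disjoint by (metis disjoint_iff)
    then show ?thesis using f by auto
  qed
  have white: "\<exists>f\<in>set es. f \<noteq> e \<and> white_end M f = white_end M e" if e: "e \<in> set es" for e
  proof -
    have "white_end M e \<in> {black_end M e, white_end M e}" by simp
    then obtain f where f: "f \<in> set es" "f \<noteq> e" "white_end M e \<in> {black_end M f, white_end M f}"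
      using c(3)[OF e] by blast
    have "e \<in> edges M" "f \<in> edges M" using e f(1) c(2) by auto
    then have "black_end M f \<noteq> white_end M e" using bw model_disjoint by (metis disjoint_iff)
    then show ?thesis using f by auto
  qed
  have big: "(e mod 4 = 0 \<and> e div 4 \<le> r) \<or> (e mod 4 = k \<and> (e div 4 = 1 \<or> r < e div 4))"
    if e: "e \<in> set es" for e
  proof (rule ccontr)
    assume "\<not> ?thesis"
    then have *: "black_end M e = 2 * r + 1 + e" by (simp add: model_def Let_def)
    obtain f where "f \<in> set es" "f \<noteq> e" "black_end M f = black_end M e" using black[OF e] by blast
    then show False using * by (simp add: model_def Let_def split: if_splits)
  qed
  have one: "e div 4 = 1" if e: "e \<in> set es" for e
  proof -
    obtain f where f: "f \<in> set es" "f \<noteq> e" "f div 4 = e div 4"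
      using white[OF e] by (auto simp: model_white_end)
    have "f mod 4 \<noteq> e mod 4" using f(2,3) by (metis div_mult_mod_eq)
    then show ?thesis using big[OF e] big[OF f(1)] f(3) k by auto
  qed
  have "\<exists>e. e \<in> set es" using c(1) by (simp add: ex_in_conv)
  then obtain e where e: "e \<in> set es" by (rule exE)
  obtain f where f: "f \<in> set es" "f \<noteq> e" "black_end M f = black_end M e" using black[OF e] by blast
  have "f mod 4 \<noteq> e mod 4" using f(2) one[OF e] one[OF f(1)] by (metis div_mult_mod_eq)
  then show False
    using big[OF e] big[OF f(1)] one[OF e] one[OF f(1)] f(3) r k
    by (auto simp: model_def Let_def split: if_splits)
qed

text \<open>Every white vertex is joined to \<open>0\<close> or to \<open>2 * r\<close>, and vertex
  1 to both.\<close>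

lemma model_connected: "connected_graph M"
proof -
  let ?R = "(adjacent M)\<^sup>*\<^sup>*"
  have sym: "adjacent M u v \<Longrightarrow> adjacent M v u" for u v
    by (auto simp: adjacent_def insert_commute)
  have symR: "?R u v \<Longrightarrow> ?R v u" for u v
  proof (induction rule: rtranclp_induct)
    case (step y z)
    then show ?case by (meson converse_rtranclp_into_rtranclp sym)
  qed simp
  have edge: "?R (white_end M e) (black_end M e)" if "e \<in> edges M" for e
    using that by (intro r_into_rtranclp) (auto simp: adjacent_def insert_commute)
  have k4: "k < 4" "k \<noteq> 0" using k by auto
  have A: "?R w 0" if "w \<in> {1..r}" for w
  proof -
    have "4 * w + 0 \<in> edges M" using that by (intro model_edge) auto
    from edge[OF this] show ?thesis using that by (simp add: model_white_end model_black_end[of 0, simplified])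
  qed
  have B: "?R w (2 * r)" if "w = 1 \<or> r < w" "w \<in> {1..2 * r - 1}" for w
    using edge[OF model_edge[OF that(2) k4(1)]] that(1) k4 by (simp add: model_white_end model_black_end)
  have one: "1 \<in> {1..r}" "1 \<in> {1..2 * r - 1}" using r by auto
  have white: "?R w 1" if w: "w \<in> {1..2 * r - 1}" for w
  proof (cases "w \<le> r")
    case True
    then show ?thesis using A[of w] symR[OF A[OF one(1)]] w by auto
  next
    case False
    then show ?thesis using B[OF _ w] symR[OF B[OF _ one(2)]] by auto
  qed
  have all: "?R v 1" if "v \<in> vertices M" for v
  proof (cases "v \<in> whites M")
    case True
    then show ?thesis using white by (simp add: model_whites)
  next
    case False
    then have "v \<in> black_end M ` edges M"
      using that by (simp add: vertices_def model_blacks model_edges)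
    then obtain e where e: "e \<in> edges M" "v = black_end M e" by blast
    have w: "white_end M e \<in> {1..2 * r - 1}" using e(1) by (auto simp: model_white_end elim!: model_edge_cases)
    show ?thesis unfolding e(2) by (rule rtranclp_trans[OF symR[OF edge[OF e(1)]] white[OF w]])
  qed
  have "1 \<in> vertices M" using one by (simp add: vertices_def model_whites)
  then show ?thesis
    unfolding connected_graph_def
    by (blast intro: rtranclp_trans[OF all symR[OF all]])
qed

lemma model_plane_tree: "plane_tree M"
proof -
  have "finite (vertices M)" "finite (edges M)"
    by (simp_all add: vertices_def model_blacks model_whites model_edges)
  moreover have "black_end M ` edges M \<subseteq> blacks M" "white_end M ` edges M \<subseteq> whites M"
    by (auto simp: model_blacks model_whites model_white_end model_edges)
  ultimately show ?thesis
    unfolding plane_tree_def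
    using model_disjoint model_connected model_acyclic model_cyclic by blast
qed

lemma model_coord_tree: "coord_tree M r k (\<lambda>w i. 4 * w + i)"
proof
  show "plane_tree M" by (rule model_plane_tree)
  have "bij_betw (\<lambda>(w, i). 4 * w + i) ({1..2 * r - 1} \<times> {..<4}) (edges M)"
  proof (rule bij_betw_byWitness[where f' = "\<lambda>e. (e div 4, e mod 4)"])
    show "(\<lambda>(w, i). 4 * w + i) ` ({1..2 * r - 1} \<times> {..<4}) \<subseteq> edges M"
      using model_edge by auto
    show "(\<lambda>e. (e div 4, e mod 4)) ` edges M \<subseteq> {1..2 * r - 1} \<times> {..<4}"
      by (auto elim!: model_edge_cases)
  qed auto
  moreover have "wrot M (4 * w + i) = 4 * w + (i + 1) mod 4" if "w \<in> {1..2 * r - 1}" "i < 4" for w i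
    using that by (simp add: wrot_def model_white_end model_rot del: atLeastAtMost_iff)
  moreover have "brot M (4 * w + i) = 4 * lev r k i w + i" if "i < 4" for w i
  proof -
    have "black_end M (4 * w + i) \<notin> {1..2 * r - 1}"
      using model_black_end_range[of "4 * w + i"] r by auto
    then show ?thesis using that by (simp add: brot_def model_rot del: atLeastAtMost_iff)
  qed
  ultimately show "coords M r k (\<lambda>w i. 4 * w + i)"
    by (simp add: coords_def del: atLeastAtMost_iff)
qed (rule r k)+

text \<open>Of the \<open>8 * r - 4\<close> edges, \<open>r\<close> are at each of the two big black
  vertices; the remaining \<open>6 * r - 4\<close> carry one leaf each.\<close>

lemma model_passport:
  "has_passport M (replicate_mset 2 r + replicate_mset (6 * r - 4) 1) (replicate_mset (2 * r - 1) 4) (8 * r - 4)"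
proof -
  define L where "L = {e \<in> edges M. black_end M e = 2 * r + 1 + e}"
  have dA: "card (incident M 0) = r"
    unfolding model_incident_A by (subst card_image) (auto simp: inj_on_def)
  have "inj_on enumB {..<r}"
  proof
    fix i j assume "enumB i = enumB j"
    then have "(if i = 0 then 1 else r + i) = (if j = 0 then 1 else r + j)"
      by (simp only: enumB_def add_right_cancel mult_cancel1) simp
    then show "i = j" using r by (cases "i = 0"; cases "j = 0") simp_all
  qed
  then have dB: "card (incident M (2 * r)) = r"
    unfolding model_incident_B by (simp add: card_image)
  have A: "incident M 0 = {e \<in> edges M. black_end M e = 0}"
    by (rule model_incident_black) simp
  have B: "incident M (2 * r) = {e \<in> edges M. black_end M e = 2 * r}"
    by (rule model_incident_black) (use r in simp)
  note AB = A B
  have "black_end M e = 0 \<or> black_end M e = 2 * r \<or> black_end M e = 2 * r + 1 + e" for e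
    by (simp add: model_def Let_def)
  then have un: "edges M = incident M 0 \<union> (incident M (2 * r) \<union> L)"
    unfolding AB L_def by blast
  have fin: "finite (edges M)" by (simp add: model_edges)
  then have fins: "finite (incident M 0)" "finite (incident M (2 * r))" "finite L"
    by (simp_all add: AB L_def)
  have "incident M 0 \<inter> (incident M (2 * r) \<union> L) = {}"
  proof -
    have False if "black_end M e = 0" "black_end M e = 2 * r \<or> black_end M e = 2 * r + 1 + e" for e
      using that r by linarith
    then show ?thesis unfolding AB L_def by blast
  qed
  then have "card (incident M 0 \<union> (incident M (2 * r) \<union> L)) =
      card (incident M 0) + card (incident M (2 * r) \<union> L)"
    using fins by (intro card_Un_disjoint) simp_all
  moreover have "incident M (2 * r) \<inter> L = {}"
  proof -
    have False if "black_end M e = 2 * r" "black_end M e = 2 * r + 1 + e" for e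
      using that by linarith
    then show ?thesis unfolding AB L_def by blast
  qed
  then have "card (incident M (2 * r) \<union> L) = card (incident M (2 * r)) + card L"
    using fins by (intro card_Un_disjoint)
  ultimately have "card (edges M) = r + (r + card L)" unfolding un[symmetric] by (simp only: dA dB)
  then have cL: "card L = 6 * r - 4" using r by (simp add: model_edges)
  have "incident M 0 \<noteq> {}" "incident M (2 * r) \<noteq> {}" using dA dB r by auto
  then have big: "0 \<in> blacks M" "2 * r \<in> blacks M"
    unfolding AB model_blacks model_edges by force+
  have bl: "blacks M = insert 0 (insert (2 * r) ((\<lambda>e. 2 * r + 1 + e) ` L))"
  proof (intro equalityI subsetI)
    fix v assume "v \<in> blacks M"
    then show "v \<in> insert 0 (insert (2 * r) ((\<lambda>e. 2 * r + 1 + e) ` L))"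
      by (cases rule: model_black_cases) (simp_all add: L_def)
  next
    fix v assume "v \<in> insert 0 (insert (2 * r) ((\<lambda>e. 2 * r + 1 + e) ` L))"
    then consider "v = 0" | "v = 2 * r" | e where "e \<in> L" "v = 2 * r + 1 + e" by blast
    then show "v \<in> blacks M"
    proof cases
      case (3 e)
      then have "e \<in> edges M" "v = black_end M e" by (simp_all add: L_def)
      then show ?thesis unfolding model_blacks model_edges by (rule rev_image_eqI)
    qed (simp_all add: big)
  qed
  have finL: "finite L" using fin by (simp add: L_def)
  have "mset_set (blacks M) = {#0, 2 * r#} + image_mset (\<lambda>e. 2 * r + 1 + e) (mset_set L)"
    unfolding bl using finL r by (simp add: image_mset_mset_set inj_on_def image_iff)
  moreover have "vdegree M (2 * r + 1 + e) = 1" if "e \<in> L" for e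
    using that model_incident_leaf by (simp add: vdegree_def L_def)
  then have "image_mset (\<lambda>e. vdegree M (2 * r + 1 + e)) (mset_set L) = image_mset (\<lambda>_. 1) (mset_set L)"
    using finL by (intro image_mset_cong) simp
  ultimately have "image_mset (vdegree M) (mset_set (blacks M)) = {#r, r#} + replicate_mset (6 * r - 4) 1"
    by (simp add: vdegree_def[of _ 0] vdegree_def[of _ "2 * r"] dA dB image_mset.compositionality comp_def
      image_mset_const_eq cL)
  moreover have "vdegree M w = 4" if "w \<in> {1..2 * r - 1}" for w
    unfolding vdegree_def model_incident_white[OF that] by (simp add: card_image inj_on_def)
  then have "image_mset (vdegree M) (mset_set (whites M)) = image_mset (\<lambda>_. 4) (mset_set {1..2 * r - 1})"
    unfolding model_whites by (intro image_mset_cong) simp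
  ultimately show ?thesis
    by (simp add: has_passport_def image_mset_const_eq model_edges numeral_2_eq_2 del: One_nat_def)
qed

end

theorem lemma7p2:
  fixes r s p n :: nat
  assumes "2 \<le> r" "0 < s" "0 < p" "0 < n"
    and "n = 4 * p" "n = 2 * r + s" "p + s + 2 = n + 1"
  shows
    "(\<exists>(T1 :: (nat, nat) bicolored_map) (T2 :: (nat, nat) bicolored_map).
        plane_tree T1 \<and>
        has_passport T1 (replicate_mset 2 r + replicate_mset s 1) (replicate_mset p 4) n \<and>
        (\<exists>c. is_center T1 r c \<and> \<not> consecutive_leaves T1 c) \<and>
        plane_tree T2 \<and>
        has_passport T2 (replicate_mset 2 r + replicate_mset s 1) (replicate_mset p 4) n \<and>
        (\<exists>c. is_center T2 r c \<and> consecutive_leaves T2 c) \<and>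
        \<not> map_iso T1 T2 \<and>
        (\<forall>T :: ('v, 'e) bicolored_map. plane_tree T \<longrightarrow>
           has_passport T (replicate_mset 2 r + replicate_mset s 1) (replicate_mset p 4) n \<longrightarrow>
           map_iso T T1 \<or> map_iso T T2)) \<and>
     (\<forall>T :: ('v, 'e) bicolored_map. plane_tree T \<longrightarrow>
        has_passport T (replicate_mset 2 r + replicate_mset s 1) (replicate_mset p 4) n \<longrightarrow>
        (\<exists>!c. is_center T r c) \<and>
        (\<forall>c l. is_center T r c \<longrightarrow> edge_labelling T l \<longrightarrow>
          (\<not> consecutive_leaves T c \<longrightarrow>
            (odd r \<longrightarrow> iso_semidirect (monodromy_group T l)
               (power_group (alt_group p) 2) (integer_mod_group 4)) \<and>
            (even r \<longrightarrow> iso_semidirect (monodromy_group T l)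
               (power_group (sym_group p) 2) (integer_mod_group 4))) \<and>
          (consecutive_leaves T c \<longrightarrow>
            (even r \<longrightarrow>
              (\<exists>\<psi>\<in>actions (power_group (integer_mod_group 2) 3) (integer_mod_group 4).
                iso_semidirect (monodromy_group T l) (power_group (alt_group p) 4)
                  (semidirect_product (power_group (integer_mod_group 2) 3) (integer_mod_group 4) \<psi>))) \<and>
            (odd r \<longrightarrow> iso_semidirect (monodromy_group T l)
               (power_group (alt_group p) 4) (integer_mod_group 4)))))"
proof -
  \<comment> \<open>Eliminating \<open>n\<close> gives \<open>s = 3 * p - 1\<close>, and then
    \<open>4 * p = 2 * r + s\<close> yields \<open>p = 2 * r - 1\<close>.\<close>
  have p: "p = 2 * r - 1" and s: "s = 6 * r - 4" and n: "n = 8 * r - 4"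
    using assms by linarith+
  define P where "P = (\<lambda>T :: ('v, 'e) bicolored_map.
    has_passport T (replicate_mset 2 r + replicate_mset s 1) (replicate_mset p 4) n)"
  have coord: "\<exists>k h. coord_tree T r k h" if "plane_tree T" "P T" for T :: "('v, 'e) bicolored_map"
  proof -
    interpret tree T by unfold_locales (rule that(1))
    show ?thesis
      using coords_of_passport[OF assms(1) p assms(5)] that(2) T assms(1)
      unfolding P_def coord_tree_def coord_tree_axioms_def tree_def by blast
  qed
  let ?T1 = "model r 2" and ?T2 = "model r 1"
  have c1: "coord_tree ?T1 r 2 (\<lambda>w i. 4 * w + i)" and c2: "coord_tree ?T2 r 1 (\<lambda>w i. 4 * w + i)"
    using model_coord_tree[OF assms(1)] by simp_all
  interpret T1: coord_tree ?T1 r 2 "\<lambda>w i. 4 * w + i" by (rule c1)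
  interpret T2: coord_tree ?T2 r 1 "\<lambda>w i. 4 * w + i" by (rule c2)
  have pass: "has_passport (model r k) (replicate_mset 2 r + replicate_mset s 1) (replicate_mset p 4) n"
    if "k = 1 \<or> k = 2" for k
    using model_passport[OF assms(1) that] by (simp only: p s n)
  \<comment> \<open>Coordinates with parameter \<open>k\<close> identify a tree with the model for
    the same \<open>k\<close>.\<close>
  have cls: "map_iso T ?T1 \<or> map_iso T ?T2" if T: "plane_tree T" "P T" for T
  proof -
    obtain k h where c: "coord_tree T r k h" using coord[OF T] by blast
    have "k = 1 \<or> k = 2" using c by (simp add: coord_tree_def coord_tree_axioms_def)
    then show ?thesis using map_iso_of_coords[OF c] c1 c2 c map_iso_of_coords by blast
  qed
  have center: "\<exists>c. is_center ?T1 r c \<and> \<not> consecutive_leaves ?T1 c"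
    "\<exists>c. is_center ?T2 r c \<and> consecutive_leaves ?T2 c"
    using T1.is_center_iff T1.consecutive_iff T2.is_center_iff T2.consecutive_iff by auto
  have A: "\<exists>(T1 :: (nat, nat) bicolored_map) (T2 :: (nat, nat) bicolored_map).
        plane_tree T1 \<and>
        has_passport T1 (replicate_mset 2 r + replicate_mset s 1) (replicate_mset p 4) n \<and>
        (\<exists>c. is_center T1 r c \<and> \<not> consecutive_leaves T1 c) \<and>
        plane_tree T2 \<and>
        has_passport T2 (replicate_mset 2 r + replicate_mset s 1) (replicate_mset p 4) n \<and>
        (\<exists>c. is_center T2 r c \<and> consecutive_leaves T2 c) \<and>
        \<not> map_iso T1 T2 \<and>
        (\<forall>T :: ('v, 'e) bicolored_map. plane_tree T \<longrightarrow> P T \<longrightarrow> map_iso T T1 \<or> map_iso T T2)"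
    using T1.T T2.T pass[of 1] pass[of 2] center not_map_iso_of_coords[OF c1 c2] cls
    by (intro exI[of _ ?T1] exI[of _ ?T2] conjI) simp_all
  have B: "(\<exists>!c. is_center T r c) \<and>
        (\<forall>c l. is_center T r c \<longrightarrow> edge_labelling T l \<longrightarrow>
          (\<not> consecutive_leaves T c \<longrightarrow>
            (odd r \<longrightarrow> iso_semidirect (monodromy_group T l)
               (power_group (alt_group p) 2) (integer_mod_group 4)) \<and>
            (even r \<longrightarrow> iso_semidirect (monodromy_group T l)
               (power_group (sym_group p) 2) (integer_mod_group 4))) \<and>
          (consecutive_leaves T c \<longrightarrow>
            (even r \<longrightarrow>
              (\<exists>\<psi>\<in>actions (power_group (integer_mod_group 2) 3) (integer_mod_group 4).
                iso_semidirect (monodromy_group T l) (power_group (alt_group p) 4)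
                  (semidirect_product (power_group (integer_mod_group 2) 3) (integer_mod_group 4) \<psi>))) \<and>
            (odd r \<longrightarrow> iso_semidirect (monodromy_group T l)
               (power_group (alt_group p) 4) (integer_mod_group 4))))"
    if T: "plane_tree T" "P T" for T
  proof -
    obtain k h where c: "coord_tree T r k h" using coord[OF T] by blast
    interpret C: coord_tree T r k h by (rule c)
    \<comment> \<open>By \<open>consecutive_iff\<close> the two cases of the statement are
      \<open>k = 2\<close> and \<open>k = 1\<close>.\<close>
    show ?thesis
      using C.is_center_iff C.consecutive_iff C.k C.iso_semidirect_opposite
        C.iso_semidirect_consecutive
      unfolding p by auto
  qed
  show ?thesis using A B unfolding P_def by blast
qed

end
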